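(* Under the standing assumptions below, the following hold. (a) The doubly indexed family $\{N^k_n\}_{k,n\geq 1}$ obeys the $(k,n)$-LDP in $\mathcal{P}(\mathbb{R}^d)$ with the rate function $$T(\nu)=\mathcal{T}_c(\mu,\nu),\qquad \nu\in\mathcal{P}(\mathbb{R}^d),$$ where the cost function is $c(x_0,x_1)=c_{x_0}(x_1)$, $x_0,x_1\in\mathbb{R}^d$. In the special case $U^k_z=z+U^k$, where $\{U^k\}_{k\geq1}$ is a sequence of $\mathbb{R}^d$-valued random variables obeying the $k$-LDP in $\mathbb{R}^d$ with good rate function $c:\mathbb{R}^d\to[0,\infty]$, one has $c(x_0,x_1)=c(x_1-x_0)$. (b) (Kantorovich duality) For all $\nu\in\mathcal{P}(\mathbb{R}^d)$, $$\mathcal{T}_c(\mu,\nu)=\sup_{f\in C_b(\mathbb{R}^d)}\Big\{\int_{\mathbb{R}^d}\mathcal{S}_1f(x_0)\,\mu(dx_0)-\int_{\mathbb{R}^d}f(x_1)\,\nu(dx_1)\Big\},$$ where $\mathcal{S}_1f(z)=\inf_{x_1\in\mathbb{R}^d}\{c(z,x_1)+f(x_1)\}$, $z\in\mathbb{R}^d$.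
   Context: $\mathcal{P}(E)$ denotes the set of Borel probability measures on a Polish space $E$, equipped with the narrow topology (weak convergence against $C_b(E)$, the bounded continuous functions) and its Borel $\sigma$-field. A family $(P_z)_{z\in\mathcal{Z}}$ of probability measures on $\mathcal{X}$ is a Feller system if $z\mapsto\int f\,dP_z$ is continuous for every $f\in C_b(\mathcal{X})$. A sequence $\{V_k\}$ of random variables in a topological space obeys the $k$-LDP with rate function $I$ ($I$ lower semicontinuous, $[0,\infty]$-valued) if for all measurable $A$: $-\inf_{\mathrm{int}A}I\le\liminf_k\frac1k\log\mathbb{P}(V_k\in A)\le\limsup_k\frac1k\log\mathbb{P}(V_k\in A)\le-\inf_{\mathrm{cl}A}I$; $I$ is good if its level sets are compact. A doubly indexed family $\{L^k_n\}_{k,n\geq1}$ of $\mathcal{P}(\mathcal{X})$-valued random variables obeys the $(k,n)$-LDP with rate function $I:\mathcal{P}(\mathcal{X})\to[0,\infty]$ if for every measurable $B\subset\mathcal{P}(\mathcal{X})$, $$-\inf_{\mathrm{int}B}I\le\liminf_{k\to\infty}\liminf_{n\to\infty}\tfrac{1}{kn}\log\mathbb{P}(L^k_n\in B)\le\limsup_{k\to\infty}\limsup_{n\to\infty}\tfrac{1}{kn}\log\mathbb{P}(L^k_n\in B)\le-\inf_{\mathrm{cl}B}I.$$ Standing assumptions: $\mu\in\mathcal{P}(\mathbb{R}^d)$; $(z_{n,i}\in\mathbb{R}^d;1\le i\le n,n\ge1)$ is a triangular array with $\frac1n\sum_{i=1}^n\delta_{z_{n,i}}\to\mu$ narrowly;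 for each $z\in\mathbb{R}^d$, $\{U^k_z\}_{k\ge1}$ is a sequence of $\mathbb{R}^d$-valued random variables; for each $k$, $(\mathrm{Law}(U^k_z);z\in\mathbb{R}^d)$ is a Feller system; for each $z$, $\{U^k_z\}_{k\ge1}$ obeys the $k$-LDP in $\mathbb{R}^d$ with a good rate function $c_z:\mathbb{R}^d\to[0,\infty]$. For each $k,n$, $(X^k_{n,i}(1))_{1\le i\le n}$ are independent with $X^k_{n,i}(1)$ distributed as $U^k_{z_{n,i}}$, and $N^k_n=\frac1n\sum_{i=1}^n\delta_{X^k_{n,i}(1)}$. For $\mu,\nu\in\mathcal{P}(\mathbb{R}^d)$, $\Pi(\mu,\nu)$ is the set of $\rho\in\mathcal{P}(\mathbb{R}^d\times\mathbb{R}^d)$ with marginals $\rho_0=\mu$, $\rho_1=\nu$, and $\mathcal{T}_c(\mu,\nu)=\inf_{\rho\in\Pi(\mu,\nu)}\int c\,d\rho$. *)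

theory Defs
  imports "HOL-Probability.Probability"
begin

definition prob_measures :: "'a::topological_space measure set" where
  "prob_measures = {M. prob_space M \<and> sets M = sets (borel :: 'a measure)}"

definition Cb :: "('a::topological_space \<Rightarrow> real) set" where
  "Cb = {f. continuous_on UNIV f \<and> bounded (range f)}"

definition narrow_topology :: "'a::topological_space measure topology" where
  "narrow_topology = topology_generated_by
     {{M \<in> prob_measures. (\<integral>x. f x \<partial>M) \<in> U} | f U. f \<in> Cb \<and> open U}"

definition narrow_borel :: "'a::topological_space measure set set" where
  "narrow_borel = sigma_sets prob_measures {U. openin narrow_topology U}"

definition narrow_conv :: "(nat \<Rightarrow> 'a::topological_space measure) \<Rightarrow> 'a measure \<Rightarrow> bool" where
  "narrow_conv Ms M \<longleftrightarrow> (\<forall>f\<in>Cb. (\<lambda>n. \<integral>x. f x \<partial>Ms n) \<longlonglongrightarrow> (\<integral>x. f x \<partial>M))"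

definition empirical :: "nat \<Rightarrow> (nat \<Rightarrow> 'a::topological_space) \<Rightarrow> 'a measure" where
  "empirical n x = distr (uniform_count_measure {1..n}) borel x"

definition feller :: "('z::topological_space \<Rightarrow> 'a::topological_space measure) \<Rightarrow> bool" where
  "feller P \<longleftrightarrow> (\<forall>f\<in>Cb. continuous_on UNIV (\<lambda>z. \<integral>x. f x \<partial>P z))"

definition eln :: "real \<Rightarrow> ereal" where
  "eln p = (if p \<le> 0 then -\<infinity> else ereal (ln p))"

definition good_rate_function :: "('a::topological_space \<Rightarrow> ennreal) \<Rightarrow> bool" where
  "good_rate_function I \<longleftrightarrow> (\<forall>t. closed {x. I x \<le> t}) \<and> (\<forall>t<top. compact {x. I x \<le> t})"

text \<open>k-LDP for a sequence of random variables, expressed through their laws P k.\<close>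
definition k_LDP :: "(nat \<Rightarrow> 'a::topological_space measure) \<Rightarrow> ('a \<Rightarrow> ennreal) \<Rightarrow> bool" where
  "k_LDP P I \<longleftrightarrow> (\<forall>t. closed {x. I x \<le> t}) \<and>
     (\<forall>A\<in>sets borel.
        - enn2ereal (INF x\<in>interior A. I x)
          \<le> liminf (\<lambda>k. ereal (1 / real k) * eln (measure (P k) A)) \<and>
        liminf (\<lambda>k. ereal (1 / real k) * eln (measure (P k) A))
          \<le> limsup (\<lambda>k. ereal (1 / real k) * eln (measure (P k) A)) \<and>
        limsup (\<lambda>k. ereal (1 / real k) * eln (measure (P k) A))
          \<le> - enn2ereal (INF x\<in>closure A. I x))"

definition kn_LDP :: "'w measure \<Rightarrow> (nat \<Rightarrow> nat \<Rightarrow> 'w \<Rightarrow> 'a::topological_space measure)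
    \<Rightarrow> ('a measure \<Rightarrow> ennreal) \<Rightarrow> bool" where
  "kn_LDP \<Omega> L I \<longleftrightarrow> (\<forall>t. closedin narrow_topology {\<nu>\<in>prob_measures. I \<nu> \<le> t}) \<and>
     (\<forall>B\<in>narrow_borel.
        let p = (\<lambda>k n. ereal (1 / (real k * real n)) * eln (measure \<Omega> {\<omega>\<in>space \<Omega>. L k n \<omega> \<in> B}))
        in - enn2ereal (INF \<nu>\<in>narrow_topology interior_of B. I \<nu>)
             \<le> liminf (\<lambda>k. liminf (\<lambda>n. p k n)) \<and>
           liminf (\<lambda>k. liminf (\<lambda>n. p k n)) \<le> limsup (\<lambda>k. limsup (\<lambda>n. p k n)) \<and>
           limsup (\<lambda>k. limsup (\<lambda>n. p k n))
             \<le> - enn2ereal (INF \<nu>\<in>narrow_topology closure_of B. I \<nu>))"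

definition couplings :: "'a::topological_space measure \<Rightarrow> 'a measure \<Rightarrow> ('a \<times> 'a) measure set" where
  "couplings \<mu> \<nu> = {\<rho>. prob_space \<rho> \<and> sets \<rho> = sets (borel :: ('a \<times> 'a) measure) \<and>
      distr \<rho> borel fst = \<mu> \<and> distr \<rho> borel snd = \<nu>}"

definition transport_cost :: "('a::topological_space \<Rightarrow> 'a \<Rightarrow> ennreal) \<Rightarrow> 'a measure \<Rightarrow> 'a measure \<Rightarrow> ennreal" where
  "transport_cost c \<mu> \<nu> = (INF \<rho>\<in>couplings \<mu> \<nu>. \<integral>\<^sup>+ p. c (fst p) (snd p) \<partial>\<rho>)"

definition S1 :: "('a \<Rightarrow> 'a \<Rightarrow> ennreal) \<Rightarrow> ('a \<Rightarrow> real) \<Rightarrow> 'a \<Rightarrow> ereal" where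
  "S1 c f z = (INF x1. enn2ereal (c z x1) + ereal (f x1))"

end

theory Submission
  imports Defs
begin

text \<open>Idea. Write \<open>G k f z = - (1 / k) * ln (\<integral> exp (- k * f) dP k z)\<close>. It is continuous in \<open>z\<close> by the Feller
  property and tends to \<open>S f z\<close>, the infimum of \<open>c z + f\<close>, by Varadhan's lemma. For fixed \<open>k\<close>, the
  logarithmic Laplace transform of the empirical measure at \<open>- k * n * f\<close> is, divided by \<open>k * n\<close>, the
  average of \<open>- G k f\<close> over the \<open>z n i\<close>, so letting first \<open>n\<close> and then \<open>k\<close> tend to infinity produces
  \<open>- \<integral> S f d\<mu>\<close>, and the natural rate function is
  the dual functional \<open>\<nu> \<mapsto> sup (\<integral> S f d\<mu> - \<integral> f d\<nu>)\<close> over bounded continuous \<open>f\<close>.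

  The upper bound is Chernoff's inequality together with a compactness argument: test functions of the
  form \<open>- M * cutoff R\<close> turn a bound on finitely many dual values into tightness. Prokhorov's theorem
  in Euclidean space is reduced to Helly's theorem on the line by Schoenberg's space-filling curve.

  For the lower bound, fix finitely many test functions and minimise the dual problem penalised by a
  small multiple of the squared coefficients. Tilting every \<open>P k z\<close> by \<open>exp (- k * f)\<close> for a near
  minimiser \<open>f\<close> produces laws whose \<open>\<mu>\<close>-mixture is close to \<open>\<nu>\<close> at an entropic cost per unit not much
  larger than the dual value; a change of measure and Chebyshev's inequality conclude.

  The same tilted laws, glued to \<open>\<mu>\<close>, form a tight sequence of measures on the product. Gibbs'
  variational inequality, tested on finite maxima of \<open>G k f x - f y\<close>, bounds the cost of a limit point
  by the dual value, which is Kantorovich duality with attainment.\<close>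

text \<open>Each \<open>c x\<close> has compact level sets, but nothing uniform in \<open>k\<close>
  ties \<open>c x\<close> to \<open>c x'\<close> at nearby points, so \<open>c\<close> is not known
  to be jointly lower semicontinuous and \<open>S f\<close> need not be continuous. Hence
  \<open>S f\<close> enters only as the pointwise limit of the continuous \<open>G k f\<close>:
  narrow convergence is applied to \<open>G k f\<close> with \<open>k\<close> frozen, and
  \<open>k\<close> is released afterwards by dominated convergence. The cost is recovered as a
  countable supremum of functions \<open>S f x - f y\<close>, which also makes it measurable on the
  product.

  The convergence of the integrals of \<open>G k f\<close> is not uniform in \<open>f\<close>,
  whereas the tilt chosen at level \<open>k\<close> varies with \<open>k\<close>. The penalty
  answers this: it confines the coefficients to a box that does not depend on \<open>k\<close>, and
  on a box a finite grid restores uniformity. Its size also measures how far the tilted mean may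
  stay from \<nu>.

  Bounded continuous functions on a noncompact space are not separable in the supremum norm.
  Countable families therefore approximate by bounded increasing limits only, and \<open>S\<close>
  respects these because the level sets of \<open>c x\<close> are compact.\<close>

lemma Cb_D: assumes "f \<in> Cb" shows "continuous_on UNIV f" "\<exists>B>0. \<forall>x. \<bar>f x\<bar> \<le> B"
  using assms by (auto simp: Cb_def bounded_pos)

lemma Cb_I: "continuous_on UNIV f \<Longrightarrow> (\<And>x. \<bar>f x\<bar> \<le> B) \<Longrightarrow> f \<in> Cb"
  by (auto simp: Cb_def intro!: boundedI[of _ B])

lemma Cb_const: "(\<lambda>_. a) \<in> Cb"
  by (rule Cb_I[where B="\<bar>a\<bar>"]) auto

lemma Cb_add: assumes "f \<in> Cb" "g \<in> Cb" shows "(\<lambda>x. f x + g x) \<in> Cb"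
proof -
  obtain A B where "\<And>x. \<bar>f x\<bar> \<le> A" "\<And>x. \<bar>g x\<bar> \<le> B" using assms Cb_D by meson
  then have "\<And>x. \<bar>f x + g x\<bar> \<le> A + B" by (metis abs_triangle_ineq add_mono order_trans)
  with assms show ?thesis by (intro Cb_I continuous_intros) (auto dest: Cb_D)
qed

lemma Cb_mult: assumes "f \<in> Cb" "g \<in> Cb" shows "(\<lambda>x. f x * g x) \<in> Cb"
proof -
  obtain A B where "A > 0" "\<And>x. \<bar>f x\<bar> \<le> A" "\<And>x. \<bar>g x\<bar> \<le> B" using assms Cb_D by meson
  then have "\<And>x. \<bar>f x * g x\<bar> \<le> A * B" by (simp add: abs_mult mult_mono)
  with assms show ?thesis by (intro Cb_I continuous_intros) (auto dest: Cb_D)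
qed

lemma Cb_cmult: "f \<in> Cb \<Longrightarrow> (\<lambda>x. a * f x) \<in> Cb"
  using Cb_mult[OF Cb_const] .

lemma Cb_uminus: "f \<in> Cb \<Longrightarrow> (\<lambda>x. - f x) \<in> Cb"
  using Cb_cmult[of f "-1"] by simp

lemma Cb_diff: "f \<in> Cb \<Longrightarrow> g \<in> Cb \<Longrightarrow> (\<lambda>x. f x - g x) \<in> Cb"
  using Cb_add[OF _ Cb_uminus] by fastforce

lemma Cb_sum: "(\<And>i. i \<in> I \<Longrightarrow> f i \<in> Cb) \<Longrightarrow> (\<lambda>x. \<Sum>i\<in>I. f i x) \<in> Cb"
  by (induction I rule: infinite_finite_induct) (auto intro: Cb_add Cb_const)

lemma Cb_max: assumes "f \<in> Cb" "g \<in> Cb" shows "(\<lambda>x. max (f x) (g x)) \<in> Cb"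
proof -
  obtain A B where "\<And>x. \<bar>f x\<bar> \<le> A" "\<And>x. \<bar>g x\<bar> \<le> B" using assms Cb_D by meson
  then have "\<And>x. \<bar>max (f x) (g x)\<bar> \<le> max A B" by (auto simp: max_def abs_le_iff) (metis linear order_trans)+
  with assms show ?thesis by (intro Cb_I continuous_intros) (auto dest: Cb_D)
qed

lemma Cb_exp: assumes "f \<in> Cb" shows "(\<lambda>x. exp (f x)) \<in> Cb"
proof -
  obtain A where "\<And>x. \<bar>f x\<bar> \<le> A" using assms Cb_D by meson
  then have "\<And>x. \<bar>exp (f x)\<bar> \<le> exp A" by (simp add: abs_le_iff)
  with assms show ?thesis by (intro Cb_I continuous_intros) (auto dest: Cb_D)
qed

lemma Cb_compose: "f \<in> Cb \<Longrightarrow> continuous_on UNIV h \<Longrightarrow> (\<lambda>x. f (h x)) \<in> Cb"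
  using Cb_D[of f]
  by (metis Cb_I continuous_on_compose2 subset_UNIV)

lemma Cb_borel: "f \<in> Cb \<Longrightarrow> f \<in> borel_measurable borel"
  by (auto simp: Cb_def intro: borel_measurable_continuous_onI)

section \<open>Borel probability measures and bounded integrands\<close>

lemma prob_measuresD:
  assumes "M \<in> prob_measures"
  shows "prob_space M" "sets M = sets borel" "space M = UNIV" "measurable M N = measurable borel N"
    "measurable N M = measurable N borel"
proof -
  show "prob_space M" and s: "sets M = sets borel" using assms by (auto simp: prob_measures_def)
  show "space M = UNIV" using sets_eq_imp_space_eq[OF s] by simp
  show "measurable M N = measurable borel N" "measurable N M = measurable N borel"
    by (auto intro!: measurable_cong_sets simp: s)
qed

lemma integrable_bounded:
  assumes "M \<in> prob_measures" "f \<in> borel_measurable borel" "\<And>x. \<bar>f x :: real\<bar> \<le> B"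
  shows "integrable M f"
proof -
  interpret prob_space M using assms prob_measuresD by blast
  show ?thesis using assms prob_measuresD[OF assms(1)] by (intro integrable_const_bound[of _ B]) auto
qed

lemma Cb_integrable: assumes "M \<in> prob_measures" "f \<in> Cb" shows "integrable M f"
  using Cb_D[OF assms(2)] integrable_bounded[OF assms(1) Cb_borel[OF assms(2)]] by blast

lemma integral_mono_bounded:
  assumes "M \<in> prob_measures" "integrable M f" "integrable M g" "\<And>x. f x \<le> (g x :: real)"
  shows "integral\<^sup>L M f \<le> integral\<^sup>L M g"
  using assms by (intro integral_mono) auto

lemma integral_le_bound:
  assumes "M \<in> prob_measures" "integrable M f" "\<And>x. f x \<le> (B::real)"
  shows "integral\<^sup>L M f \<le> B"
proof -
  interpret prob_space M using assms prob_measuresD by blast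
  show ?thesis using assms(2,3) by (intro integral_le_const) auto
qed

lemma integral_ge_bound:
  assumes "M \<in> prob_measures" "integrable M f" "\<And>x. (B::real) \<le> f x"
  shows "B \<le> integral\<^sup>L M f"
proof -
  interpret prob_space M using assms prob_measuresD by blast
  show ?thesis using assms(2,3) by (intro integral_ge_const) auto
qed

lemma integral_abs_bound:
  assumes "M \<in> prob_measures" "integrable M f" "\<And>x. \<bar>f x\<bar> \<le> (B::real)"
  shows "\<bar>integral\<^sup>L M f\<bar> \<le> B"
proof -
  have "-B \<le> f x" "f x \<le> B" for x using assms(3)[of x] by linarith+
  from integral_ge_bound[OF assms(1,2) this(1)] integral_le_bound[OF assms(1,2) this(2)]
  show ?thesis by linarith
qed

lemma prob_measures_distr:
  assumes "M \<in> prob_measures" "h \<in> borel_measurable borel"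
  shows "distr M borel h \<in> prob_measures"
  using assms prob_measuresD[OF assms(1)] by (auto simp: prob_measures_def intro!: prob_space.prob_space_distr)

text \<open>The distance to the closed set \<open>-U\<close> is positive exactly on
  \<open>U\<close>. The case \<open>U = UNIV\<close> is excluded because \<open>infdist\<close> to
  the empty set is 0 by convention, which would make every approximant vanish.\<close>

lemma Cb_open_approx:
  assumes "open (U :: 'a::metric_space set)" "U \<noteq> UNIV"
  shows "(\<lambda>x. min 1 (real n * infdist x (-U))) \<in> Cb"
    "(\<lambda>n. min 1 (real n * infdist x (-U))) \<longlonglongrightarrow> indicator U x"
proof -
  show "(\<lambda>x. min 1 (real n * infdist x (-U))) \<in> Cb"
    by (rule Cb_I[where B=1]) (auto intro!: continuous_intros simp: abs_le_iff infdist_nonneg)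
  show "(\<lambda>n. min 1 (real n * infdist x (-U))) \<longlonglongrightarrow> indicator U x"
  proof (cases "x \<in> U")
    case True
    then have pos: "infdist x (-U) > 0"
      using assms in_closed_iff_infdist_zero[of "-U" x] infdist_nonneg[of x "-U"]
      by (auto simp: less_le)
    then obtain N where N: "1 \<le> real N * infdist x (-U)"
      using ex_less_of_nat_mult[OF pos, of 1] less_imp_le by blast
    have "\<forall>\<^sub>F n in sequentially. min 1 (real n * infdist x (-U)) = indicator U x"
      using eventually_ge_at_top[of N]
    proof eventually_elim
      case (elim n)
      then have "real N * infdist x (-U) \<le> real n * infdist x (-U)" using pos by (intro mult_right_mono) auto
      with N True show ?case by auto
    qed
    then show ?thesis by (rule tendsto_eventually)
  next
    case False
    then show ?thesis by simp
  qed
qed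

text \<open>Test integrals determine the mass of every open set through the approximants above, and
  the open sets form an intersection-stable generator.\<close>

lemma prob_measures_eqI:
  assumes M: "M \<in> prob_measures" and N: "(N :: 'a::metric_space measure) \<in> prob_measures"
    and eq: "\<And>f. f \<in> Cb \<Longrightarrow> (\<integral>x. f x \<partial>M) = (\<integral>x. f x \<partial>N)"
  shows "M = N"
proof -
  interpret M: prob_space M using M prob_measuresD by blast
  interpret N: prob_space N using N prob_measuresD by blast
  have *: "measure M U = measure N U" if U: "open U" for U
  proof (cases "U = UNIV")
    case True
    then show ?thesis using M.prob_space N.prob_space prob_measuresD[OF M] prob_measuresD[OF N] by simp
  next
    case False
    let ?f = "\<lambda>n x. min 1 (real n * infdist x (-U))"
    have L: "(\<lambda>n. integral\<^sup>L K (?f n)) \<longlonglongrightarrow> measure K U" if K: "K \<in> prob_measures" for K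
    proof -
      interpret K: prob_space K using K prob_measuresD by blast
      note [measurable_cong] = prob_measuresD(2)[OF K]
      have "(\<lambda>n. integral\<^sup>L K (?f n)) \<longlonglongrightarrow> integral\<^sup>L K (indicator U)"
        using U Cb_open_approx[OF U False]
        by (intro integral_dominated_convergence[where w="\<lambda>_. 1"])
           (auto simp: prob_measuresD[OF K] abs_le_iff infdist_nonneg intro!: Cb_borel)
      then show ?thesis using U by (simp add: prob_measuresD[OF K])
    qed
    show ?thesis
      using L[OF M] L[OF N] eq[OF Cb_open_approx(1)[OF U False]] by (simp add: LIMSEQ_unique)
  qed
  show ?thesis
  proof (rule measure_eqI_generator_eq[where E="{U. open U}" and \<Omega>=UNIV and A="\<lambda>_. UNIV"])
    show "Int_stable {U :: 'a set. open U}" by (auto simp: Int_stable_def)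
    show "emeasure M X = emeasure N X" if "X \<in> {U. open U}" for X
      using * that by (simp add: M.emeasure_eq_measure N.emeasure_eq_measure)
    show "sets M = sigma_sets UNIV {U. open U}" "sets N = sigma_sets UNIV {U. open U}"
      using prob_measuresD[OF M] prob_measuresD[OF N] by (auto simp: borel_def)
  qed auto
qed

section \<open>The narrow topology\<close>

lemma Union_narrow_subbase:
  "\<Union>{{M \<in> prob_measures. (\<integral>x. f x \<partial>M) \<in> U} | f U. f \<in> Cb \<and> open U} = prob_measures"
proof -
  have "prob_measures \<in> {{M \<in> prob_measures. (\<integral>x. f x \<partial>M) \<in> U} | f U. f \<in> Cb \<and> open U}"
    using Cb_const[of 0] by (intro CollectI exI[of _ "\<lambda>_. 0"] exI[of _ UNIV]) auto
  then show ?thesis by blast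
qed

lemma topspace_narrow: "topspace narrow_topology = prob_measures"
  unfolding narrow_topology_def topology_generated_by_topspace by (rule Union_narrow_subbase)

lemma openin_narrow_basic:
  "f \<in> Cb \<Longrightarrow> open U \<Longrightarrow> openin narrow_topology {M \<in> prob_measures. (\<integral>x. f x \<partial>M) \<in> U}"
  unfolding narrow_topology_def by (rule topology_generated_by_Basis) auto

text \<open>Induction along the generation of the topology. This is what reduces the lower bound on
  open sets to finitely many test functions and one tolerance.\<close>

lemma narrow_open_nbhd:
  assumes "openin narrow_topology U" "\<nu> \<in> U"
  obtains F \<epsilon> where "finite F" "F \<subseteq> Cb" "\<epsilon> > 0"
    "\<And>M. M \<in> prob_measures \<Longrightarrow> (\<And>f. f \<in> F \<Longrightarrow> \<bar>(\<integral>x. f x \<partial>M) - (\<integral>x. f x \<partial>\<nu>)\<bar> < \<epsilon>) \<Longrightarrow> M \<in> U"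
proof -
  let ?P = "\<lambda>U. \<forall>\<nu>\<in>U. \<exists>F \<epsilon>. finite F \<and> F \<subseteq> Cb \<and> \<epsilon> > 0 \<and>
    (\<forall>M\<in>prob_measures. (\<forall>f\<in>F. \<bar>(\<integral>x. f x \<partial>M) - (\<integral>x. f x \<partial>\<nu>)\<bar> < \<epsilon>) \<longrightarrow> M \<in> U)"
  from assms(1) have "generate_topology_on
     {{M \<in> prob_measures. (\<integral>x. f x \<partial>M) \<in> U} | f U. f \<in> Cb \<and> open U} U"
    by (simp add: narrow_topology_def openin_topology_generated_by_iff)
  then have "?P U"
  proof induction
    case Empty
    then show ?case by simp
  next
    case (Int a b)
    show ?case
    proof
      fix \<nu> assume "\<nu> \<in> a \<inter> b"
      then have "\<nu> \<in> a" "\<nu> \<in> b" by auto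
      from bspec[OF Int.IH(1) this(1)] bspec[OF Int.IH(2) this(2)]
      obtain F \<epsilon> F' \<epsilon>' where "finite F" "F \<subseteq> Cb" "\<epsilon> > 0"
        "\<forall>M\<in>prob_measures. (\<forall>f\<in>F. \<bar>(\<integral>x. f x \<partial>M) - (\<integral>x. f x \<partial>\<nu>)\<bar> < \<epsilon>) \<longrightarrow> M \<in> a"
        "finite F'" "F' \<subseteq> Cb" "\<epsilon>' > 0"
        "\<forall>M\<in>prob_measures. (\<forall>f\<in>F'. \<bar>(\<integral>x. f x \<partial>M) - (\<integral>x. f x \<partial>\<nu>)\<bar> < \<epsilon>') \<longrightarrow> M \<in> b"
        by (elim exE conjE) (rule that)
      then show "\<exists>F \<epsilon>. finite F \<and> F \<subseteq> Cb \<and> \<epsilon> > 0 \<and>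
        (\<forall>M\<in>prob_measures. (\<forall>f\<in>F. \<bar>(\<integral>x. f x \<partial>M) - (\<integral>x. f x \<partial>\<nu>)\<bar> < \<epsilon>) \<longrightarrow> M \<in> a \<inter> b)"
        by (intro exI[of _ "F \<union> F'"] exI[of _ "min \<epsilon> \<epsilon>'"]) auto
    qed
  next
    case (UN K)
    show ?case
    proof
      fix \<nu> assume "\<nu> \<in> \<Union>K"
      then obtain k where k: "k \<in> K" "\<nu> \<in> k" by blast
      from bspec[OF UN.IH[OF k(1)] k(2)] k(1)
      show "\<exists>F \<epsilon>. finite F \<and> F \<subseteq> Cb \<and> \<epsilon> > 0 \<and>
        (\<forall>M\<in>prob_measures. (\<forall>f\<in>F. \<bar>(\<integral>x. f x \<partial>M) - (\<integral>x. f x \<partial>\<nu>)\<bar> < \<epsilon>) \<longrightarrow> M \<in> \<Union>K)"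
        by (elim ex_forward conj_forward) blast+
    qed
  next
    case (Basis s)
    then obtain f U where s: "s = {M \<in> prob_measures. (\<integral>x. f x \<partial>M) \<in> U}" "f \<in> Cb" "open U" by blast
    show ?case
    proof
      fix \<nu> assume "\<nu> \<in> s"
      then obtain \<epsilon> where "\<epsilon> > 0" "\<And>y. \<bar>y - (\<integral>x. f x \<partial>\<nu>)\<bar> < \<epsilon> \<Longrightarrow> y \<in> U"
        using s open_dist[of U] by (auto simp: dist_real_def)
      then show "\<exists>F \<epsilon>. finite F \<and> F \<subseteq> Cb \<and> \<epsilon> > 0 \<and>
        (\<forall>M\<in>prob_measures. (\<forall>f\<in>F. \<bar>(\<integral>x. f x \<partial>M) - (\<integral>x. f x \<partial>\<nu>)\<bar> < \<epsilon>) \<longrightarrow> M \<in> s)"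
        using s by (intro exI[of _ "{f}"] exI[of _ \<epsilon>]) auto
    qed
  qed
  from bspec[OF this assms(2)] show ?thesis
    by (elim exE conjE) (rule that; blast)
qed

lemma narrow_conv_eventually_in:
  assumes conv: "narrow_conv Ms M" and U: "openin narrow_topology U" "M \<in> U"
    and Ms: "\<And>n. Ms n \<in> prob_measures"
  shows "\<forall>\<^sub>F n in sequentially. Ms n \<in> U"
proof -
  obtain F \<epsilon> where F: "finite F" "F \<subseteq> Cb" "\<epsilon> > 0"
    "\<And>N. N \<in> prob_measures \<Longrightarrow> (\<And>f. f \<in> F \<Longrightarrow> \<bar>(\<integral>x. f x \<partial>N) - (\<integral>x. f x \<partial>M)\<bar> < \<epsilon>) \<Longrightarrow> N \<in> U"
    using narrow_open_nbhd[OF U] by blast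
  have "\<forall>\<^sub>F n in sequentially. \<forall>f\<in>F. \<bar>(\<integral>x. f x \<partial>Ms n) - (\<integral>x. f x \<partial>M)\<bar> < \<epsilon>"
  proof (intro eventually_ball_finite F(1) ballI)
    fix f assume "f \<in> F"
    then have "(\<lambda>n. \<integral>x. f x \<partial>Ms n) \<longlonglongrightarrow> (\<integral>x. f x \<partial>M)"
      using conv F(2) by (auto simp: narrow_conv_def)
    from tendstoD[OF this F(3)] show "\<forall>\<^sub>F n in sequentially. \<bar>(\<integral>x. f x \<partial>Ms n) - (\<integral>x. f x \<partial>M)\<bar> < \<epsilon>"
      by (simp add: dist_real_def)
  qed
  then show ?thesis by eventually_elim (use F Ms in auto)
qed

lemma narrow_closed_sequentially:
  assumes "closedin narrow_topology C" "narrow_conv Ms M" "\<And>n. Ms n \<in> C" "M \<in> prob_measures"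
  shows "M \<in> C"
proof (rule ccontr)
  assume "M \<notin> C"
  have "openin narrow_topology (prob_measures - C)" "C \<subseteq> prob_measures"
    using assms(1) by (auto simp: closedin_def topspace_narrow)
  from narrow_conv_eventually_in[OF assms(2) this(1)] this(2) assms \<open>M \<notin> C\<close>
  have "\<forall>\<^sub>F n in sequentially. Ms n \<in> prob_measures - C" by blast
  with assms(3) show False by (auto dest: eventually_happens)
qed

lemma empirical_prob_measures:
  assumes "n \<ge> 1" shows "empirical n x \<in> prob_measures"
proof -
  interpret prob_space "uniform_count_measure {1..n}"
    using assms by (intro prob_space_uniform_count_measure) auto
  have "prob_space (distr (uniform_count_measure {1..n}) borel x)" by (rule prob_space_distr) simp
  then show ?thesis by (simp add: empirical_def prob_measures_def)
qed

lemma integral_empirical: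
  assumes "f \<in> borel_measurable borel" "n \<ge> 1"
  shows "(\<integral>x. f x \<partial>empirical n x) = (\<Sum>i=1..n. f (x i) :: real) / real n"
proof -
  have "(\<integral>x. f x \<partial>empirical n x) = (\<integral>i. f (x i) \<partial>uniform_count_measure {1..n})"
    unfolding empirical_def by (rule integral_distr) (use assms in auto)
  also have "\<dots> = (\<Sum>i=1..n. f (x i)) / real n"
    by (simp add: uniform_count_measure_def lebesgue_integral_point_measure_finite sum_divide_distrib)
  finally show ?thesis .
qed

text \<open>Each test integral of \<open>empirical n x\<close> is a finite average of continuous
  functions of coordinates, so \<open>empirical n\<close> is continuous on the product
  space.\<close>

lemma open_empirical_vimage:
  assumes "openin narrow_topology U" "n \<ge> 1"
  shows "open {x :: nat \<Rightarrow> 'a::topological_space. empirical n x \<in> U}"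
proof -
  have "continuous_map euclidean narrow_topology (empirical n :: (nat \<Rightarrow> 'a) \<Rightarrow> 'a measure)"
    unfolding narrow_topology_def
  proof (rule continuous_on_generated_topo)
    fix U :: "'a measure set"
    assume "U \<in> {{M \<in> prob_measures. (\<integral>x. f x \<partial>M) \<in> U} | f U. f \<in> Cb \<and> open U}"
    then obtain f V where U: "U = {M \<in> prob_measures. (\<integral>x. f x \<partial>M) \<in> V}" "f \<in> Cb" "open V" by blast
    have "continuous_on UNIV (\<lambda>x. (\<Sum>i=1..n. f (x i)) / real n)"
      using Cb_D(1)[OF U(2)] assms(2)
      by (intro continuous_intros) (auto intro: continuous_on_compose2 continuous_on_product_coordinates)
    moreover have "empirical n -` U = (\<lambda>x. (\<Sum>i=1..n. f (x i)) / real n) -` V"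
      using assms(2) empirical_prob_measures[OF assms(2)] integral_empirical[OF Cb_borel[OF U(2)]]
      by (auto simp: U(1))
    ultimately show "openin euclidean (empirical n -` U \<inter> topspace euclidean)"
      using open_vimage[OF U(3)] by simp
  next
    show "empirical n ` topspace euclidean \<subseteq> \<Union>{{M \<in> prob_measures. (\<integral>x. f x \<partial>M) \<in> U} | f U. f \<in> Cb \<and> open U}"
      unfolding Union_narrow_subbase using empirical_prob_measures[OF assms(2)] by blast
  qed
  from openin_continuous_map_preimage[OF this assms(1)] show ?thesis by simp
qed

text \<open>Narrow Borel sets pull back to Borel sets of configurations, by induction on
  \<open>sigma_sets\<close>; the configuration is measurable because its coordinates are.\<close>

lemma empirical_event_sets:
  fixes X :: "nat \<Rightarrow> 'w \<Rightarrow> 'a::{second_countable_topology}"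
  assumes X: "\<And>i. i \<in> {1..n} \<Longrightarrow> X i \<in> borel_measurable M" and "B \<in> narrow_borel" "n \<ge> 1"
  shows "{\<omega>\<in>space M. empirical n (\<lambda>i. X i \<omega>) \<in> B} \<in> sets M"
proof -
  \<comment> \<open>Coordinates outside \<open>{1..n}\<close> carry no measurability assumption.
    Freezing them at a constant makes the whole sequence measurable and leaves the empirical measure
    unchanged.\<close>
  define Y where "Y \<omega> = (\<lambda>i. if i \<in> {1..n} then X i \<omega> else undefined)" for \<omega>
  have "(\<lambda>\<omega>. Y \<omega> i) \<in> borel_measurable M" for i
    using X[of i] by (cases "i \<in> {1..n}") (auto simp: Y_def)
  then have Y: "Y \<in> borel_measurable M" by (rule measurable_coordinatewise_then_product)
  have E: "empirical n (\<lambda>i. X i \<omega>) = empirical n (Y \<omega>)" for \<omega>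
    unfolding empirical_def by (rule distr_cong) (auto simp: Y_def space_uniform_count_measure)
  have "{x. empirical n x \<in> B} \<in> sets (borel :: (nat \<Rightarrow> 'a) measure)"
    using assms(2) unfolding narrow_borel_def
  proof (induction rule: sigma_sets.induct)
    case (Basic a)
    then show ?case using open_empirical_vimage[of a n] assms(3) by simp
  next
    case (Compl a)
    have "{x. empirical n x \<in> prob_measures - a} = UNIV - {x. empirical n x \<in> a}"
      using empirical_prob_measures[OF assms(3)] by auto
    then show ?case using sets.compl_sets[OF Compl.IH] by simp
  next
    case (Union a)
    have "{x. empirical n x \<in> (\<Union>i. a i)} = (\<Union>i. {x. empirical n x \<in> a i})" by auto
    moreover have "range (\<lambda>i. {x. empirical n x \<in> a i}) \<subseteq> sets borel" using Union.IH by blast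
    ultimately show ?case by (simp only: sets.countable_UN)
  qed simp
  from measurable_sets[OF Y this]
  have "Y -` {x. empirical n x \<in> B} \<inter> space M \<in> sets M" .
  also have "Y -` {x. empirical n x \<in> B} \<inter> space M = {\<omega>\<in>space M. empirical n (\<lambda>i. X i \<omega>) \<in> B}"
    unfolding E by blast
  finally show ?thesis .
qed

section \<open>Prokhorov's theorem in Euclidean space\<close>

text \<open>The closed-set half of the portmanteau theorem: continuous approximants of the indicator
  of \<open>-C\<close> from below transfer the upper bound \<open>1 - p\<close> on the mass of
  \<open>-C\<close> to the limit.\<close>

lemma narrow_conv_closed_ge:
  fixes C :: "'a::metric_space set"
  assumes conv: "narrow_conv Ms M" and M: "M \<in> prob_measures" and Ms: "\<And>j. Ms j \<in> prob_measures"
    and C: "closed C" "p > 0" and ge: "\<forall>\<^sub>F j in sequentially. p \<le> measure (Ms j) C"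
  shows "p \<le> measure M C"
proof -
  interpret M: prob_space M using M prob_measuresD by blast
  interpret Ms: prob_space "Ms j" for j using Ms prob_measuresD by blast
  note [measurable_cong] = prob_measuresD(2)[OF M] prob_measuresD(2)[OF Ms]
  \<comment> \<open>Positivity of \<open>p\<close> excludes an empty \<open>C\<close>, whose
    complement would fall under the excluded case of the approximation.\<close>
  have "C \<noteq> {}" using C(2) eventually_happens[OF ge] by auto
  then have U: "open (-C)" "-C \<noteq> UNIV" using C(1) by (simp_all add: open_closed, blast)
  let ?f = "\<lambda>n x. min 1 (real n * infdist x C)"
  note approx = Cb_open_approx[OF U, simplified]
  have "(\<integral>x. ?f n x \<partial>M) \<le> 1 - p" for n
  proof (rule tendsto_upperbound)
    show "(\<lambda>j. \<integral>x. ?f n x \<partial>Ms j) \<longlonglongrightarrow> (\<integral>x. ?f n x \<partial>M)"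
      using conv approx(1) by (auto simp: narrow_conv_def)
    show "\<forall>\<^sub>F j in sequentially. (\<integral>x. ?f n x \<partial>Ms j) \<le> 1 - p"
      using ge
    proof eventually_elim
      case (elim j)
      have "(\<integral>x. ?f n x \<partial>Ms j) \<le> (\<integral>x. indicator (-C) x \<partial>Ms j)"
      proof (rule integral_mono[OF Cb_integrable[OF Ms approx(1)]])
        show "integrable (Ms j) (\<lambda>x. indicator (-C) x :: real)"
          using C by (intro integrable_bounded[OF Ms, where B=1]) auto
        show "?f n x \<le> indicator (-C) x" for x by (simp add: indicator_def)
      qed
      also have "\<dots> = measure (Ms j) (UNIV - C)"
        using C by (simp add: prob_measuresD[OF Ms] Compl_eq_Diff_UNIV)
      also have "\<dots> = 1 - measure (Ms j) C"
        using C Ms.prob_compl[of C j] by (simp add: prob_measuresD[OF Ms])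
      finally show ?case using elim by simp
    qed
  qed simp
  moreover have "(\<lambda>n. \<integral>x. ?f n x \<partial>M) \<longlonglongrightarrow> (\<integral>x. indicator (-C) x \<partial>M)"
    using C approx
    by (intro integral_dominated_convergence[where w="\<lambda>_. 1"])
       (auto simp: prob_measuresD[OF M] abs_le_iff infdist_nonneg intro!: Cb_borel)
  ultimately have "(\<integral>x. indicator (-C) x \<partial>M) \<le> 1 - p"
    by (intro LIMSEQ_le_const2) auto
  moreover have "(\<integral>x. indicator (-C) x \<partial>M) = 1 - measure M C"
    using C M.prob_compl[of C] by (simp add: prob_measuresD[OF M] Compl_eq_Diff_UNIV)
  ultimately show ?thesis by simp
qed

subsection \<open>Schoenberg's space-filling curve\<close>

text \<open>A continuous function of period 2 which is 0 on \<open>[0, 1/3]\<close> and 1 on \<open>[2/3, 1]\<close>: for a real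
  whose ternary digits are \<open>2 * a k\<close> with \<open>a k \<in> {0, 1}\<close>, its value at \<open>3 ^ k * t\<close> is \<open>a k\<close>.\<close>

definition zigzag :: "real \<Rightarrow> real" where
  "zigzag t = max 0 (min 1 (3 * (arccos (cos (pi * t)) / pi) - 1))"

text \<open>The number with these binary digits. Through \<open>prod_encode\<close> the single
  parameter \<open>t\<close> stores digit \<open>n\<close> of coordinate \<open>i\<close> at its own
  ternary position, so one real number carries infinitely many coordinates.\<close>

definition schoenberg :: "nat \<Rightarrow> real \<Rightarrow> real" where
  "schoenberg i t = (\<Sum>n. zigzag (3 ^ prod_encode (n, i) * t) / 2 ^ Suc n)"

text \<open>Written as a difference of floors so that the partial sums of the binary expansion
  telescope.\<close>

definition binary_digit :: "nat \<Rightarrow> real \<Rightarrow> real" where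
  "binary_digit n x = of_int \<lfloor>2 ^ Suc n * x\<rfloor> - 2 * of_int \<lfloor>2 ^ n * x\<rfloor>"

lemma zigzag_bounds: "0 \<le> zigzag t" "zigzag t \<le> 1"
  by (auto simp: zigzag_def)

lemma continuous_on_zigzag: "continuous_on UNIV zigzag"
  unfolding zigzag_def by (intro continuous_intros) auto

text \<open>\<open>arccos (cos (pi * t)) / pi\<close> is the triangle wave giving the distance from
  \<open>t\<close> to the nearest even integer, which is \<open>s\<close> here.\<close>

lemma zigzag_shift:
  assumes "0 \<le> s" "s \<le> 1"
  shows "zigzag (2 * of_int m + s) = max 0 (min 1 (3 * s - 1))"
proof -
  have "cos (pi * (2 * of_int m + s)) = cos (2 * pi * of_int m + pi * s)" by (simp add: algebra_simps)
  also have "\<dots> = cos (pi * s)" by (simp add: cos_add)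
  finally show ?thesis using assms by (simp add: zigzag_def arccos_cos)
qed

lemma summable_half: "summable (\<lambda>n. 1 / 2 ^ Suc n :: real)" "(\<Sum>n. 1 / 2 ^ Suc n :: real) = 1"
  using power_half_series by (auto simp: sums_iff power_divide)

lemma continuous_on_schoenberg: "continuous_on UNIV (schoenberg i)"
proof -
  have "uniform_limit UNIV (\<lambda>N t. \<Sum>n<N. zigzag (3 ^ prod_encode (n, i) * t) / 2 ^ Suc n) (schoenberg i) sequentially"
    unfolding schoenberg_def[abs_def]
    by (rule Weierstrass_m_test[OF _ summable_half(1)])
       (auto intro!: divide_right_mono simp: zigzag_bounds)
  then show ?thesis
    by (rule uniform_limit_theorem[rotated])
       (auto intro!: always_eventually continuous_intros continuous_on_compose2[OF continuous_on_zigzag])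
qed

lemma binary_digit_cases: "binary_digit n x = 0 \<or> binary_digit n x = 1"
proof -
  have "\<lfloor>2 * y\<rfloor> = 2 * \<lfloor>y\<rfloor> \<or> \<lfloor>2 * y\<rfloor> = 2 * \<lfloor>y\<rfloor> + 1" for y :: real
    by linarith
  from this[of "2 ^ n * x"] show ?thesis
    by (auto simp: binary_digit_def mult.assoc)
qed

lemma binary_expansion:
  assumes "0 \<le> x" "x < 1"
  shows "(\<lambda>n. binary_digit n x / 2 ^ Suc n) sums x"
proof -
  have S: "(\<Sum>n<N. binary_digit n x / 2 ^ Suc n) = of_int \<lfloor>2 ^ N * x\<rfloor> / 2 ^ N" for N
  proof (induction N)
    case 0
    then show ?case using assms by (simp add: floor_eq_iff)
  next
    case (Suc N)
    then show ?case by (simp add: binary_digit_def field_simps)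
  qed
  have "(\<lambda>N. of_int \<lfloor>2 ^ N * x\<rfloor> / 2 ^ N) \<longlonglongrightarrow> x"
  proof (rule tendsto_sandwich[OF _ _ _ tendsto_const])
    have "(\<lambda>N. x - (1/2) ^ N) \<longlonglongrightarrow> x - 0"
      by (intro tendsto_intros) auto
    then show "(\<lambda>N. x - (1/2) ^ N) \<longlonglongrightarrow> x" by simp
    have "2 ^ N * x - 1 \<le> of_int \<lfloor>2 ^ N * x\<rfloor>" for N by linarith
    then have "(2 ^ N * x - 1) / 2 ^ N \<le> of_int \<lfloor>2 ^ N * x\<rfloor> / 2 ^ N" for N
      by (rule divide_right_mono) simp
    then show "\<forall>\<^sub>F N in sequentially. x - (1/2) ^ N \<le> of_int \<lfloor>2 ^ N * x\<rfloor> / 2 ^ N"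
      by (simp add: diff_divide_distrib power_divide)
    show "\<forall>\<^sub>F N in sequentially. of_int \<lfloor>2 ^ N * x\<rfloor> / 2 ^ N \<le> x"
      by (simp add: divide_le_eq mult.commute)
  qed
  then show ?thesis unfolding sums_def S .
qed

lemma summable_ternary:
  assumes "\<And>k. a k = 0 \<or> a k = (1::real)"
  shows "summable (\<lambda>k. 2 * a k / 3 ^ Suc k)" "0 \<le> (\<Sum>k. 2 * a k / 3 ^ Suc k)" "(\<Sum>k. 2 * a k / 3 ^ Suc k) \<le> 1"
proof -
  have g: "(\<lambda>k. 2 / 3 ^ Suc k :: real) sums 1"
    using sums_mult[OF geometric_sums[of "1/3::real"], of "2/3"] by (simp add: power_divide)
  have le: "0 \<le> 2 * a k / 3 ^ Suc k" "2 * a k / 3 ^ Suc k \<le> 2 / 3 ^ Suc k" for k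
    using assms[of k] by auto
  show s: "summable (\<lambda>k. 2 * a k / 3 ^ Suc k)"
    by (rule summable_comparison_test[OF _ sums_summable[OF g]]) (intro exI[of _ 0] allI impI, metis abs_of_nonneg le real_norm_def)
  show "0 \<le> (\<Sum>k. 2 * a k / 3 ^ Suc k)" by (rule suminf_nonneg[OF s]) (use le in auto)
  show "(\<Sum>k. 2 * a k / 3 ^ Suc k) \<le> 1"
    using suminf_le[OF le(2) s sums_summable[OF g]] sums_unique[OF g] by simp
qed

text \<open>Multiplication by \<open>3 ^ k\<close> shifts \<open>k\<close> ternary digits out. What
  remains is an even integer plus a tail, and the tail lies in \<open>[0, 1/3]\<close> or
  \<open>[2/3, 1]\<close> according to the digit \<open>a k\<close>.\<close>

lemma zigzag_ternary:
  assumes a: "\<And>k. a k = 0 \<or> a k = (1::real)"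
  shows "zigzag (3 ^ k * (\<Sum>k. 2 * a k / 3 ^ Suc k)) = a k"
proof -
  define t where "t = (\<lambda>k. \<Sum>j. 2 * a (j + k) / 3 ^ Suc j)"
  have a': "a (j + k) = 0 \<or> a (j + k) = 1" for j k using a by auto
  have t01: "0 \<le> t k" "t k \<le> 1" for k using summable_ternary(2,3)[of "\<lambda>j. a (j + k)", OF a'] by (auto simp: t_def)
  have step: "t k = (2 * a k + t (Suc k)) / 3" for k
  proof -
    have "t k = 2 * a k / 3 + (\<Sum>j. 2 * a (Suc j + k) / 3 ^ Suc (Suc j))"
      unfolding t_def using suminf_split_initial_segment[OF summable_ternary(1)[of "\<lambda>j. a (j + k)", OF a'], of 1]
      by simp
    also have "(\<Sum>j. 2 * a (Suc j + k) / 3 ^ Suc (Suc j)) = (\<Sum>j. 2 * a (j + Suc k) / 3 ^ Suc j * (1/3))"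
      by (intro suminf_cong) simp
    also have "\<dots> = t (Suc k) * (1/3)"
      unfolding t_def by (rule suminf_mult2[symmetric]) (rule summable_ternary(1), rule a')
    finally show ?thesis by simp
  qed
  \<comment> \<open>The integer shifted out stays even because the ternary digits
    \<open>2 * a k\<close> are 0 or 2; this is why the period 2 is invisible to
    \<open>zigzag\<close>.\<close>
  have "\<exists>m::int. 3 ^ k * t 0 = 2 * of_int m + t k" for k
  proof (induction k)
    case (Suc k)
    then obtain m :: int where "3 ^ k * t 0 = 2 * of_int m + t k" by blast
    then have "3 ^ Suc k * t 0 = 2 * of_int (3 * m) + 2 * a k + t (Suc k)"
      using step[of k] by (simp add: field_simps)
    moreover have "a k = of_int (if a k = 0 then 0 else 1)" using a[of k] by auto
    ultimately have "3 ^ Suc k * t 0 = 2 * of_int (3 * m + (if a k = 0 then 0 else 1)) + t (Suc k)" by simp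
    then show ?case by blast
  qed (auto intro: exI[of _ 0])
  then obtain m :: int where "3 ^ k * t 0 = 2 * of_int m + t k" by blast
  then have "zigzag (3 ^ k * t 0) = max 0 (min 1 (3 * t k - 1))"
    using zigzag_shift[OF t01] by simp
  also have "\<dots> = a k" using step[of k] t01[of "Suc k"] a[of k] by auto
  finally show ?thesis by (simp add: t_def)
qed

lemma schoenberg_right_inverse:
  assumes "\<And>i. 0 \<le> x i" "\<And>i. x i < 1"
  shows "schoenberg i (\<Sum>k. 2 * binary_digit (fst (prod_decode k)) (x (snd (prod_decode k))) / 3 ^ Suc k) = x i"
proof -
  have "schoenberg i (\<Sum>k. 2 * binary_digit (fst (prod_decode k)) (x (snd (prod_decode k))) / 3 ^ Suc k)
    = (\<Sum>n. binary_digit n (x i) / 2 ^ Suc n)"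
    unfolding schoenberg_def
    by (subst zigzag_ternary[where a="\<lambda>k. binary_digit (fst (prod_decode k)) (x (snd (prod_decode k)))"])
       (use binary_digit_cases in simp_all)
  then show ?thesis using binary_expansion[OF assms] by (simp add: sums_iff)
qed

lemma squash_bounds: "0 < 1/2 + arctan r / pi" "1/2 + arctan r / pi < 1"
proof -
  have "- (pi/2) / pi < arctan r / pi" "arctan r / pi < (pi/2) / pi"
    using arctan_lbound[of r] arctan_ubound[of r] by (intro divide_strict_right_mono; simp)+
  moreover have "- (pi/2) / pi = - (1/2)" "(pi/2) / pi = 1/2" by auto
  ultimately show "0 < 1/2 + arctan r / pi" "1/2 + arctan r / pi < 1" by linarith+
qed

text \<open>The open cube is homeomorphic to the whole space, so Schoenberg's curve in infinitely many
  dimensions gives a partial curve \<open>X\<close> onto a Euclidean space, with Borel right inverse \<open>E\<close>.\<close>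

lemma Euclidean_curve:
  obtains E :: "'a::euclidean_space \<Rightarrow> real" and X :: "real \<Rightarrow> 'a" and h :: "'a \<Rightarrow> real \<Rightarrow> real"
  where "E \<in> borel_measurable borel" "X \<in> borel_measurable borel" "\<And>y. X (E y) = y"
    "\<And>y. 0 \<le> E y" "\<And>y. E y \<le> 1"
    "\<And>b. b \<in> Basis \<Longrightarrow> continuous_on UNIV (h b)"
    "\<And>b y. b \<in> Basis \<Longrightarrow> h b (E y) = 1/2 + arctan (y \<bullet> b) / pi"
    "\<And>t. (\<And>b. b \<in> Basis \<Longrightarrow> 0 < h b t \<and> h b t < 1) \<Longrightarrow> isCont X t"
proof -
  \<comment> \<open>The curve has a coordinate for every natural number; only those that code basis
    vectors are read back, and the others merely have to stay in the unit interval.\<close>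
  define \<beta> :: "nat \<Rightarrow> 'a" where "\<beta> = from_nat_into Basis"
  define u where "u y i = 1/2 + arctan (y \<bullet> \<beta> i) / pi" for y :: 'a and i
  define E where "E y = (\<Sum>k. 2 * binary_digit (fst (prod_decode k)) (u y (snd (prod_decode k))) / 3 ^ Suc k)" for y
  define h where "h b = schoenberg (to_nat_on Basis b)" for b :: 'a
  \<comment> \<open>Inverse of the squashing map \<open>1/2 + arctan r / pi\<close>. It is
    continuous only where the coordinates stay strictly inside the unit interval.\<close>
  define X where "X t = (\<Sum>b\<in>Basis. tan (pi * (h b t - 1/2)) *\<^sub>R b)" for t :: real
  have \<beta>: "\<beta> (to_nat_on Basis b) = b" if "b \<in> Basis" for b
    unfolding \<beta>_def by (rule from_nat_into_to_nat_on) (use that in \<open>auto intro: countable_finite\<close>)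
  have u: "0 < u y i" "u y i < 1" for y i using squash_bounds by (auto simp: u_def)
  have digits: "2 * binary_digit (fst (prod_decode k)) (u y (snd (prod_decode k))) / 3 ^ Suc k
    = 2 * (\<lambda>k. binary_digit (fst (prod_decode k)) (u y (snd (prod_decode k)))) k / 3 ^ Suc k" for k y by simp
  have hE: "h b (E y) = 1/2 + arctan (y \<bullet> b) / pi" if "b \<in> Basis" for b y
    using schoenberg_right_inverse[of "u y"] u \<beta>[OF that] by (simp add: h_def E_def u_def less_imp_le)
  have hc: "continuous_on UNIV (h b)" for b by (simp add: h_def continuous_on_schoenberg)
  show ?thesis
  proof (rule that[of E X h])
    show "0 \<le> E y" "E y \<le> 1" for y
      unfolding E_def using summable_ternary(2,3)[of "\<lambda>k. binary_digit (fst (prod_decode k)) (u y (snd (prod_decode k)))"]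
        binary_digit_cases by auto
    have [measurable]: "(\<lambda>y. u y i) \<in> borel_measurable borel" for i
      unfolding u_def by (intro borel_measurable_continuous_onI continuous_intros) auto
    show "E \<in> borel_measurable borel"
      unfolding E_def[abs_def] binary_digit_def by measurable
    have [measurable]: "h b \<in> borel_measurable borel" for b
      using hc by (rule borel_measurable_continuous_onI)
    show "X \<in> borel_measurable borel" unfolding X_def[abs_def] tan_def by measurable
    show "X (E y) = y" for y
    proof -
      have "X (E y) = (\<Sum>b\<in>Basis. (y \<bullet> b) *\<^sub>R b)"
        unfolding X_def by (intro sum.cong) (simp_all add: hE tan_arctan)
      then show ?thesis by (simp add: euclidean_representation)
    qed
    show "isCont X t" if "\<And>b. b \<in> Basis \<Longrightarrow> 0 < h b t \<and> h b t < 1" for t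
      unfolding X_def[abs_def]
    proof (intro continuous_intros)
      fix b :: 'a assume b: "b \<in> Basis"
      show "isCont (h b) t" using hc[of b] by (simp add: continuous_on_eq_continuous_at)
      have "0 < cos (pi * (h b t - 1/2))"
      proof (rule cos_gt_zero_pi)
        have "pi * (- (1/2)) < pi * (h b t - 1/2)" "pi * (h b t - 1/2) < pi * (1/2)"
          using that[OF b] by (intro mult_strict_left_mono; simp)+
        then show "- (pi/2) < pi * (h b t - 1/2)" "pi * (h b t - 1/2) < pi/2" by simp_all
      qed
      then show "cos (pi * (h b t - 1/2)) \<noteq> 0" by simp
    qed
  qed (use hc hE in auto)
qed

text \<open>Pushing forward by \<open>E\<close> gives laws on the unit interval, where Helly's
  theorem applies at once. The map \<open>X\<close> brings the limit back by the mapping theorem for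
  almost everywhere continuous functions; the assumed tightness serves to keep the limit off the
  discontinuities of \<open>X\<close>.\<close>

theorem prokhorov:
  fixes \<nu> :: "nat \<Rightarrow> 'a::euclidean_space measure"
  assumes \<nu>: "\<And>j. \<nu> j \<in> prob_measures"
    and tight: "\<And>\<epsilon>. \<epsilon> > 0 \<Longrightarrow> \<exists>R. \<forall>\<^sub>F j in sequentially. 1 - \<epsilon> \<le> measure (\<nu> j) (cball 0 R)"
  obtains r M where "strict_mono r" "M \<in> prob_measures" "narrow_conv (\<lambda>j. \<nu> (r j)) M"
proof -
  obtain E :: "'a \<Rightarrow> real" and X :: "real \<Rightarrow> 'a" and h where
    meas[measurable]: "E \<in> borel_measurable borel" "X \<in> borel_measurable borel" and XE: "\<And>y. X (E y) = y"
    and E01: "\<And>y. 0 \<le> E y" "\<And>y. E y \<le> 1"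
    and hc: "\<And>b. b \<in> Basis \<Longrightarrow> continuous_on UNIV (h b)"
    and hE: "\<And>b y. b \<in> Basis \<Longrightarrow> h b (E y) = 1/2 + arctan (y \<bullet> b) / pi"
    and Xc: "\<And>t. (\<And>b. b \<in> Basis \<Longrightarrow> 0 < h b t \<and> h b t < 1) \<Longrightarrow> isCont X t"
    using Euclidean_curve by blast
  define \<sigma> where "\<sigma> j = distr (\<nu> j) borel E" for j
  have \<sigma>: "\<sigma> j \<in> prob_measures" for j
    unfolding \<sigma>_def by (rule prob_measures_distr[OF \<nu>]) simp
  interpret \<sigma>: prob_space "\<sigma> j" for j using \<sigma> prob_measuresD by blast
  have rd: "real_distribution (\<sigma> j)" for j
    by unfold_locales (simp_all add: \<sigma>_def)
  have \<sigma>_measure: "measure (\<sigma> j) A = measure (\<nu> j) (E -` A)" if "A \<in> sets borel" for j A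
    unfolding \<sigma>_def using that prob_measuresD[OF \<nu>[of j]] by (simp add: measure_distr)
  have "tight \<sigma>"
    unfolding tight_def
  proof (intro conjI allI impI rd)
    fix \<epsilon> :: real assume "\<epsilon> > 0"
    \<comment> \<open>The definition of \<open>tight\<close> uses intervals open on the left, so the
      left end is moved to -1 to include the value 0.\<close>
    have "E -` {-1<..1} = UNIV" using E01(2) less_le_trans[OF _ E01(1), of "-1"] by auto
    then have "measure (\<sigma> j) {-1<..1} = 1" for j
      using prob_space.prob_space[OF prob_measuresD(1)[OF \<nu>]] prob_measuresD(3)[OF \<nu>]
      by (simp add: \<sigma>_measure)
    then show "\<exists>a b. a < b \<and> (\<forall>j. 1 - \<epsilon> < measure (\<sigma> j) {a<..b})"
      using \<open>\<epsilon> > 0\<close> by (intro exI[of _ "-1"] exI[of _ 1]) auto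
  qed
  from tight_imp_convergent_subsubsequence[OF this strict_mono_id] obtain r M where
    r: "strict_mono r" and rM: "real_distribution M" and wc: "weak_conv_m (\<lambda>j. \<sigma> (r j)) M"
    by (auto simp: comp_def)
  interpret M: real_distribution M by fact
  have M: "M \<in> prob_measures" by (simp add: prob_measures_def M.prob_space_axioms)
  have nc: "narrow_conv (\<lambda>j. \<sigma> (r j)) M"
    unfolding narrow_conv_def
  proof
    fix f :: "real \<Rightarrow> real" assume f: "f \<in> Cb"
    obtain B where "\<And>x. \<bar>f x\<bar> \<le> B" using Cb_D[OF f] by blast
    with f show "(\<lambda>j. \<integral>x. f x \<partial>\<sigma> (r j)) \<longlonglongrightarrow> (\<integral>x. f x \<partial>M)"
      by (intro weak_conv_imp_integral_bdd_continuous_conv[OF _ _ wc])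
         (auto simp: rd rM continuous_on_eq_continuous_at dest: Cb_D)
  qed
  \<comment> \<open>Parameters whose curve point lies in the open cube. \<open>X\<close> is
    continuous there, so full mass of \<open>A\<close> is the remaining goal.\<close>
  define A where "A = {t. \<forall>b\<in>Basis. 0 < h b t \<and> h b t < 1}"
  have "open A"
  proof -
    have "A = (\<Inter>b\<in>Basis. {t. 0 < h b t \<and> h b t < 1})" by (auto simp: A_def)
    then show ?thesis
      using hc by (auto intro!: open_INT open_Collect_conj open_Collect_less continuous_intros)
  qed
  have "1 - \<epsilon> \<le> measure M A" if "0 < \<epsilon>" "\<epsilon> < 1" for \<epsilon>
  proof -
    obtain R where R: "\<forall>\<^sub>F j in sequentially. 1 - \<epsilon> \<le> measure (\<nu> j) (cball 0 R)"
      using tight \<open>0 < \<epsilon>\<close> by blast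
    let ?s = "\<lambda>r. 1/2 + arctan r / pi"
    \<comment> \<open>A closed part of \<open>A\<close> whose preimage under \<open>E\<close>
      contains \<open>cball 0 R\<close>; being closed, it keeps at least the mass
      \<open>1 - \<epsilon>\<close> in the limit.\<close>
    define C where "C = {t. \<forall>b\<in>Basis. ?s (-R) \<le> h b t \<and> h b t \<le> ?s R}"
    have C: "closed C"
    proof -
      have "C = (\<Inter>b\<in>Basis. {t. ?s (-R) \<le> h b t \<and> h b t \<le> ?s R})" by (auto simp: C_def)
      then show ?thesis
        using hc by (auto intro!: closed_INT closed_Collect_conj closed_Collect_le continuous_intros)
    qed
    have "C \<subseteq> A" unfolding C_def A_def using squash_bounds by (auto intro: less_le_trans le_less_trans)
    have "cball 0 R \<subseteq> E -` C"
    proof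
      fix y :: 'a assume "y \<in> cball 0 R"
      then have "\<bar>y \<bullet> b\<bar> \<le> R" if "b \<in> Basis" for b using Basis_le_norm[OF that, of y] by simp
      then have "-R \<le> y \<bullet> b" "y \<bullet> b \<le> R" if "b \<in> Basis" for b using that by (fastforce simp: abs_le_iff)+
      then show "y \<in> E -` C"
        by (auto simp: C_def hE intro!: divide_right_mono arctan_monotone')
    qed
    then have "measure (\<nu> j) (cball 0 R) \<le> measure (\<sigma> j) C" for j
    proof -
      interpret N: prob_space "\<nu> j" using \<nu> prob_measuresD by blast
      note [measurable_cong] = prob_measuresD(2)[OF \<nu>[of j]]
      have "E -` C \<in> sets (\<nu> j)" using measurable_sets[OF meas(1), of C] C prob_measuresD[OF \<nu>[of j]] by simp
      then show ?thesis
        using C \<open>cball 0 R \<subseteq> E -` C\<close> by (subst \<sigma>_measure) (auto intro: N.finite_measure_mono)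
    qed
    then have "\<forall>\<^sub>F j in sequentially. 1 - \<epsilon> \<le> measure (\<sigma> j) C"
      using R by (auto elim!: eventually_mono intro: order_trans)
    then have "\<forall>\<^sub>F j in sequentially. 1 - \<epsilon> \<le> measure (\<sigma> (r j)) C"
      using r by (rule eventually_subseq[rotated])
    from narrow_conv_closed_ge[OF nc M \<sigma> C _ this] \<open>\<epsilon> < 1\<close> have "1 - \<epsilon> \<le> measure M C" by simp
    also have "\<dots> \<le> measure M A"
      using \<open>C \<subseteq> A\<close> \<open>open A\<close> by (intro M.finite_measure_mono) auto
    finally show ?thesis .
  qed
  note ge = this
  have "measure M A = 1"
  proof (rule ccontr)
    assume "measure M A \<noteq> 1"
    then have "measure M A < 1" using M.prob_le_1[of A] by linarith
    with ge[of "(1 - measure M A) / 2"] measure_nonneg[of M A] show False by (simp add: field_simps)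
  qed
  then have A0: "emeasure M (-A) = 0"
    using M.prob_compl[of A] \<open>open A\<close> by (simp add: M.emeasure_eq_measure Compl_eq_Diff_UNIV)
  show ?thesis
  proof (rule that[OF r])
    show "distr M borel X \<in> prob_measures" by (rule prob_measures_distr[OF M]) simp
    show "narrow_conv (\<lambda>j. \<nu> (r j)) (distr M borel X)"
      unfolding narrow_conv_def
    proof
      fix f :: "'a \<Rightarrow> real" assume f: "f \<in> Cb"
      obtain B where B: "\<And>x. \<bar>f x\<bar> \<le> B" using Cb_D[OF f] by blast
      note [measurable] = Cb_borel[OF f]
      have "isCont (\<lambda>t. f (X t)) t" if "t \<in> A" for t
        using Xc[of t] that Cb_D(1)[OF f] 
        by (intro isCont_o2[of _ X f]) (auto simp: A_def continuous_on_eq_continuous_at)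
      then have "{t. \<not> isCont (\<lambda>t. f (X t)) t} \<subseteq> -A" by blast
      from emeasure_mono[OF this, of M] A0 \<open>open A\<close>
      have "emeasure M {t. \<not> isCont (\<lambda>t. f (X t)) t} = 0" by simp
      then have "(\<lambda>j. \<integral>t. f (X t) \<partial>\<sigma> (r j)) \<longlonglongrightarrow> (\<integral>t. f (X t) \<partial>M)"
        using B by (intro weak_conv_imp_bdd_ae_continuous_conv[OF _ _ wc]) (auto simp: rd rM)
      moreover have "(\<integral>t. f (X t) \<partial>\<sigma> j) = (\<integral>x. f x \<partial>\<nu> j)" for j
        unfolding \<sigma>_def by (subst integral_distr) (auto simp: XE prob_measuresD[OF \<nu>])
      ultimately show "(\<lambda>j. \<integral>x. f x \<partial>\<nu> (r j)) \<longlonglongrightarrow> (\<integral>x. f x \<partial>distr M borel X)"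
        by (simp add: integral_distr)
    qed
  qed
qed

section \<open>A countable family of bounded continuous functions\<close>

text \<open>Bounded continuous functions are suprema of the rational cones below them.\<close>

definition rational_cone :: "'a::metric_space \<times> real \<times> nat \<Rightarrow> 'a \<Rightarrow> real" where
  "rational_cone \<tau> x = fst (snd \<tau>) - real (snd (snd \<tau>)) * dist x (fst \<tau>)"

text \<open>Maxima are indexed by lists, so countably many cones yield countably many functions. The
  base value \<open>- M\<close> supplies the lower bound that cones, which may fall without limit,
  do not have.\<close>

primrec max_cones :: "real \<Rightarrow> ('a::metric_space \<times> real \<times> nat) list \<Rightarrow> 'a \<Rightarrow> real" where
  "max_cones M [] x = - M"
| "max_cones M (\<tau> # l) x = max (max_cones M l x) (rational_cone \<tau> x)"

lemma max_cones_Cb: "max_cones M l \<in> Cb"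
proof (induction l)
  case Nil
  have "max_cones M [] = (\<lambda>_. - M)" by (rule ext) simp
  then show ?case using Cb_const[of "-M"] by simp
next
  case (Cons \<tau> l)
  obtain B where B: "\<And>x. \<bar>max_cones M l x\<bar> \<le> B" using Cb_D[OF Cons] by blast
  have "max_cones M (\<tau> # l) x \<le> max B (fst (snd \<tau>))" for x
  proof -
    have "rational_cone \<tau> x \<le> fst (snd \<tau>)" by (simp add: rational_cone_def)
    then show ?thesis using B[of x] by auto
  qed
  moreover have "- B \<le> max_cones M (\<tau> # l) x" for x
    using B[of x] by auto
  ultimately have "\<bar>max_cones M (\<tau> # l) x\<bar> \<le> max B (max B (fst (snd \<tau>)))" for x
    by (meson abs_leI max.coboundedI1 max.coboundedI2 minus_le_iff order_refl)
  moreover have "continuous_on UNIV (max_cones M (\<tau> # l))"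
    using Cb_D(1)[OF Cons] by (simp add: rational_cone_def) (intro continuous_intros)
  ultimately show ?case by (rule Cb_I[rotated])
qed

text \<open>A cone with vertex near \<open>x\<close> and height slightly below \<open>f x\<close>
  fits under \<open>f\<close> near \<open>x\<close> by continuity, and elsewhere because it is steep
  enough to have dropped below \<open>- M\<close>.\<close>

lemma rational_cone_below:
  fixes f :: "'a::metric_space \<Rightarrow> real"
  assumes f: "continuous_on UNIV f" "\<And>x. \<bar>f x\<bar> \<le> M" and \<epsilon>: "\<epsilon> > 0"
    and dense: "\<And>X. open X \<Longrightarrow> X \<noteq> {} \<Longrightarrow> \<exists>d\<in>Q. d \<in> X"
  obtains \<tau> where "\<tau> \<in> Q \<times> \<rat> \<times> UNIV" "\<And>y. rational_cone \<tau> y \<le> f y" "f x - \<epsilon> < rational_cone \<tau> x"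
proof -
  obtain \<delta> where \<delta>: "\<delta> > 0" "\<And>y. dist y x < \<delta> \<Longrightarrow> \<bar>f y - f x\<bar> < \<epsilon> / 4"
    using f(1) \<epsilon> unfolding continuous_on_iff dist_real_def
    by (metis UNIV_I divide_pos_pos zero_less_numeral)
  obtain a where a: "a \<in> \<rat>" "f x - \<epsilon> / 2 < a" "a < f x - \<epsilon> / 4"
    using Rats_dense_in_real[of "f x - \<epsilon> / 2" "f x - \<epsilon> / 4"] \<epsilon> by auto
  \<comment> \<open>The slope must lose the whole oscillation \<open>2 * M\<close> of
    \<open>f\<close> over half the continuity radius.\<close>
  obtain b :: nat where b: "2 * M < real b * (\<delta> / 2)"
    using \<delta>(1) ex_less_of_nat_mult[of "\<delta> / 2" "2 * M"] by auto
  \<comment> \<open>Once the slope is fixed, the vertex is taken so close to \<open>x\<close> that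
    the steepness costs less than \<open>\<epsilon> / 4\<close> at \<open>x\<close>; the added 1
    avoids division by zero.\<close>
  have "ball x (min (\<delta> / 2) (\<epsilon> / (4 * (real b + 1)))) \<noteq> {}"
    using \<delta>(1) \<epsilon> by (simp add: add_pos_nonneg add.commute not_le)
  from dense[OF open_ball this] obtain q where q: "q \<in> Q" "dist x q < \<delta> / 2" "dist x q < \<epsilon> / (4 * (real b + 1))"
    by auto
  show ?thesis
  proof (rule that[of "(q, a, b)"])
    show "(q, a, b) \<in> Q \<times> \<rat> \<times> UNIV" using q a by auto
    have "real b * dist x q \<le> (real b + 1) * dist x q" by (simp add: algebra_simps)
    also have "\<dots> < \<epsilon> / 4" using q(3) by (simp add: field_simps)
    finally show "f x - \<epsilon> < rational_cone (q, a, b) x" using a(2) \<epsilon> by (simp add: rational_cone_def)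
    show "rational_cone (q, a, b) y \<le> f y" for y
    proof (cases "dist y x < \<delta>")
      case True
      have "rational_cone (q, a, b) y \<le> a" by (simp add: rational_cone_def)
      then show ?thesis using \<delta>(2)[OF True] a(3) by linarith
    next
      case False
      then have "\<delta> / 2 \<le> dist y q" using q(2) dist_triangle[of y x q] by (simp add: dist_commute)
      then have "real b * (\<delta> / 2) \<le> real b * dist y q" by (intro mult_left_mono) auto
      then have "rational_cone (q, a, b) y \<le> a - 2 * M" using b by (simp add: rational_cone_def)
      then show ?thesis using f(2)[of x] f(2)[of y] a(3) \<epsilon> by linarith
    qed
  qed
qed

abbreviation bounded_increasing_limit :: "('a \<Rightarrow> real) set \<Rightarrow> ('a \<Rightarrow> real) \<Rightarrow> bool" where
  "bounded_increasing_limit D f \<equiv> \<exists>g B. range g \<subseteq> D \<and> (\<forall>j x. \<bar>g j x\<bar> \<le> B) \<and>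
     (\<forall>x. incseq (\<lambda>j. g j x)) \<and> (\<forall>x. (\<lambda>j::nat. g j x) \<longlonglongrightarrow> f x)"

text \<open>Bounded increasing limits are the mode of approximation that both dominated convergence
  and \<open>S_tendsto_increasing\<close> accept. The sequence is the running maximum of an
  enumeration of all admissible cones below \<open>f\<close>.\<close>

lemma Cb_countable_monotone_dense:
  obtains D :: "('a::{metric_space, second_countable_topology} \<Rightarrow> real) set"
  where "countable D" "D \<subseteq> Cb"
    "\<forall>f\<in>Cb. bounded_increasing_limit D f"
proof -
  obtain Q :: "'a set" where Q: "countable Q" "\<And>X. open X \<Longrightarrow> X \<noteq> {} \<Longrightarrow> \<exists>d\<in>Q. d \<in> X"
    using countable_dense_exists by blast
  let ?T = "Q \<times> \<rat> \<times> (UNIV :: nat set)"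
  let ?D = "(\<lambda>(M :: nat, l). max_cones (real M) l) ` (UNIV \<times> lists ?T)"
  have "countable ?D"
    using Q(1) countable_rat by (intro countable_image countable_SIGMA countable_lists) auto
  moreover have "?D \<subseteq> Cb" using max_cones_Cb by auto
  moreover have "\<exists>g B. range g \<subseteq> ?D \<and> (\<forall>j x. \<bar>g j x\<bar> \<le> B) \<and> (\<forall>x. incseq (\<lambda>j. g j x)) \<and>
       (\<forall>x. (\<lambda>j::nat. g j x) \<longlonglongrightarrow> f x)" if f: "f \<in> Cb" for f
  proof -
    obtain B where B: "\<And>x. \<bar>f x\<bar> \<le> B" using Cb_D[OF f] by blast
    obtain M :: nat where "B \<le> real M" using real_arch_simple by blast
    then have M: "\<And>x. \<bar>f x\<bar> \<le> real M" using B order_trans by blast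
    define A where "A = {\<tau> \<in> ?T. \<forall>y. rational_cone \<tau> y \<le> f y}"
    note below = rational_cone_below[OF Cb_D(1)[OF f] M _ Q(2)]
    have "\<exists>t. t \<in> A" 
    proof (rule below[of 1 undefined, OF zero_less_one])
      fix \<tau> assume "\<tau> \<in> ?T" "\<And>y. rational_cone \<tau> y \<le> f y"
      then have "\<tau> \<in> A" unfolding A_def by (intro CollectI conjI allI)
      then show ?thesis by blast
    qed
    then have "A \<noteq> {}" by blast
    moreover have "countable A"
      unfolding A_def using Q(1) countable_rat by (intro countable_subset[OF Collect_subset]) auto
    ultimately have A: "range (from_nat_into A) = A" by (rule range_from_nat_into)
    define \<tau> where "\<tau> = from_nat_into A"
    define g where "g j = max_cones (real M) (map \<tau> (rev [0..<j]))" for j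
    have gS: "g (Suc j) x = max (g j x) (rational_cone (\<tau> j) x)" for j x by (simp add: g_def)
    have \<tau>A: "\<tau> j \<in> A" for j using A unfolding \<tau>_def by blast
    then have le: "g j x \<le> f x" for j x
      using M[of x] by (induction j) (auto simp: gS A_def, simp add: g_def)
    have ge: "- real M \<le> g j x" for j x
      by (induction j) (auto simp: gS, simp add: g_def)
    have inc: "incseq (\<lambda>j. g j x)" for x by (rule incseq_SucI) (simp add: gS)
    have "(\<lambda>j. g j x) \<longlonglongrightarrow> f x" for x
    proof (rule LIMSEQ_I)
      fix \<epsilon> :: real assume "\<epsilon> > 0"
      have "\<exists>t\<in>A. f x - \<epsilon> < rational_cone t x"
      proof (rule below[OF \<open>\<epsilon> > 0\<close>, of x])
        fix \<tau> assume "\<tau> \<in> ?T" "\<And>y. rational_cone \<tau> y \<le> f y" and *: "f x - \<epsilon> < rational_cone \<tau> x"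
        then have "\<tau> \<in> A" unfolding A_def by (intro CollectI conjI allI)
        with * show ?thesis by blast
      qed
      then obtain t where "t \<in> A" "f x - \<epsilon> < rational_cone t x" by blast
      moreover have "t \<in> range \<tau>" using \<open>t \<in> A\<close> A unfolding \<tau>_def by simp
      ultimately obtain J where J: "f x - \<epsilon> < rational_cone (\<tau> J) x" by blast
      have "norm (g j x - f x) < \<epsilon>" if "j \<ge> Suc J" for j
      proof -
        have "rational_cone (\<tau> J) x \<le> g (Suc J) x" by (simp add: gS)
        also have "\<dots> \<le> g j x" using inc[of x] that by (auto simp: incseq_def)
        finally show ?thesis using J le[of j x] by auto
      qed
      then show "\<exists>no. \<forall>n\<ge>no. norm (g n x - f x) < \<epsilon>" by blast
    qed
    moreover have "range g \<subseteq> ?D"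
    proof
      fix h assume "h \<in> range g"
      then obtain j where "h = g j" by blast
      then have "h = (\<lambda>(M :: nat, l). max_cones (real M) l) (M, map \<tau> (rev [0..<j]))" by (simp add: g_def)
      moreover have "map \<tau> (rev [0..<j]) \<in> lists ?T" 
      proof -
        have "\<tau> j \<in> ?T" for j using \<tau>A[of j] unfolding A_def by blast
        then show ?thesis by (simp only: in_lists_conv_set set_map) blast
      qed
      ultimately show "h \<in> ?D" by (metis (no_types, lifting) UNIV_I imageI mem_Sigma_iff)
    qed
    moreover have "\<bar>g j x\<bar> \<le> real M" for j x
      using le[of j x] ge[of j x] M[of x] by (auto simp: abs_le_iff)
    ultimately show ?thesis using inc by blast
  qed
  ultimately show ?thesis by (intro that ballI)
qed

section \<open>Large deviation estimates in terms of reals\<close>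

lemma eln_less_imp: assumes "ereal (1 / \<kappa>) * eln m < ereal s" "\<kappa> > 0" shows "m \<le> exp (\<kappa> * s)"
proof (cases "m \<le> 0")
  case False
  then have "ln m < \<kappa> * s" using assms by (simp add: eln_def field_simps)
  then have "exp (ln m) \<le> exp (\<kappa> * s)" by (subst exp_le_cancel_iff) simp
  then show ?thesis using False by simp
qed (meson exp_ge_zero order_trans)

lemma eln_greater_imp: assumes "ereal s < ereal (1 / \<kappa>) * eln m" "\<kappa> > 0" shows "exp (\<kappa> * s) \<le> m"
proof (cases "m \<le> 0")
  case True
  then show ?thesis using assms by (simp add: eln_def)
next
  case False
  then have "\<kappa> * s < ln m" using assms by (simp add: eln_def field_simps)
  then have "exp (\<kappa> * s) \<le> exp (ln m)" by (subst exp_le_cancel_iff) simp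
  then show ?thesis using False by simp
qed

lemma eln_le: assumes "m \<le> exp (\<kappa> * s)" "\<kappa> > 0" shows "ereal (1 / \<kappa>) * eln m \<le> ereal s"
proof (cases "m \<le> 0")
  case True
  then show ?thesis using assms by (simp add: eln_def)
next
  case False
  then have "ln m \<le> ln (exp (\<kappa> * s))" using assms(1) by (subst ln_le_cancel_iff) auto
  then show ?thesis using False assms by (simp add: eln_def field_simps)
qed

lemma eln_ge: assumes "exp (\<kappa> * s) \<le> m" "\<kappa> > 0" shows "ereal s \<le> ereal (1 / \<kappa>) * eln m"
proof -
  have m: "m > 0" using less_le_trans[OF exp_gt_zero assms(1)] .
  then have "ln (exp (\<kappa> * s)) \<le> ln m" using assms(1) by (subst ln_le_cancel_iff) auto
  then show ?thesis using m assms by (simp add: eln_def field_simps)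
qed

lemma k_LDP_upper:
  assumes LDP: "k_LDP P I" and A: "closed A" "\<And>x. x \<in> A \<Longrightarrow> ennreal s \<le> I x" and "0 \<le> s" "t < s"
  shows "\<forall>\<^sub>F k in sequentially. measure (P k) A \<le> exp (- (real k * t))"
proof -
  have "A \<in> sets borel" using A(1) by simp
  then have "limsup (\<lambda>k. ereal (1 / real k) * eln (measure (P k) A)) \<le> - enn2ereal (INF x\<in>closure A. I x)"
    using LDP unfolding k_LDP_def by blast
  also have "ennreal s \<le> (INF x\<in>closure A. I x)" using A by (auto intro: INF_greatest)
  then have "ereal s \<le> enn2ereal (INF x\<in>closure A. I x)"
    using \<open>0 \<le> s\<close> by (simp add: less_eq_ennreal.rep_eq enn2ereal_ennreal)
  then have "- enn2ereal (INF x\<in>closure A. I x) \<le> ereal (- s)"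
    using ereal_minus_le_minus[of _ "ereal s"] by simp
  also have "\<dots> < ereal (- t)" using \<open>t < s\<close> by simp
  finally have "\<forall>\<^sub>F k in sequentially. ereal (1 / real k) * eln (measure (P k) A) < ereal (- t)"
    by (rule Limsup_lessD)
  then show ?thesis
    using eventually_gt_at_top[of 0]
  proof eventually_elim
    case (elim k)
    from eln_less_imp[OF elim(1)] elim(2) show ?case by simp
  qed
qed

lemma k_LDP_lower:
  assumes LDP: "k_LDP P I" and G: "open G" "x \<in> G" "I x < ennreal t"
  shows "\<forall>\<^sub>F k in sequentially. exp (- (real k * t)) \<le> measure (P k) G"
proof -
  have "0 < t"
  proof (rule ccontr)
    assume "\<not> 0 < t"
    then have "ennreal t = 0" by (simp add: ennreal_eq_0_iff)
    with G(3) show False by simp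
  qed
  have "(INF x\<in>interior G. I x) \<le> I x" using G by (auto intro: INF_lower simp: interior_open)
  then have "enn2ereal (INF x\<in>interior G. I x) < ereal t"
    using le_less_trans[OF _ G(3)] \<open>0 < t\<close> by (simp add: less_ennreal.rep_eq enn2ereal_ennreal)
  then have "ereal (- t) < - enn2ereal (INF x\<in>interior G. I x)"
    using ereal_minus_less_minus[of "ereal t"] by simp
  also have "G \<in> sets borel" using G by simp
  then have "- enn2ereal (INF x\<in>interior G. I x) \<le> liminf (\<lambda>k. ereal (1 / real k) * eln (measure (P k) G))"
    using LDP unfolding k_LDP_def by blast
  finally have "\<forall>\<^sub>F k in sequentially. ereal (- t) < ereal (1 / real k) * eln (measure (P k) G)"
    by (rule less_LiminfD)
  then show ?thesis
    using eventually_gt_at_top[of 0]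
  proof eventually_elim
    case (elim k)
    from eln_greater_imp[OF elim(1)] elim(2) show ?case by simp
  qed
qed

text \<open>Uniqueness of the rate function: if \<open>J x < t < s < I x\<close>, lower
  semicontinuity keeps \<open>I\<close> above \<open>s\<close> on a closed ball about
  \<open>x\<close>, and the upper estimate at the midpoint of \<open>s\<close> and \<open>t\<close>
  contradicts the lower one. The hypotheses are exponential estimates instead of
  \<open>k_LDP\<close>, so that one side may be a transported rate.\<close>

lemma rate_function_le:
  fixes I J :: "'a::metric_space \<Rightarrow> ennreal"
  assumes P: "\<And>k. P k \<in> prob_measures" and lsc: "\<And>t. closed {x. I x \<le> t}"
    and up: "\<And>A s t. closed A \<Longrightarrow> (\<And>x. x \<in> A \<Longrightarrow> ennreal s \<le> I x) \<Longrightarrow> 0 \<le> s \<Longrightarrow> t < s \<Longrightarrow>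
      \<forall>\<^sub>F k in sequentially. measure (P k) A \<le> exp (- (real k * t))"
    and low: "\<And>G x t. open G \<Longrightarrow> x \<in> G \<Longrightarrow> J x < ennreal t \<Longrightarrow>
      \<forall>\<^sub>F k in sequentially. exp (- (real k * t)) \<le> measure (P k) G"
  shows "I x \<le> J x"
proof (rule ccontr)
  assume "\<not> I x \<le> J x"
  then obtain s' where s': "J x < s'" "s' < I x" using dense[of "J x" "I x"] by (auto simp: not_le)
  then obtain t' where t': "J x < t'" "t' < s'" using dense by blast
  obtain s where s: "s' = ennreal s" "0 \<le> s" using s' by (cases s') auto
  obtain t where t: "t' = ennreal t" "0 \<le> t" using s' t' by (cases t') auto
  have "t < s" using s t t' by (simp add: ennreal_less_iff)
  have "open (- {y. I y \<le> s'})" "x \<in> - {y. I y \<le> s'}" using lsc s' by (auto simp: open_closed)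
  then obtain e where e: "e > 0" "cball x e \<subseteq> - {y. I y \<le> s'}" using open_contains_cball by blast
  have "\<forall>\<^sub>F k in sequentially. measure (P k) (cball x e) \<le> exp (- (real k * ((s + t) / 2)))"
    using e s \<open>t < s\<close> by (intro up[of _ s]) auto
  moreover have "\<forall>\<^sub>F k in sequentially. exp (- (real k * t)) \<le> measure (P k) (ball x e)"
    using e t t' by (intro low[of _ x]) auto
  ultimately have "\<forall>\<^sub>F k in sequentially. k > 0 \<and> measure (P k) (cball x e) \<le> exp (- (real k * ((s + t) / 2)))
    \<and> exp (- (real k * t)) \<le> measure (P k) (ball x e)"
    using eventually_gt_at_top[of 0] by eventually_elim auto
  then obtain k where k: "k > 0" "measure (P k) (cball x e) \<le> exp (- (real k * ((s + t) / 2)))"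
    "exp (- (real k * t)) \<le> measure (P k) (ball x e)"
    by (auto dest: eventually_happens)
  interpret prob_space "P k" using P prob_measuresD by blast
  have "measure (P k) (ball x e) \<le> measure (P k) (cball x e)"
    by (intro finite_measure_mono) (auto simp: prob_measuresD[OF P])
  with k have "exp (- (real k * t)) \<le> exp (- (real k * ((s + t) / 2)))" by linarith
  then have "real k * ((s + t) / 2) \<le> real k * t" by simp
  with k \<open>t < s\<close> show False by simp
qed

text \<open>Preimages under the translation turn the estimates for \<open>Q\<close> into estimates
  for the shifted laws with rate \<open>c0 (x - a)\<close>; uniqueness of the rate then applies in
  both directions.\<close>

lemma k_LDP_translate:
  fixes Q :: "nat \<Rightarrow> 'a::real_normed_vector measure"
  assumes Q: "\<And>k. Q k \<in> prob_measures" and QL: "k_LDP Q c0"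
    and PL: "k_LDP (\<lambda>k. distr (Q k) borel (\<lambda>u. a + u)) c"
  shows "c x = c0 (x - a)"
proof -
  let ?P = "\<lambda>k. distr (Q k) borel (\<lambda>u. a + u)"
  have m: "(\<lambda>u. a + u) \<in> borel_measurable borel"
    by (intro borel_measurable_continuous_onI continuous_intros)
  have P: "?P k \<in> prob_measures" for k by (rule prob_measures_distr[OF Q m])
  have PQ: "measure (?P k) A = measure (Q k) ((\<lambda>u. a + u) -` A)" if "A \<in> sets borel" for k A
    using that m prob_measuresD[OF Q[of k]] by (simp add: measure_distr)
  have vi: "continuous_on UNIV (\<lambda>u. a + u)" "continuous_on UNIV (\<lambda>u. u - a)" by (intro continuous_intros)+
  have up: "\<forall>\<^sub>F k in sequentially. measure (?P k) A \<le> exp (- (real k * t))"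
    if A: "closed A" "\<And>x. x \<in> A \<Longrightarrow> ennreal s \<le> c0 (x - a)" "0 \<le> s" "t < s" for A s t
  proof -
    have "closed ((\<lambda>u. a + u) -` A)" using A(1) vi(1) by (rule closed_vimage)
    moreover have "ennreal s \<le> c0 x" if x: "x \<in> (\<lambda>u. a + u) -` A" for x
    proof -
      have "a + x \<in> A" using x by simp
      from A(2)[OF this] show ?thesis by simp
    qed
    ultimately have "\<forall>\<^sub>F k in sequentially. measure (Q k) ((\<lambda>u. a + u) -` A) \<le> exp (- (real k * t))"
      by (rule k_LDP_upper[OF QL _ _ A(3,4)])
    moreover have "A \<in> sets borel" using A(1) by simp
    ultimately show ?thesis by (simp only: PQ)
  qed
  have low: "\<forall>\<^sub>F k in sequentially. exp (- (real k * t)) \<le> measure (?P k) G"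
    if "open G" "x \<in> G" "c0 (x - a) < ennreal t" for G x t
  proof -
    have "open ((\<lambda>u. a + u) -` G)" using that(1) vi(1) by (rule open_vimage)
    moreover have "x - a \<in> (\<lambda>u. a + u) -` G" using that(2) by simp
    ultimately have "\<forall>\<^sub>F k in sequentially. exp (- (real k * t)) \<le> measure (Q k) ((\<lambda>u. a + u) -` G)"
      by (rule k_LDP_lower[OF QL _ _ that(3)])
    moreover have "G \<in> sets borel" using that(1) by simp
    ultimately show ?thesis by (simp only: PQ)
  qed
  have lsc: "closed {x. c0 (x - a) \<le> t}" for t
    using closed_vimage[OF _ vi(2), of "{x. c0 x \<le> t}"] QL by (simp add: k_LDP_def vimage_def)
  have lsc': "closed {x. c x \<le> t}" for t using PL by (simp add: k_LDP_def)
  show ?thesis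
  proof (rule antisym)
    show "c x \<le> c0 (x - a)"
      by (rule rate_function_le[OF P lsc' k_LDP_upper[OF PL] low])
    show "c0 (x - a) \<le> c x"
      by (rule rate_function_le[where I="\<lambda>x. c0 (x - a)", OF P lsc up k_LDP_lower[OF PL]])
  qed
qed

section \<open>Varadhan's lemma for a Feller system\<close>

locale feller_LDP =
  fixes \<mu> :: "'a::euclidean_space measure"
    and P :: "nat \<Rightarrow> 'a \<Rightarrow> 'a measure"
    and c :: "'a \<Rightarrow> 'a \<Rightarrow> ennreal"
  assumes mu: "\<mu> \<in> prob_measures"
    and P_prob: "\<And>k x. P k x \<in> prob_measures"
    and P_feller: "\<And>k. feller (P k)"
    and P_LDP: "\<And>x. k_LDP (\<lambda>k. P k x) (c x)"
    and c_good: "\<And>x. good_rate_function (c x)"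
begin

sublocale mu: prob_space \<mu> using mu by (rule prob_measuresD)

definition Z :: "nat \<Rightarrow> ('a \<Rightarrow> real) \<Rightarrow> 'a \<Rightarrow> real" where
  "Z k f x = (\<integral>y. exp (- (real k * f y)) \<partial>P k x)"

definition G :: "nat \<Rightarrow> ('a \<Rightarrow> real) \<Rightarrow> 'a \<Rightarrow> real" where
  "G k f x = - ln (Z k f x) / real k"

text \<open>For bounded continuous \<open>f\<close> the infimum is finite by \<open>ereal_S\<close>,
  so the passage to reals loses nothing.\<close>

definition S :: "('a \<Rightarrow> real) \<Rightarrow> 'a \<Rightarrow> real" where
  "S f x = real_of_ereal (S1 c f x)"

abbreviation dual :: "'a measure \<Rightarrow> ('a \<Rightarrow> real) \<Rightarrow> real" where
  "dual \<nu> f \<equiv> (\<integral>x. S f x \<partial>\<mu>) - (\<integral>y. f y \<partial>\<nu>)"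

lemma lsc: "closed {y. c x y \<le> t}"
  using c_good by (simp add: good_rate_function_def)

text \<open>A rate bounded away from zero would make the total mass exponentially small. This is
  what bounds \<open>S f\<close> above by the supremum of \<open>f\<close>.\<close>

lemma c_small:
  assumes "\<epsilon> > 0" obtains y where "c x y < ennreal \<epsilon>"
proof (rule ccontr)
  assume "\<not> thesis"
  then have "ennreal \<epsilon> \<le> c x y" for y using that[of y] by (rule contrapos_np) simp
  then have "\<forall>\<^sub>F k in sequentially. measure (P k x) UNIV \<le> exp (- (real k * (\<epsilon> / 2)))"
    using assms by (intro k_LDP_upper[OF P_LDP, of UNIV \<epsilon>]) auto
  then have "\<forall>\<^sub>F k in sequentially. k > 0 \<and> measure (P k x) UNIV \<le> exp (- (real k * (\<epsilon> / 2)))"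
    using eventually_gt_at_top[of 0] by eventually_elim auto
  then obtain k where k: "k > 0" "measure (P k x) UNIV \<le> exp (- (real k * (\<epsilon> / 2)))"
    by (auto dest: eventually_happens)
  have "measure (P k x) UNIV = 1"
    using prob_space.prob_space[OF prob_measuresD(1)[OF P_prob[of k x]]]
    by (simp add: prob_measuresD(3)[OF P_prob[of k x]])
  with k have "1 \<le> exp (- (real k * (\<epsilon> / 2)))" by simp
  then have "0 \<le> - (real k * (\<epsilon> / 2))" by (simp only: one_le_exp_iff)
  moreover have "0 < real k * (\<epsilon> / 2)" using k assms by simp
  ultimately show False by linarith
qed

lemma ereal_S: assumes "f \<in> Cb" shows "ereal (S f x) = S1 c f x"
proof -
  obtain B where B: "\<And>y. \<bar>f y\<bar> \<le> B" using Cb_D[OF assms] by blast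
  have low: "ereal (- B) \<le> S1 c f x"
    unfolding S1_def
  proof (rule INF_greatest)
    fix y
    have "ereal (- B) \<le> ereal (f y)" using B[of y] by simp
    also have "\<dots> \<le> enn2ereal (c x y) + ereal (f y)" using add_right_mono[OF enn2ereal_nonneg] by fastforce
    finally show "ereal (- B) \<le> enn2ereal (c x y) + ereal (f y)" .
  qed
  obtain y where y: "c x y < ennreal 1" using c_small[of 1] by auto
  have "S1 c f x \<le> enn2ereal (c x y) + ereal (f y)"
    unfolding S1_def by (rule INF_lower) simp
  also have "\<dots> < \<infinity>" using y by (cases "c x y") (auto simp: enn2ereal_ennreal)
  finally have "S1 c f x < \<infinity>" .
  with low have "\<bar>S1 c f x\<bar> \<noteq> \<infinity>" by (cases "S1 c f x") auto
  then show ?thesis by (simp add: S_def ereal_real')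
qed

lemma S_le: assumes "f \<in> Cb" "c x y \<le> ennreal r" "0 \<le> r" shows "S f x \<le> r + f y"
proof -
  have "ereal (S f x) \<le> enn2ereal (c x y) + ereal (f y)"
    unfolding ereal_S[OF assms(1)] S1_def by (rule INF_lower) simp
  also have "enn2ereal (c x y) \<le> ereal r"
    using assms(2,3) by (simp add: less_eq_ennreal.rep_eq enn2ereal_ennreal)
  then have "enn2ereal (c x y) + ereal (f y) \<le> ereal r + ereal (f y)" by (rule add_right_mono)
  finally show ?thesis by simp
qed

lemma S_ge:
  assumes f: "f \<in> Cb" and ge: "\<And>y r. 0 \<le> r \<Longrightarrow> c x y = ennreal r \<Longrightarrow> v \<le> r + f y"
  shows "v \<le> S f x"
proof -
  have "ereal v \<le> ereal (S f x)"
    unfolding ereal_S[OF f] S1_def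
  proof (rule INF_greatest)
    fix y show "ereal v \<le> enn2ereal (c x y) + ereal (f y)"
    proof (cases "c x y")
      case (real r)
      then show ?thesis using ge[of r y] by (simp add: enn2ereal_ennreal)
    qed simp
  qed
  then show ?thesis by simp
qed

lemma S_witness:
  assumes f: "f \<in> Cb" and v: "S f x < v"
  obtains y r where "0 \<le> r" "c x y = ennreal r" "r + f y < v"
proof (rule ccontr)
  assume "\<not> thesis"
  have "v \<le> S f x"
  proof (rule S_ge[OF f])
    fix y r assume "0 \<le> r" "c x y = ennreal r"
    with that[of r y] \<open>\<not> thesis\<close> show "v \<le> r + f y" by linarith
  qed
  with v show False by simp
qed

lemma S_bound: assumes f: "f \<in> Cb" and B: "\<And>y. \<bar>f y\<bar> \<le> B" shows "\<bar>S f x\<bar> \<le> B"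
proof -
  have "-B \<le> S f x"
  proof (rule S_ge[OF f])
    fix y and r :: real assume "0 \<le> r"
    then show "-B \<le> r + f y" using B[of y] by linarith
  qed
  moreover have "S f x \<le> B + e" if "e > 0" for e
  proof -
    obtain y where "c x y < ennreal e" by (rule c_small[OF \<open>e > 0\<close>])
    with S_le[OF f, of x y e] \<open>e > 0\<close> have "S f x \<le> e + f y" by simp
    then show ?thesis using B[of y] by linarith
  qed
  then have "S f x \<le> B" by (rule field_le_epsilon)
  ultimately show ?thesis by (simp add: abs_le_iff)
qed

lemma S_mono: assumes "f \<in> Cb" "g \<in> Cb" "\<And>y. f y \<le> g y" shows "S f x \<le> S g x"
proof (rule S_ge[OF assms(2)])
  fix y r assume "0 \<le> r" "c x y = ennreal r"
  then show "S f x \<le> r + g y" using S_le[OF assms(1), of x y r] assms(3)[of y] by simp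
qed

lemma S_zero: "S (\<lambda>_. 0) x = 0"
  using S_bound[OF Cb_const, of 0 0 x] by simp

section \<open>Laplace integrals and their logarithms\<close>

lemma Cb_tilt: "f \<in> Cb \<Longrightarrow> (\<lambda>y. exp (- (real k * f y))) \<in> Cb"
  using Cb_exp[OF Cb_cmult[of f "- real k"]] by simp

lemma Z_bounds:
  assumes f: "f \<in> Cb" and B: "\<And>y. \<bar>f y\<bar> \<le> B"
  shows "exp (- (real k * B)) \<le> Z k f x" "Z k f x \<le> exp (real k * B)"
proof -
  have le: "- (real k * B) \<le> - (real k * f y)" "- (real k * f y) \<le> real k * B" for y
    using mult_left_mono[of "f y" B "real k"] mult_left_mono[of "-f y" B "real k"] B[of y] by auto
  then show "exp (- (real k * B)) \<le> Z k f x" "Z k f x \<le> exp (real k * B)"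
    unfolding Z_def using Cb_integrable[OF P_prob Cb_tilt[OF f]]
    by (auto intro!: integral_ge_bound[OF P_prob] integral_le_bound[OF P_prob])
qed

lemma Z_pos: assumes "f \<in> Cb" shows "0 < Z k f x"
proof -
  obtain B where "\<And>y. \<bar>f y\<bar> \<le> B" using Cb_D[OF assms] by blast
  from less_le_trans[OF exp_gt_zero Z_bounds(1)[OF assms this]] show ?thesis .
qed

lemma continuous_on_Z: "f \<in> Cb \<Longrightarrow> continuous_on UNIV (Z k f)"
  unfolding Z_def[abs_def] using P_feller Cb_tilt by (auto simp: feller_def)

lemma continuous_on_G: "f \<in> Cb \<Longrightarrow> continuous_on UNIV (G k f)"
  unfolding G_def[abs_def] divide_inverse
  using Z_pos[of f k] by (intro continuous_intros continuous_on_Z) (auto simp: less_imp_neq[symmetric])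

lemma exp_G: "f \<in> Cb \<Longrightarrow> k > 0 \<Longrightarrow> exp (- (real k * G k f x)) = Z k f x"
  using Z_pos[of f k x] by (simp add: G_def)

lemma G_le_iff: assumes "f \<in> Cb" "k > 0" shows "G k f x \<le> v \<longleftrightarrow> exp (- (real k * v)) \<le> Z k f x"
proof -
  have "exp (- (real k * v)) \<le> Z k f x \<longleftrightarrow> real k * G k f x \<le> real k * v"
    unfolding exp_G[OF assms, symmetric] by simp
  then show ?thesis using assms(2) by simp
qed

lemma G_ge_iff: assumes "f \<in> Cb" "k > 0" shows "v \<le> G k f x \<longleftrightarrow> Z k f x \<le> exp (- (real k * v))"
proof -
  have "Z k f x \<le> exp (- (real k * v)) \<longleftrightarrow> real k * v \<le> real k * G k f x"
    unfolding exp_G[OF assms, symmetric] by simp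
  then show ?thesis using assms(2) by simp
qed

lemma G_bound: assumes f: "f \<in> Cb" and B: "\<And>y. \<bar>f y\<bar> \<le> B" shows "\<bar>G k f x\<bar> \<le> B"
proof (cases "k = 0")
  case True
  then show ?thesis using order_trans[OF abs_ge_zero B] by (simp add: G_def)
next
  case False
  then show ?thesis
    using Z_bounds[OF f B, of k x] G_le_iff[OF f, of k x B] G_ge_iff[OF f, of k "-B" x] by (simp add: abs_le_iff)
qed

lemma G_Cb: assumes "f \<in> Cb" shows "G k f \<in> Cb"
proof -
  obtain B where "\<And>y. \<bar>f y\<bar> \<le> B" using Cb_D[OF assms] by blast
  from Cb_I[OF continuous_on_G[OF assms] G_bound[OF assms this]] show ?thesis .
qed

text \<open>\<open>G k\<close> is monotone and shifts along with additive constants, hence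
  nonexpansive in the supremum norm, uniformly in \<open>k\<close> and \<open>x\<close>.\<close>

lemma G_Lipschitz:
  assumes f: "f \<in> Cb" and g: "g \<in> Cb" and le: "\<And>y. \<bar>f y - g y\<bar> \<le> e"
  shows "\<bar>G k f x - G k g x\<bar> \<le> e"
proof (cases "k = 0")
  case True
  then show ?thesis using order_trans[OF abs_ge_zero le] by (simp add: G_def)
next
  case False
  have *: "G k f x \<le> G k g x + e" if f: "f \<in> Cb" and g: "g \<in> Cb" and le: "\<And>y. \<bar>f y - g y\<bar> \<le> e" for f g
  proof -
    have "exp (- (real k * (G k g x + e))) = exp (- (real k * e)) * Z k g x"
      using False by (simp add: exp_G[OF g, symmetric] exp_add[symmetric] algebra_simps)
    also have "\<dots> = (\<integral>y. exp (- (real k * e)) * exp (- (real k * g y)) \<partial>P k x)"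
      by (simp add: Z_def)
    also have "\<dots> \<le> Z k f x"
      unfolding Z_def
    proof (rule integral_mono_bounded[OF P_prob])
      show "integrable (P k x) (\<lambda>y. exp (- (real k * e)) * exp (- (real k * g y)))"
        by (intro Cb_integrable[OF P_prob] Cb_cmult Cb_tilt g)
      show "integrable (P k x) (\<lambda>y. exp (- (real k * f y)))" by (intro Cb_integrable[OF P_prob] Cb_tilt f)
      fix y
      have "real k * f y \<le> real k * (e + g y)" using le[of y] by (intro mult_left_mono) auto
      then show "exp (- (real k * e)) * exp (- (real k * g y)) \<le> exp (- (real k * f y))"
        by (simp add: exp_add[symmetric] algebra_simps)
    qed
    finally show ?thesis using G_le_iff[OF f] False by simp
  qed
  show ?thesis
    using *[OF f g le] *[OF g f] le by (simp add: abs_le_iff abs_minus_commute)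
qed

lemma varadhan_lower:
  assumes f: "f \<in> Cb" and v: "S f x < v"
  shows "\<forall>\<^sub>F k in sequentially. exp (- (real k * v)) \<le> Z k f x"
proof -
  obtain y r where r: "0 \<le> r" "c x y = ennreal r" "r + f y < v" using S_witness[OF f v] .
  \<comment> \<open>The slack is split evenly: one half for the variation of \<open>f\<close> near
    \<open>y\<close>, one half for the loss in the lower estimate.\<close>
  define \<delta> where "\<delta> = (v - (r + f y)) / 2"
  have \<delta>: "\<delta> > 0" "r + f y + 2 * \<delta> = v" using r by (auto simp: \<delta>_def field_simps)
  define U where "U = {y'. f y' < f y + \<delta>}"
  have U: "open U" "y \<in> U" using Cb_D(1)[OF f] \<delta> by (auto simp: U_def intro!: open_Collect_less continuous_intros)
  have "\<forall>\<^sub>F k in sequentially. exp (- (real k * (r + \<delta>))) \<le> measure (P k x) U"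
    using k_LDP_lower[OF P_LDP U] r \<delta> by (simp add: ennreal_less_iff)
  then show ?thesis
  proof eventually_elim
    case (elim k)
    interpret p: prob_space "P k x" using P_prob prob_measuresD by blast
    have "exp (- (real k * v)) = exp (- (real k * (f y + \<delta>))) * exp (- (real k * (r + \<delta>)))"
      using \<delta>(2)[symmetric] by (simp add: exp_add[symmetric] algebra_simps)
    also have "\<dots> \<le> exp (- (real k * (f y + \<delta>))) * measure (P k x) U"
      using elim by (intro mult_left_mono) auto
    also have "\<dots> = (\<integral>y'. exp (- (real k * (f y + \<delta>))) * indicator U y' \<partial>P k x)"
      using U prob_measuresD[OF P_prob[of k x]] by simp
    also have "\<dots> \<le> Z k f x"
      unfolding Z_def
    proof (rule integral_mono_bounded[OF P_prob])
      show "integrable (P k x) (\<lambda>y'. exp (- (real k * (f y + \<delta>))) * indicator U y')"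
        using U by (intro integrable_mult_right integrable_bounded[OF P_prob, of _ 1]) auto
      show "integrable (P k x) (\<lambda>y. exp (- (real k * f y)))" by (intro Cb_integrable[OF P_prob] Cb_tilt f)
      show "exp (- (real k * (f y + \<delta>))) * indicator U y' \<le> exp (- (real k * f y'))" for y'
        by (auto simp: U_def indicator_def intro!: mult_left_mono)
    qed
    finally show ?case .
  qed
qed

text \<open>The range of \<open>f\<close> is cut into finitely many closed bands. On a band
  \<open>f\<close> is almost constant, and the definition of \<open>S f x\<close> as an infimum
  bounds \<open>c x\<close> from below there.\<close>

lemma varadhan_upper:
  assumes f: "f \<in> Cb" and v: "v < S f x"
  shows "\<forall>\<^sub>F k in sequentially. Z k f x \<le> exp (- (real k * v))"
proof -
  obtain B where B: "\<And>y. \<bar>f y\<bar> \<le> B" using Cb_D[OF f] by blast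
  \<comment> \<open>Three losses of \<delta>: the height of a band, the gap in the upper estimate,
    and the number of bands.\<close>
  define \<delta> where "\<delta> = (S f x - v) / 3"
  have "3 * \<delta> = S f x - v" by (simp add: \<delta>_def)
  then have \<delta>: "\<delta> > 0" "S f x - 3 * \<delta> = v" using v by linarith+
  obtain N :: nat where N: "2 * B < real N * \<delta>" using ex_less_of_nat_mult[OF \<delta>(1)] by blast
  define A where "A j = {y. - B + real j * \<delta> \<le> f y \<and> f y \<le> - B + (real j + 1) * \<delta>}" for j :: nat
  have A: "closed (A j)" for j
    using Cb_D(1)[OF f] by (auto simp: A_def intro!: closed_Collect_le closed_Collect_conj continuous_intros)
  \<comment> \<open>Bound for \<open>c x\<close> on band \<open>j\<close>, taken from the top value
    of \<open>f\<close> there; the maximum with 0 meets the sign condition of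
    \<open>k_LDP_upper\<close>.\<close>
  define s where "s j = max 0 (S f x - (- B + (real j + 1) * \<delta>))" for j :: nat
  have "\<forall>\<^sub>F k in sequentially. measure (P k x) (A j) \<le> exp (- (real k * (s j - \<delta>)))" for j
  proof (rule k_LDP_upper[OF P_LDP A])
    show "0 \<le> s j" by (simp add: s_def)
    show "s j - \<delta> < s j" using \<delta> by simp
    fix y assume y: "y \<in> A j"
    show "ennreal (s j) \<le> c x y"
    proof (cases "c x y")
      case (real r)
      then show ?thesis using S_le[OF f, of x y r] y by (simp add: s_def A_def ennreal_leI)
    qed simp
  qed
  then have ev: "\<forall>\<^sub>F k in sequentially. \<forall>j\<in>{..N}. measure (P k x) (A j) \<le> exp (- (real k * (s j - \<delta>)))"
    by (intro eventually_ball_finite) auto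
  obtain m :: nat where m: "real N < real m * \<delta>" using ex_less_of_nat_mult[OF \<delta>(1)] by blast
  have "\<forall>\<^sub>F k in sequentially. real N + 1 \<le> exp (real k * \<delta>)"
    using eventually_ge_at_top[of m]
  proof eventually_elim
    case (elim k)
    then have "real m * \<delta> \<le> real k * \<delta>" using \<delta>(1) by (intro mult_right_mono) auto
    then show ?case using m exp_ge_add_one_self[of "real k * \<delta>"] by linarith
  qed
  with ev show ?thesis
  proof eventually_elim
    case (elim k)
    interpret p: prob_space "P k x" using P_prob prob_measuresD by blast
    let ?e = "\<lambda>j::nat. exp (- (real k * (- B + real j * \<delta>)))"
    have int: "integrable (P k x) (\<lambda>y. indicator (A j) y :: real)" for j
      using A by (intro integrable_bounded[OF P_prob, of _ 1]) auto
    have "Z k f x \<le> (\<integral>y. (\<Sum>j\<le>N. ?e j * indicator (A j) y) \<partial>P k x)"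
      unfolding Z_def
    proof (rule integral_mono_bounded[OF P_prob])
      show "integrable (P k x) (\<lambda>y. exp (- (real k * f y)))" by (intro Cb_integrable[OF P_prob] Cb_tilt f)
      show "integrable (P k x) (\<lambda>y. \<Sum>j\<le>N. ?e j * indicator (A j) y)"
        using int by (intro Bochner_Integration.integrable_sum integrable_mult_right)
      fix y
      define j where "j = nat \<lfloor>(f y + B) / \<delta>\<rfloor>"
      have pos: "0 \<le> (f y + B) / \<delta>" using B[of y] \<delta> by (simp add: abs_le_iff)
      then have j: "real j \<le> (f y + B) / \<delta>" "(f y + B) / \<delta> < real j + 1" unfolding j_def by linarith+
      then have j': "real j * \<delta> \<le> f y + B" "f y + B < (real j + 1) * \<delta>"
        using \<delta>(1) by (simp_all add: field_simps)
      have "real j * \<delta> < real N * \<delta>" using j'(1) N B[of y] by (simp add: abs_le_iff)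
      then have "j \<in> {..N}" using \<delta>(1) by simp
      moreover have "y \<in> A j" using j' by (simp add: A_def)
      moreover have "exp (- (real k * f y)) \<le> ?e j"
        using mult_left_mono[of "- B + real j * \<delta>" "f y" "real k"] j' by simp
      ultimately have "exp (- (real k * f y)) \<le> ?e j * indicator (A j) y" by simp
      also have "\<dots> \<le> (\<Sum>j\<le>N. ?e j * indicator (A j) y)"
        using \<open>j \<in> {..N}\<close> by (intro member_le_sum) auto
      finally show "exp (- (real k * f y)) \<le> (\<Sum>j\<le>N. ?e j * indicator (A j) y)" .
    qed
    also have "\<dots> = (\<Sum>j\<le>N. ?e j * measure (P k x) (A j))"
      using int by (subst Bochner_Integration.integral_sum) (auto simp: prob_measuresD[OF P_prob])
    also have "\<dots> \<le> (\<Sum>j\<le>N. exp (- (real k * (S f x - 2 * \<delta>))))"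
    proof (rule sum_mono)
      fix j assume j: "j \<in> {..N}"
      have "?e j * measure (P k x) (A j) \<le> ?e j * exp (- (real k * (s j - \<delta>)))"
        using elim j by (intro mult_left_mono) auto
      also have "\<dots> = exp (- (real k * (- B + real j * \<delta> + s j - \<delta>)))"
        by (simp add: exp_add[symmetric] algebra_simps)
      also have "\<dots> \<le> exp (- (real k * (S f x - 2 * \<delta>)))"
      proof -
        have "S f x - 2 * \<delta> \<le> - B + real j * \<delta> + s j - \<delta>" by (simp add: s_def algebra_simps)
        then show ?thesis by (simp add: mult_left_mono)
      qed
      finally show "?e j * measure (P k x) (A j) \<le> exp (- (real k * (S f x - 2 * \<delta>)))" .
    qed
    also have "\<dots> = (real N + 1) * exp (- (real k * (S f x - 2 * \<delta>)))" by simp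
    also have "\<dots> \<le> exp (real k * \<delta>) * exp (- (real k * (S f x - 2 * \<delta>)))"
      using elim by (intro mult_right_mono) auto
    also have "\<dots> = exp (- (real k * v))" by (simp add: exp_add[symmetric] \<delta>(2)[symmetric] algebra_simps)
    finally show ?case .
  qed
qed

lemma varadhan: assumes f: "f \<in> Cb" shows "(\<lambda>k. G k f x) \<longlonglongrightarrow> S f x"
proof (rule order_tendstoI)
  fix u assume "u < S f x"
  then obtain v where v: "u < v" "v < S f x" using dense by blast
  show "\<forall>\<^sub>F k in sequentially. u < G k f x"
    using varadhan_upper[OF f v(2)] eventually_gt_at_top[of 0]
  proof eventually_elim
    case (elim k)
    then show ?case using v(1) G_ge_iff[OF f, of k v x] by simp
  qed
next
  fix u assume "S f x < u"
  then obtain v where v: "S f x < v" "v < u" using dense by blast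
  show "\<forall>\<^sub>F k in sequentially. G k f x < u"
    using varadhan_lower[OF f v(1)] eventually_gt_at_top[of 0]
  proof eventually_elim
    case (elim k)
    then show ?case using v(2) G_le_iff[OF f, of k x v] by simp
  qed
qed

text \<open>An infimum over uncountably many points carries no measurability of its own; it comes
  from the pointwise limit of the continuous \<open>G k f\<close>.\<close>

lemma S_borel: "f \<in> Cb \<Longrightarrow> S f \<in> borel_measurable borel"
  by (rule borel_measurable_LIMSEQ_real[OF varadhan]) (auto intro: Cb_borel G_Cb)

lemma integral_G_tendsto:
  assumes f: "f \<in> Cb" shows "(\<lambda>k. \<integral>x. G k f x \<partial>\<mu>) \<longlonglongrightarrow> (\<integral>x. S f x \<partial>\<mu>)"
proof -
  obtain B where B: "\<And>y. \<bar>f y\<bar> \<le> B" using Cb_D[OF f] by blast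
  show ?thesis
    using varadhan[OF f] G_bound[OF f B] S_borel[OF f] Cb_borel[OF G_Cb[OF f]]
    by (intro integral_dominated_convergence[where w="\<lambda>_. B"]) (auto simp: prob_measuresD[OF mu])
qed

text \<open>Interchange of an infimum with an increasing limit, by Dini's argument on one compact
  level set of \<open>c x\<close>; outside it the cost alone exceeds every relevant value.\<close>

lemma S_tendsto_increasing:
  assumes g: "\<And>j. g j \<in> Cb" and f: "f \<in> Cb" and B: "\<And>j y. \<bar>g j y\<bar> \<le> B"
    and inc: "\<And>y. incseq (\<lambda>j. g j y)" and lim: "\<And>y. (\<lambda>j. g j y) \<longlonglongrightarrow> f y"
  shows "(\<lambda>j. S (g j) x) \<longlonglongrightarrow> S f x"
proof (rule order_tendstoI)
  have le: "g j y \<le> f y" for j y by (rule incseq_le[OF inc lim])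
  fix u assume "S f x < u"
  then have "S (g j) x < u" for j using S_mono[OF g f le, of j x] by linarith
  then show "\<forall>\<^sub>F j in sequentially. S (g j) x < u" by simp
next
  have "\<bar>f y\<bar> \<le> B" for y
    by (rule tendsto_upperbound[OF tendsto_rabs[OF lim]]) (use B in auto)
  then have SB: "\<bar>S f x\<bar> \<le> B" by (rule S_bound[OF f])
  fix u assume "u < S f x"
  define \<epsilon> where "\<epsilon> = (S f x - u) / 2"
  have \<epsilon>: "\<epsilon> > 0" "S f x - \<epsilon> > u" using \<open>u < S f x\<close> by (auto simp: \<epsilon>_def field_simps)
  \<comment> \<open>The level \<open>2 * B\<close> suffices: beyond it, cost plus \<open>g j\<close>
    exceeds \<open>2 * B - B\<close>, and \<open>S f x\<close> is at most \<open>B\<close>.\<close>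
  define K where "K = {y. c x y \<le> ennreal (2 * B)}"
  have "compact K" using c_good[of x] by (simp add: K_def good_rate_function_def)
  have opn: "open {y. f y - \<epsilon> < g j y}" for j
    using Cb_D(1)[OF f] Cb_D(1)[OF g] by (intro open_Collect_less continuous_intros) auto
  have cov: "K \<subseteq> (\<Union>j\<in>UNIV. {y. f y - \<epsilon> < g j y})"
  proof
    fix y
    have "\<forall>\<^sub>F j in sequentially. f y - \<epsilon> < g j y" using \<epsilon>(1) by (intro order_tendstoD(1)[OF lim]) simp
    then show "y \<in> (\<Union>j. {y. f y - \<epsilon> < g j y})" by (auto dest: eventually_happens)
  qed
  from compactE_image[OF \<open>compact K\<close> opn cov]
  obtain J where J: "finite J" "K \<subseteq> (\<Union>j\<in>J. {y. f y - \<epsilon> < g j y})" .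
  obtain m where "\<forall>j\<in>J. j \<le> m" using J(1) unfolding finite_nat_set_iff_bounded_le ..
  then have m: "\<And>j. j \<in> J \<Longrightarrow> j \<le> m" by (rule bspec)
  have "S f x - \<epsilon> \<le> S (g j) x" if "j \<ge> m" for j
  proof (rule S_ge[OF g])
    fix y r assume r: "0 \<le> r" "c x y = ennreal r"
    show "S f x - \<epsilon> \<le> r + g j y"
    proof (cases "y \<in> K")
      case True
      from subsetD[OF J(2) this] obtain i where i: "i \<in> J" "f y - \<epsilon> < g i y" by (elim UN_E CollectE)
      have "g i y \<le> g j y" using m[OF i(1)] that inc[of y] by (auto simp: incseq_def)
      then show ?thesis using S_le[OF f, of x y r] r i by simp
    next
      case False
      then have "2 * B < r" using r SB by (auto simp: K_def ennreal_le_iff2 not_le)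
      then show ?thesis using SB B[of j y] \<epsilon> by (simp add: abs_le_iff)
    qed
  qed
  then show "\<forall>\<^sub>F j in sequentially. u < S (g j) x"
    using \<epsilon> by (auto intro!: eventually_sequentiallyI[of m] intro: less_le_trans)
qed

text \<open>Lower semicontinuity makes \<open>c x\<close> the supremum of
  \<open>S f x - f y\<close>: a tent of depth \<open>s\<close>, supported where \<open>c x\<close>
  exceeds \<open>s\<close>, gains \<open>s\<close> at \<open>y\<close> without making
  \<open>S f x\<close> negative.\<close>

lemma cost_dual_less:
  assumes "t < c x y" obtains f where "f \<in> Cb" "t < ennreal (S f x - f y)"
proof -
  obtain s' where s': "t < s'" "s' < c x y" using dense[OF assms] by blast
  obtain s where s: "s' = ennreal s" "0 \<le> s" using s' by (cases s') auto
  have "open (- {y. c x y \<le> s'})" "y \<in> - {y. c x y \<le> s'}" using lsc s' by (auto simp: open_closed)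
  then obtain e where e: "e > 0" "ball y e \<subseteq> - {y. c x y \<le> s'}" using open_contains_ball by blast
  define f where "f y' = - s * max 0 (1 - dist y' y / e)" for y'
  have "\<bar>max 0 (1 - dist y' y / e)\<bar> \<le> 1" for y' using e(1) by auto
  then have f: "f \<in> Cb"
    unfolding f_def[abs_def] using e(1)
    by (intro Cb_cmult Cb_I[where B=1] continuous_intros) auto
  have "0 \<le> S f x"
  proof (rule S_ge[OF f])
    fix y' r assume r: "0 \<le> r" "c x y' = ennreal r"
    show "0 \<le> r + f y'"
    proof (cases "dist y' y < e")
      case True
      then have "y' \<in> ball y e" by (simp add: dist_commute)
      then have "s' < c x y'" using e(2) by (auto simp: not_le)
      then have "s \<le> r" using r s by (simp add: ennreal_less_iff)
      moreover have "s * max 0 (1 - dist y' y / e) \<le> s * 1" using s e by (intro mult_left_mono) auto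
      ultimately show ?thesis by (simp add: f_def)
    next
      case False
      then have "f y' = 0" using e(1) by (simp add: f_def max_def)
      then show ?thesis using r by simp
    qed
  qed
  moreover have "f y = - s" by (simp add: f_def)
  ultimately have "s' \<le> ennreal (S f x - f y)" unfolding s by (intro ennreal_leI) simp
  then show ?thesis using that[OF f] s'(1) by (blast intro: less_le_trans)
qed

lemma cost_dual_le: assumes "f \<in> Cb" shows "ennreal (S f x - f y) \<le> c x y"
proof (cases "c x y")
  case (real r)
  then show ?thesis using S_le[OF assms, of x y r] by (simp add: ennreal_leI)
qed simp

end

section \<open>Exponentially tilted laws\<close>

text \<open>Both sides are multiplied by \<open>1 - u\<close>: the left becomes at most 1, the right
  at least 1.\<close>

lemma exp_le_quadratic: fixes u :: real assumes "\<bar>u\<bar> \<le> 1/2" shows "exp u \<le> 1 + u + 2 * u\<^sup>2"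
proof -
  have "1 - u \<le> exp (- u)" using exp_ge_add_one_self[of "-u"] by simp
  then have "exp u * (1 - u) \<le> exp u * exp (- u)" by (intro mult_left_mono) auto
  then have 1: "exp u * (1 - u) \<le> 1" by (simp add: exp_minus)
  have "(1 - u) * (1 + u + 2 * u\<^sup>2) = 1 + u\<^sup>2 * (1 - 2 * u)" by (simp add: algebra_simps power2_eq_square)
  moreover have "0 \<le> u\<^sup>2 * (1 - 2 * u)" using assms by (intro mult_nonneg_nonneg) auto
  ultimately have "exp u * (1 - u) \<le> (1 + u + 2 * u\<^sup>2) * (1 - u)" using 1 by (simp add: mult.commute)
  then show ?thesis by (rule mult_right_le_imp_le) (use assms in linarith)
qed

context feller_LDP
begin

text \<open>The mean of \<open>g\<close> under the Gibbs tilt of \<open>P k x\<close>, whose density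
  is \<open>exp (- k * f)\<close> normalised by \<open>Z k f x\<close>. The measure itself appears
  later as \<open>tilted_law\<close>.\<close>

definition tilt :: "nat \<Rightarrow> ('a \<Rightarrow> real) \<Rightarrow> ('a \<Rightarrow> real) \<Rightarrow> 'a \<Rightarrow> real" where
  "tilt k f g x = (\<integral>y. g y * exp (- (real k * f y)) \<partial>P k x) / Z k f x"

lemma tilt_integrable: "f \<in> Cb \<Longrightarrow> g \<in> Cb \<Longrightarrow> integrable (P k x) (\<lambda>y. g y * exp (- (real k * f y)))"
  by (intro Cb_integrable[OF P_prob] Cb_mult Cb_tilt)

lemma tilt_const: "f \<in> Cb \<Longrightarrow> tilt k f (\<lambda>_. a) x = a"
  using Z_pos[of f k x] by (simp add: tilt_def Z_def)

lemma tilt_add: "f \<in> Cb \<Longrightarrow> g \<in> Cb \<Longrightarrow> h \<in> Cb \<Longrightarrow> tilt k f (\<lambda>y. g y + h y) x = tilt k f g x + tilt k f h x"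
  using tilt_integrable[of f g k x] tilt_integrable[of f h k x]
  by (simp add: tilt_def add_divide_distrib distrib_right)

lemma tilt_cmult: "tilt k f (\<lambda>y. a * g y) x = a * tilt k f g x"
  by (simp add: tilt_def mult.assoc)

lemma tilt_affine:
  assumes f: "f \<in> Cb" and g: "g \<in> Cb" shows "tilt k f (\<lambda>y. a + b * g y) x = a + b * tilt k f g x"
  using tilt_add[OF f Cb_const Cb_cmult[OF g], of k a b x] by (simp only: tilt_const[OF f] tilt_cmult)

lemma tilt_uminus: "tilt k f (\<lambda>y. - g y) x = - tilt k f g x"
  using tilt_cmult[of k f "-1" g x] by simp

lemma tilt_sum:
  assumes f: "f \<in> Cb" and "\<And>i. i \<in> I \<Longrightarrow> g i \<in> Cb"
  shows "tilt k f (\<lambda>y. \<Sum>i\<in>I. g i y) x = (\<Sum>i\<in>I. tilt k f (g i) x)"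
  using assms(2)
proof (induction I rule: infinite_finite_induct)
  case (insert i I)
  then show ?case using tilt_add[OF f, of "g i" "\<lambda>y. \<Sum>i\<in>I. g i y"] by (simp add: Cb_sum)
qed (use tilt_const[OF f, of _ 0] in auto)

lemma tilt_mono:
  assumes f: "f \<in> Cb" and g: "g \<in> Cb" and h: "h \<in> Cb" and le: "\<And>y. g y \<le> h y"
  shows "tilt k f g x \<le> tilt k f h x"
  unfolding tilt_def using Z_pos[OF f, of k x] le
  by (intro divide_right_mono integral_mono_bounded[OF P_prob] tilt_integrable f g h mult_right_mono) auto

lemma tilt_bound:
  assumes f: "f \<in> Cb" and g: "g \<in> Cb" and B: "\<And>y. \<bar>g y\<bar> \<le> B"
  shows "\<bar>tilt k f g x\<bar> \<le> B"
proof -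
  have "- B \<le> g y" "g y \<le> B" for y using B[of y] by linarith+
  then have "tilt k f (\<lambda>_. - B) x \<le> tilt k f g x" "tilt k f g x \<le> tilt k f (\<lambda>_. B) x"
    by (intro tilt_mono f g Cb_const; simp)+
  then show ?thesis by (simp add: tilt_const[OF f] abs_le_iff)
qed

lemma tilt_Cb: assumes f: "f \<in> Cb" and g: "g \<in> Cb" shows "tilt k f g \<in> Cb"
proof -
  obtain B where B: "\<And>y. \<bar>g y\<bar> \<le> B" using Cb_D[OF g] by blast
  have "(\<lambda>y. g y * exp (- (real k * f y))) \<in> Cb" by (intro Cb_mult Cb_tilt f g)
  then have "continuous_on UNIV (\<lambda>x. \<integral>y. g y * exp (- (real k * f y)) \<partial>P k x)"
    using P_feller by (auto simp: feller_def)
  then have "continuous_on UNIV (tilt k f g)"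
    unfolding tilt_def[abs_def] using Z_pos[OF f, of k]
    by (intro continuous_intros continuous_on_Z f) (auto simp: less_imp_neq[symmetric])
  then show ?thesis using tilt_bound[OF f g B] by (rule Cb_I)
qed

lemma Z_add: assumes f: "f \<in> Cb" shows "Z k (\<lambda>y. f y + g y) x = Z k f x * tilt k f (\<lambda>y. exp (- (real k * g y))) x"
  using Z_pos[OF f, of k x] by (simp add: tilt_def Z_def exp_add[symmetric] algebra_simps)

text \<open>Jensen's inequality under the tilted law, from \<open>1 + u \<le> exp u\<close>.\<close>

lemma G_add_le:
  assumes f: "f \<in> Cb" and g: "g \<in> Cb" and k: "k > 0"
  shows "G k (\<lambda>y. f y + g y) x \<le> G k f x + tilt k f g x"
proof -
  let ?m = "tilt k f g x"
  have "exp (- (real k * (G k f x + ?m))) = Z k f x * exp (- (real k * ?m))"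
    by (simp add: exp_G[OF f k, symmetric] exp_add[symmetric] algebra_simps)
  also have "\<dots> = Z k f x * tilt k f (\<lambda>y. exp (- (real k * ?m)) * ((1 + real k * ?m) + (- real k) * g y)) x"
    unfolding tilt_cmult tilt_affine[OF f g] by simp
  also have "\<dots> \<le> Z k f x * tilt k f (\<lambda>y. exp (- (real k * g y))) x"
  proof (intro mult_left_mono tilt_mono f)
    show "(\<lambda>y. exp (- (real k * ?m)) * ((1 + real k * ?m) + (- real k) * g y)) \<in> Cb"
      by (intro Cb_cmult Cb_add Cb_const g)
    show "(\<lambda>y. exp (- (real k * g y))) \<in> Cb" by (rule Cb_tilt[OF g])
    show "exp (- (real k * ?m)) * ((1 + real k * ?m) + (- real k) * g y) \<le> exp (- (real k * g y))" for y
    proof -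
      have "exp (- (real k * ?m)) * ((1 + real k * ?m) + (- real k) * g y)
        \<le> exp (- (real k * ?m)) * exp (real k * ?m + (- real k) * g y)"
        unfolding add.assoc by (intro mult_left_mono exp_ge_add_one_self) auto
      also have "\<dots> = exp (- (real k * g y))" by (simp add: exp_add[symmetric])
      finally show ?thesis .
    qed
    show "0 \<le> Z k f x" using Z_pos[OF f, of k x] by simp
  qed
  also have "\<dots> = Z k (\<lambda>y. f y + g y) x" by (rule Z_add[OF f, symmetric])
  finally show ?thesis using G_le_iff[OF Cb_add[OF f g] k] by simp
qed

lemma G_zero: "G k (\<lambda>_. 0) x = 0"
  using G_bound[OF Cb_const, of 0 0 k x] by simp

text \<open>Gibbs' variational inequality: \<open>k * (G k f x - tilt k f f x)\<close> is the
  relative entropy of the tilted law with respect to \<open>P k x\<close>. It is Jensen's inequality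
  for the step from \<open>f\<close> to \<open>- F\<close>.\<close>

lemma tilt_le_entropy:
  assumes f: "f \<in> Cb" and F: "F \<in> Cb" and k: "k > 0"
  shows "tilt k f F x \<le> G k f x - tilt k f f x - G k (\<lambda>y. - F y) x"
proof -
  have "G k (\<lambda>y. f y + (- f y + - F y)) x \<le> G k f x + tilt k f (\<lambda>y. - f y + - F y) x"
    by (intro G_add_le f Cb_add Cb_uminus F k)
  also have "tilt k f (\<lambda>y. - f y + - F y) x = - tilt k f f x - tilt k f F x"
    using tilt_add[OF f Cb_uminus[OF f] Cb_uminus[OF F]] by (simp add: tilt_uminus)
  finally show ?thesis by simp
qed

lemma entropy_nonneg:
  assumes f: "f \<in> Cb" and k: "k > 0"
  shows "tilt k f f x \<le> G k f x"
  using tilt_le_entropy[OF f Cb_const k, of 0] by (simp add: tilt_const[OF f] G_zero)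

text \<open>A one-sided second-order expansion, with an error uniform in \<open>x\<close>; it takes
  the place of differentiating under the integral. The bound on \<open>s\<close> keeps the exponent
  in the range of \<open>exp_le_quadratic\<close>.\<close>

lemma G_perturb_ge:
  assumes f: "f \<in> Cb" and g: "g \<in> Cb" and B: "\<And>y. \<bar>g y\<bar> \<le> B" and k: "k > 0"
    and s: "real k * \<bar>s\<bar> * B \<le> 1/2"
  shows "G k f x + s * tilt k f g x - 2 * real k * s\<^sup>2 * B\<^sup>2 \<le> G k (\<lambda>y. f y + s * g y) x"
proof -
  let ?m = "tilt k f g x"
  define C where "C = 2 * (real k * s * B)\<^sup>2"
  have sg: "(\<lambda>y. s * g y) \<in> Cb" by (rule Cb_cmult[OF g])
  have "Z k (\<lambda>y. f y + s * g y) x = Z k f x * tilt k f (\<lambda>y. exp (- (real k * (s * g y)))) x"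
    by (rule Z_add[OF f])
  also have "\<dots> \<le> Z k f x * tilt k f (\<lambda>y. (1 + C) + (- (real k * s)) * g y) x"
  proof (intro mult_left_mono tilt_mono f)
    show "(\<lambda>y. exp (- (real k * (s * g y)))) \<in> Cb" by (rule Cb_tilt[OF sg])
    show "(\<lambda>y. (1 + C) + (- (real k * s)) * g y) \<in> Cb" by (intro Cb_add Cb_cmult Cb_const g)
    show "0 \<le> Z k f x" using Z_pos[OF f, of k x] by simp
    fix y
    let ?u = "- (real k * (s * g y))"
    have u: "\<bar>?u\<bar> \<le> \<bar>real k * s * B\<bar>"
      using mult_left_mono[OF B[of y], of "real k * \<bar>s\<bar>"] by (simp add: abs_mult mult.assoc[symmetric])
        (metis abs_ge_self abs_ge_zero mult_left_mono mult_nonneg_nonneg of_nat_0_le_iff order_trans)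
    have "\<bar>real k * s * B\<bar> \<le> 1/2"
      using s order_trans[OF abs_ge_zero B] by (simp add: abs_mult)
    with u have "\<bar>?u\<bar> \<le> 1/2" by linarith
    then have "exp ?u \<le> 1 + ?u + 2 * ?u\<^sup>2" by (rule exp_le_quadratic)
    also have "?u\<^sup>2 \<le> (real k * s * B)\<^sup>2" using u by (simp only: abs_le_square_iff)
    finally show "exp ?u \<le> (1 + C) + (- (real k * s)) * g y" by (simp add: C_def)
  qed
  also have "tilt k f (\<lambda>y. (1 + C) + (- (real k * s)) * g y) x = 1 + C + (- (real k * s)) * ?m"
    by (rule tilt_affine[OF f g])
  also have "Z k f x * (1 + C + (- (real k * s)) * ?m) \<le> Z k f x * exp (C + (- (real k * s)) * ?m)"
    unfolding add.assoc using Z_pos[OF f, of k x] by (intro mult_left_mono exp_ge_add_one_self) auto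
  also have "\<dots> = exp (- (real k * (G k f x + s * ?m - 2 * real k * s\<^sup>2 * B\<^sup>2)))"
    by (simp add: exp_G[OF f k, symmetric] exp_add[symmetric] C_def power_mult_distrib power2_eq_square algebra_simps)
  finally show ?thesis using G_ge_iff[OF Cb_add[OF f sg] k] by simp
qed

text \<open>A near minimiser of the penalised functional is compared with its two shifts along each
  coordinate. Near optimality and the quadratic expansion together force an approximate first-order
  condition.\<close>

lemma near_stationary:
  fixes m :: nat
  assumes \<nu>: "\<nu> \<in> prob_measures" and fs: "\<And>i. i < m \<Longrightarrow> fs i \<in> Cb"
    and B: "B > 0" "\<And>i y. i < m \<Longrightarrow> \<bar>fs i y\<bar> \<le> B" and \<kappa>: "\<kappa> > 0" and \<eta>: "\<eta> > 0" and k: "k > 0"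
  defines "F \<equiv> \<lambda>a y. \<Sum>i<m. a i * fs i y"
  obtains a where
    "\<forall>i<m. \<bar>\<kappa> * a i - ((\<integral>x. tilt k (F a) (fs i) x \<partial>\<mu>) - (\<integral>y. fs i y \<partial>\<nu>))\<bar> \<le> \<eta>"
proof -
  have F: "F a \<in> Cb" for a unfolding F_def by (intro Cb_sum Cb_cmult fs) simp
  define J where "J a = - (\<integral>x. G k (F a) x \<partial>\<mu>) + (\<integral>y. F a y \<partial>\<nu>) + \<kappa> / 2 * (\<Sum>i<m. (a i)\<^sup>2)" for a
  \<comment> \<open>Curvature of \<open>J\<close> along one coordinate:
    \<open>2 * k * B\<^sup>2\<close> from \<open>G_perturb_ge\<close>, \<open>\<kappa> / 2\<close>
    from the penalty.\<close>
  define C where "C = 2 * real k * B\<^sup>2 + \<kappa> / 2"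
  \<comment> \<open>The first bound admits \<open>G_perturb_ge\<close>, the second makes the
    curvature term at most half of \<open>s0 * \<eta>\<close>. With suboptimality \<theta> equal to
    a quarter of \<open>s0 * \<eta>\<close>, the total stays below
    \<open>s0 * \<eta>\<close>.\<close>
  define s0 where "s0 = min (1 / (2 * real k * B)) (\<eta> / (2 * C))"
  define \<theta> where "\<theta> = s0 * \<eta> / 4"
  have C: "C > 0" using \<kappa> B k by (simp add: C_def add_nonneg_pos)
  have s0: "s0 > 0" "real k * s0 * B \<le> 1/2" "C * s0 \<le> \<eta> / 2"
  proof -
    show "s0 > 0" using B k \<eta> C by (simp add: s0_def)
    have "s0 \<le> 1 / (2 * real k * B)" "s0 \<le> \<eta> / (2 * C)" by (simp_all add: s0_def)
    then show "real k * s0 * B \<le> 1/2" "C * s0 \<le> \<eta> / 2" using B k C by (simp_all add: field_simps)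
  qed
  have \<theta>: "\<theta> > 0" using s0 \<eta> by (simp add: \<theta>_def)
  have Fb: "\<bar>F a y\<bar> \<le> (\<Sum>i<m. B * \<bar>a i\<bar>)" for a y
  proof -
    have "\<bar>F a y\<bar> \<le> (\<Sum>i<m. \<bar>a i * fs i y\<bar>)" unfolding F_def by (rule sum_abs)
    also have "\<dots> \<le> (\<Sum>i<m. B * \<bar>a i\<bar>)"
    proof (rule sum_mono)
      fix i assume "i \<in> {..<m}"
      then show "\<bar>a i * fs i y\<bar> \<le> B * \<bar>a i\<bar>"
        using mult_left_mono[OF B(2)[of i y], of "\<bar>a i\<bar>"] by (simp add: abs_mult mult.commute)
    qed
    finally show ?thesis .
  qed
  \<comment> \<open>Completing the square: the penalty beats the linear growth of both integrals, so
    the infimum of \<open>J\<close> is finite.\<close>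
  have "- (real m * (2 * B\<^sup>2 / \<kappa>)) \<le> J a" for a
  proof -
    have "\<bar>\<integral>x. G k (F a) x \<partial>\<mu>\<bar> \<le> (\<Sum>i<m. B * \<bar>a i\<bar>)" "\<bar>\<integral>y. F a y \<partial>\<nu>\<bar> \<le> (\<Sum>i<m. B * \<bar>a i\<bar>)"
      using G_bound[OF F Fb] Fb
      by (auto intro!: integral_abs_bound mu \<nu> Cb_integrable G_Cb F)
    then have "J a \<ge> (\<Sum>i<m. \<kappa> / 2 * (a i)\<^sup>2 - 2 * (B * \<bar>a i\<bar>))"
      unfolding J_def sum_subtractf sum_distrib_left[symmetric] by linarith
    moreover have "(\<Sum>i<m. - (2 * B\<^sup>2 / \<kappa>)) \<le> (\<Sum>i<m. \<kappa> / 2 * (a i)\<^sup>2 - 2 * (B * \<bar>a i\<bar>))"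
    proof (rule sum_mono)
      fix i
      have "0 \<le> \<kappa> / 2 * (\<bar>a i\<bar> - 2 * B / \<kappa>)\<^sup>2" using \<kappa> by simp
      also have "\<dots> = \<kappa> / 2 * (a i)\<^sup>2 - 2 * (B * \<bar>a i\<bar>) + 2 * B\<^sup>2 / \<kappa>"
        using \<kappa> by (simp add: power2_diff power_divide power_mult_distrib field_simps power2_eq_square)
      finally show "- (2 * B\<^sup>2 / \<kappa>) \<le> \<kappa> / 2 * (a i)\<^sup>2 - 2 * (B * \<bar>a i\<bar>)" by simp
    qed
    ultimately show ?thesis by simp
  qed
  then have bdd: "bdd_below (range J)" by (intro bdd_belowI2)
  have "Inf (range J) < Inf (range J) + \<theta>" using \<theta> by simp
  then obtain a where a: "J a < Inf (range J) + \<theta>" using cInf_lessD[of "range J"] by blast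
  have min: "J a \<le> J b + \<theta>" for b using a cINF_lower[OF bdd, of b] by simp
  show ?thesis
  proof (rule that[of a], intro allI impI)
    fix i assume i: "i < m"
    define D where "D = \<kappa> * a i - ((\<integral>x. tilt k (F a) (fs i) x \<partial>\<mu>) - (\<integral>y. fs i y \<partial>\<nu>))"
    \<comment> \<open>\<open>D\<close> is the formal partial derivative of \<open>J\<close> at
      \<open>a\<close>; taking both signs of \<open>s\<close> bounds its absolute value.\<close>
    have key: "0 \<le> \<theta> + s * D + C * s\<^sup>2" if s: "\<bar>s\<bar> = s0" for s
    proof -
      define b where "b = a(i := a i + s)"
      have Fb: "F b = (\<lambda>y. F a y + s * fs i y)"
        using i by (auto simp: F_def b_def fun_upd_def sum.remove[of "{..<m}" i] algebra_simps)
      have sq: "(\<Sum>i<m. (b i)\<^sup>2) = (\<Sum>i<m. (a i)\<^sup>2) + 2 * s * a i + s\<^sup>2"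
        using i by (simp add: b_def sum.remove[of "{..<m}" i] power2_sum algebra_simps)
      have intG: "integrable \<mu> (G k (F a))" "integrable \<mu> (G k (F b))" "integrable \<mu> (tilt k (F a) (fs i))"
        by (intro Cb_integrable mu G_Cb tilt_Cb F fs i)+
      have "(\<integral>x. G k (F a) x + s * tilt k (F a) (fs i) x - 2 * real k * s\<^sup>2 * B\<^sup>2 \<partial>\<mu>) \<le> (\<integral>x. G k (F b) x \<partial>\<mu>)"
        using intG G_perturb_ge[OF F fs[OF i] B(2)[OF i] k, of s a] s s0 unfolding Fb[symmetric]
        by (intro integral_mono_bounded[OF mu]) auto
      also have "(\<integral>x. G k (F a) x + s * tilt k (F a) (fs i) x - 2 * real k * s\<^sup>2 * B\<^sup>2 \<partial>\<mu>)
        = (\<integral>x. G k (F a) x \<partial>\<mu>) + s * (\<integral>x. tilt k (F a) (fs i) x \<partial>\<mu>) - 2 * real k * s\<^sup>2 * B\<^sup>2"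
        using intG by (simp add: mu.prob_space)
      finally have 1: "(\<integral>x. G k (F a) x \<partial>\<mu>) + s * (\<integral>x. tilt k (F a) (fs i) x \<partial>\<mu>) - 2 * real k * s\<^sup>2 * B\<^sup>2
        \<le> (\<integral>x. G k (F b) x \<partial>\<mu>)" .
      have 2: "(\<integral>y. F b y \<partial>\<nu>) = (\<integral>y. F a y \<partial>\<nu>) + s * (\<integral>y. fs i y \<partial>\<nu>)"
        unfolding Fb using Cb_integrable[OF \<nu> F] Cb_integrable[OF \<nu> fs[OF i]] by simp
      have "J a \<le> J b + \<theta>" by (rule min)
      with 1 2 show ?thesis unfolding J_def sq D_def C_def by (simp add: algebra_simps)
    qed
    have "C * s0\<^sup>2 \<le> s0 * (\<eta> / 2)"
      using mult_left_mono[OF s0(3), of s0] s0(1) by (simp add: power2_eq_square algebra_simps)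
    then have "s0 * \<bar>D\<bar> \<le> \<theta> + s0 * (\<eta> / 2)"
      using key[of s0] key[of "- s0"] s0(1) by (cases "D \<ge> 0") auto
    then have "s0 * \<bar>D\<bar> \<le> s0 * \<eta>" using s0(1) \<eta> by (simp add: \<theta>_def)
    then show "\<bar>\<kappa> * a i - ((\<integral>x. tilt k (F a) (fs i) x \<partial>\<mu>) - (\<integral>y. fs i y \<partial>\<nu>))\<bar> \<le> \<eta>"
      using s0(1) by (simp add: D_def)
  qed
qed

text \<open>For one fixed function the bound is the convergence of the integrals of
  \<open>G k f\<close>. Uniformity over a box of coefficients comes from a finite grid and the
  \<open>k\<close>-free Lipschitz bound \<open>G_Lipschitz\<close>.\<close>

lemma dual_bound_uniform:
  fixes m :: nat
  assumes \<nu>: "\<nu> \<in> prob_measures" and fs: "\<And>i. i < m \<Longrightarrow> fs i \<in> Cb"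
    and B: "B > 0" "\<And>i y. i < m \<Longrightarrow> \<bar>fs i y\<bar> \<le> B"
    and dual: "\<And>f. f \<in> Cb \<Longrightarrow> dual \<nu> f \<le> t" and \<eta>: "\<eta> > 0"
  defines "F \<equiv> \<lambda>a y. \<Sum>i<m. a i * fs i y"
  shows "\<forall>\<^sub>F k in sequentially. \<forall>a. (\<forall>i<m. \<bar>a i\<bar> \<le> R) \<longrightarrow>
    (\<integral>x. G k (F a) x \<partial>\<mu>) - (\<integral>y. F a y \<partial>\<nu>) \<le> t + \<eta>"
proof -
  have F: "F a \<in> Cb" for a unfolding F_def by (intro Cb_sum Cb_cmult fs) simp
  \<comment> \<open>Mesh for which rounding changes the two integrals by at most
    \<open>\<eta> / 2\<close> in total; the added 1 covers \<open>m = 0\<close>.\<close>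
  define \<delta> where "\<delta> = \<eta> / (4 * (real m * B + 1))"
  have mB: "0 \<le> real m * B" using B by simp
  have \<delta>: "\<delta> > 0" "2 * (real m * B * \<delta>) \<le> \<eta> / 2"
  proof -
    show "\<delta> > 0" using \<eta> mB by (simp add: \<delta>_def)
    have "4 * ((real m * B + 1) * \<delta>) = \<eta>" using mB by (simp add: \<delta>_def field_simps)
    then have "4 * (real m * B * \<delta>) + 4 * \<delta> = \<eta>" by (simp add: algebra_simps)
    then show "2 * (real m * B * \<delta>) \<le> \<eta> / 2" using \<open>\<delta> > 0\<close> by linarith
  qed
  define N where "N = \<lceil>R / \<delta>\<rceil> + 1"
  define grid where "grid = (\<lambda>q i. \<delta> * of_int (q i :: int)) ` ({..<m} \<rightarrow>\<^sub>E {-N..N})"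
  have "finite grid" unfolding grid_def by (intro finite_imageI finite_PiE) auto
  moreover have "\<forall>\<^sub>F k in sequentially. (\<integral>x. G k (F a) x \<partial>\<mu>) < t + (\<integral>y. F a y \<partial>\<nu>) + \<eta> / 2" for a
    using dual[OF F, of a] \<eta> by (intro order_tendstoD(2)[OF integral_G_tendsto[OF F]]) linarith
  ultimately have "\<forall>\<^sub>F k in sequentially. \<forall>a\<in>grid. (\<integral>x. G k (F a) x \<partial>\<mu>) < t + (\<integral>y. F a y \<partial>\<nu>) + \<eta> / 2"
    by (intro eventually_ball_finite) auto
  then show ?thesis
  proof eventually_elim
    case (elim k)
    show ?case
    proof (intro allI impI)
      fix a assume a: "\<forall>i<m. \<bar>a i\<bar> \<le> R"
      define b where "b = (\<lambda>i. \<delta> * of_int (restrict (\<lambda>i. \<lfloor>a i / \<delta>\<rfloor>) {..<m} i))"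
      have "restrict (\<lambda>i. \<lfloor>a i / \<delta>\<rfloor>) {..<m} \<in> {..<m} \<rightarrow>\<^sub>E {-N..N}"
      proof (rule restrict_PiE_iff[THEN iffD2], intro ballI)
        fix i assume "i \<in> {..<m}"
        then have "\<bar>a i\<bar> \<le> R" using a by simp
        then have "- (R / \<delta>) \<le> a i / \<delta>" "a i / \<delta> \<le> R / \<delta>"
          using \<delta>(1) by (simp_all add: field_simps abs_le_iff)
        then show "\<lfloor>a i / \<delta>\<rfloor> \<in> {-N..N}" unfolding N_def atLeastAtMost_iff by linarith
      qed
      then have "b \<in> grid" unfolding grid_def b_def by (rule imageI)
      have ab: "\<bar>a i - b i\<bar> \<le> \<delta>" if "i < m" for i
      proof -
        have "a i / \<delta> - 1 \<le> of_int \<lfloor>a i / \<delta>\<rfloor>" "of_int \<lfloor>a i / \<delta>\<rfloor> \<le> a i / \<delta>" by linarith+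
        then have "\<delta> * (a i / \<delta> - 1) \<le> \<delta> * of_int \<lfloor>a i / \<delta>\<rfloor>" "\<delta> * of_int \<lfloor>a i / \<delta>\<rfloor> \<le> \<delta> * (a i / \<delta>)"
          using \<delta>(1) by (simp_all only: mult_left_mono less_imp_le)
        moreover have "\<delta> * (a i / \<delta> - 1) = a i - \<delta>" "\<delta> * (a i / \<delta>) = a i" using \<delta>(1) by (simp_all add: algebra_simps)
        ultimately have "a i - \<delta> \<le> \<delta> * of_int \<lfloor>a i / \<delta>\<rfloor>" "\<delta> * of_int \<lfloor>a i / \<delta>\<rfloor> \<le> a i" by simp_all
        then show ?thesis using that \<delta>(1) by (simp add: b_def abs_le_iff)
      qed
      have le: "\<bar>F a y - F b y\<bar> \<le> real m * B * \<delta>" for y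
      proof -
        have "\<bar>F a y - F b y\<bar> = \<bar>\<Sum>i<m. (a i - b i) * fs i y\<bar>"
          by (simp add: F_def sum_subtractf[symmetric] left_diff_distrib)
        also have "\<dots> \<le> (\<Sum>i<m. \<bar>(a i - b i) * fs i y\<bar>)" by (rule sum_abs)
        also have "\<dots> \<le> (\<Sum>i<m. \<delta> * B)"
          using ab B \<delta> by (intro sum_mono) (auto simp: abs_mult intro!: mult_mono)
        finally show ?thesis by (simp add: algebra_simps)
      qed
      have "(\<integral>x. G k (F a) x \<partial>\<mu>) \<le> (\<integral>x. G k (F b) x + real m * B * \<delta> \<partial>\<mu>)"
      proof (rule integral_mono_bounded[OF mu])
        show "integrable \<mu> (G k (F a))" "integrable \<mu> (\<lambda>x. G k (F b) x + real m * B * \<delta>)"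
          by (intro Cb_integrable mu G_Cb F Cb_add Cb_const)+
        show "G k (F a) x \<le> G k (F b) x + real m * B * \<delta>" for x
          using G_Lipschitz[OF F F le, of k x] by (simp add: abs_le_iff)
      qed
      also have "\<dots> = (\<integral>x. G k (F b) x \<partial>\<mu>) + real m * B * \<delta>"
        using Cb_integrable[OF mu G_Cb[OF F]] by (simp add: mu.prob_space)
      finally have 1: "(\<integral>x. G k (F a) x \<partial>\<mu>) \<le> (\<integral>x. G k (F b) x \<partial>\<mu>) + real m * B * \<delta>" .
      interpret nu: prob_space \<nu> using \<nu> by (rule prob_measuresD)
      have "(\<integral>y. F b y \<partial>\<nu>) \<le> (\<integral>y. F a y + real m * B * \<delta> \<partial>\<nu>)"
      proof (rule integral_mono_bounded[OF \<nu>])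
        show "integrable \<nu> (F b)" "integrable \<nu> (\<lambda>y. F a y + real m * B * \<delta>)"
          by (intro Cb_integrable \<nu> F Cb_add Cb_const)+
        show "F b y \<le> F a y + real m * B * \<delta>" for y using le[of y] by (simp add: abs_le_iff)
      qed
      also have "\<dots> = (\<integral>y. F a y \<partial>\<nu>) + real m * B * \<delta>"
        using Cb_integrable[OF \<nu> F] by (simp add: nu.prob_space)
      finally have "(\<integral>y. F b y \<partial>\<nu>) \<le> (\<integral>y. F a y \<partial>\<nu>) + real m * B * \<delta>" .
      with 1 bspec[OF elim \<open>b \<in> grid\<close>] \<delta>(2)
      show "(\<integral>x. G k (F a) x \<partial>\<mu>) - (\<integral>y. F a y \<partial>\<nu>) \<le> t + \<eta>" by linarith
    qed
  qed
qed

text \<open>The tilt is a near minimiser of the quadratically penalised dual problem: its near stationarity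
  says that the tilted law differs from \<open>\<nu>\<close>, on the test functions, by the small penalty term.\<close>

lemma tilt_recovery:
  fixes m :: nat
  assumes \<nu>: "\<nu> \<in> prob_measures" and fs: "\<And>i. i < m \<Longrightarrow> fs i \<in> Cb"
    and dual: "\<And>f. f \<in> Cb \<Longrightarrow> dual \<nu> f \<le> t" and \<epsilon>: "\<epsilon> > 0"
  shows "\<forall>\<^sub>F k in sequentially. \<exists>f\<in>Cb. (\<forall>i<m. \<bar>(\<integral>x. tilt k f (fs i) x \<partial>\<mu>) - (\<integral>y. fs i y \<partial>\<nu>)\<bar> \<le> \<epsilon>) \<and>
    (\<integral>x. G k f x \<partial>\<mu>) - (\<integral>x. tilt k f f x \<partial>\<mu>) \<le> t + \<epsilon>"
proof -
  have "\<exists>B. \<forall>y. \<bar>fs i y\<bar> \<le> B" if "i < m" for i using Cb_D(2)[OF fs[OF that]] by blast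
  then obtain b where b: "\<And>i y. i < m \<Longrightarrow> \<bar>fs i y\<bar> \<le> b i" by metis
  \<comment> \<open>The inserted 1 keeps the common bound positive, also when there are no test
    functions.\<close>
  define B where "B = Max (insert 1 (b ` {..<m}))"
  have "1 \<le> B" unfolding B_def by (rule Max_ge) auto
  then have B: "B > 0" by simp
  have fB: "\<bar>fs i y\<bar> \<le> B" if "i < m" for i y
  proof -
    have "b i \<le> B" unfolding B_def using that by (intro Max_ge) auto
    then show ?thesis using b[OF that, of y] by simp
  qed
  have t: "0 \<le> t" using dual[OF Cb_const, of 0] by (simp add: S_zero)
  \<comment> \<open>Solved from the last estimate: a penalty sum of at most \<open>t + 1\<close>
    then gives \<open>\<bar>\<kappa> * a i\<bar> \<le> \<epsilon> / 2\<close>.\<close>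
  define \<kappa> where "\<kappa> = \<epsilon>\<^sup>2 / (4 * (t + 1))"
  have \<kappa>: "\<kappa> > 0" "\<kappa> * (t + 1) = (\<epsilon> / 2)\<^sup>2" using \<epsilon> t by (simp_all add: \<kappa>_def field_simps power2_eq_square)
  \<comment> \<open>Stationarity within 1 gives
    \<open>\<bar>\<kappa> * a i\<bar> \<le> 2 * B + 1\<close>, since the two means differ by at most
    \<open>2 * B\<close>. This box does not depend on \<open>k\<close>, as the uniform dual bound
    demands.\<close>
  define R where "R = (2 * B + 1) / \<kappa>"
  have R: "R > 0" "\<kappa> * R = 2 * B + 1" using B \<kappa> by (simp_all add: R_def)
  \<comment> \<open>At most 1 for the box, at most \<open>\<epsilon> / 2\<close> for the final
    deviation; the quotient keeps the accumulated error \<open>\<eta> + m * \<eta> * R\<close> below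
    both \<epsilon> and 1.\<close>
  define \<eta> where "\<eta> = min (min 1 (\<epsilon> / 2)) (min \<epsilon> 1 / (1 + real m * R))"
  have mR: "0 \<le> real m * R" using R by simp
  have \<eta>: "\<eta> > 0" "\<eta> \<le> 1" "\<eta> \<le> \<epsilon> / 2" "\<eta> + real m * (\<eta> * R) \<le> \<epsilon>" "\<eta> + real m * (\<eta> * R) \<le> 1"
  proof -
    have 1: "0 < 1 + real m * R" using mR by linarith
    show "\<eta> > 0" using \<epsilon> 1 by (auto simp: \<eta>_def)
    have "\<eta> \<le> min 1 (\<epsilon> / 2)" unfolding \<eta>_def by (rule min.cobounded1)
    then show "\<eta> \<le> 1" "\<eta> \<le> \<epsilon> / 2" by simp_all
    have "\<eta> \<le> min \<epsilon> 1 / (1 + real m * R)" by (simp add: \<eta>_def)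
    then have "\<eta> * (1 + real m * R) \<le> min \<epsilon> 1" using 1 by (simp add: pos_le_divide_eq)
    then show "\<eta> + real m * (\<eta> * R) \<le> \<epsilon>" "\<eta> + real m * (\<eta> * R) \<le> 1" by (simp_all add: algebra_simps)
  qed
  define F where "F = (\<lambda>(a :: nat \<Rightarrow> real) y. \<Sum>i<m. a i * fs i y)"
  have F: "F a \<in> Cb" for a unfolding F_def by (intro Cb_sum Cb_cmult fs) simp
  have "\<forall>\<^sub>F k in sequentially. \<forall>a. (\<forall>i<m. \<bar>a i\<bar> \<le> R) \<longrightarrow>
    (\<integral>x. G k (F a) x \<partial>\<mu>) - (\<integral>y. F a y \<partial>\<nu>) \<le> t + \<eta>"
    unfolding F_def by (rule dual_bound_uniform[OF \<nu> fs B fB dual \<eta>(1)])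
  then show ?thesis using eventually_gt_at_top[of 0]
  proof eventually_elim
    case (elim k)
    from near_stationary[OF \<nu> fs B fB \<kappa>(1) \<eta>(1) elim(2)]
    obtain a where "\<forall>i<m. \<bar>\<kappa> * a i - ((\<integral>x. tilt k (F a) (fs i) x \<partial>\<mu>) - (\<integral>y. fs i y \<partial>\<nu>))\<bar> \<le> \<eta>"
      unfolding F_def .
    note a = this[rule_format]
    define \<phi> where "\<phi> i = (\<integral>x. tilt k (F a) (fs i) x \<partial>\<mu>) - (\<integral>y. fs i y \<partial>\<nu>)" for i
    have ti: "integrable \<mu> (tilt k (F a) (fs i))" if "i < m" for i
      by (intro Cb_integrable mu tilt_Cb F fs that)
    have aR: "\<bar>a i\<bar> \<le> R" if i: "i < m" for i
    proof -
      have "\<bar>\<integral>x. tilt k (F a) (fs i) x \<partial>\<mu>\<bar> \<le> B" "\<bar>\<integral>y. fs i y \<partial>\<nu>\<bar> \<le> B"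
        using tilt_bound[OF F fs[OF i] fB[OF i]] fB[OF i] Cb_integrable[OF \<nu> fs[OF i]] ti[OF i]
        by (auto intro!: integral_abs_bound mu \<nu>)
      then have "\<bar>\<kappa> * a i\<bar> \<le> \<kappa> * R" using a[OF i] \<eta>(2) unfolding R(2) by linarith
      then show ?thesis using \<kappa> by (simp add: abs_mult)
    qed
    have "(\<integral>x. tilt k (F a) (F a) x \<partial>\<mu>) = (\<integral>x. (\<Sum>i<m. a i * tilt k (F a) (fs i) x) \<partial>\<mu>)"
    proof (rule Bochner_Integration.integral_cong[OF refl])
      fix x
      have "tilt k (F a) (F a) x = tilt k (F a) (\<lambda>y. \<Sum>i<m. a i * fs i y) x" by (simp add: F_def)
      also have "\<dots> = (\<Sum>i<m. tilt k (F a) (\<lambda>y. a i * fs i y) x)"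
        by (intro tilt_sum F Cb_cmult fs) simp
      finally show "tilt k (F a) (F a) x = (\<Sum>i<m. a i * tilt k (F a) (fs i) x)" by (simp add: tilt_cmult)
    qed
    also have "\<dots> = (\<Sum>i<m. a i * (\<integral>x. tilt k (F a) (fs i) x \<partial>\<mu>))"
      using ti by (subst Bochner_Integration.integral_sum) auto
    also have "\<dots> = (\<Sum>i<m. a i * (\<integral>y. fs i y \<partial>\<nu>)) + (\<Sum>i<m. a i * \<phi> i)"
      by (simp add: \<phi>_def sum.distrib[symmetric] algebra_simps)
    also have "(\<Sum>i<m. a i * (\<integral>y. fs i y \<partial>\<nu>)) = (\<integral>y. F a y \<partial>\<nu>)"
      unfolding F_def using Cb_integrable[OF \<nu> fs] by (subst Bochner_Integration.integral_sum) auto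
    finally have tF: "(\<integral>x. tilt k (F a) (F a) x \<partial>\<mu>) = (\<integral>y. F a y \<partial>\<nu>) + (\<Sum>i<m. a i * \<phi> i)" .
    \<comment> \<open>By near stationarity \<open>\<phi> i\<close> is close to
      \<open>\<kappa> * a i\<close>, so the defect of the tilted means pays for the penalty; the
      dual bound then controls entropic cost and penalty together.\<close>
    have "(\<Sum>i<m. \<kappa> * (a i)\<^sup>2 - \<eta> * R) \<le> (\<Sum>i<m. a i * \<phi> i)"
    proof (rule sum_mono)
      fix i assume "i \<in> {..<m}"
      then have i: "i < m" by simp
      have "a i * (\<kappa> * a i - \<phi> i) \<le> \<bar>a i\<bar> * \<bar>\<kappa> * a i - \<phi> i\<bar>" by (metis abs_ge_self abs_mult)
      also have "\<dots> \<le> R * \<eta>" using a[OF i] aR[OF i] R by (intro mult_mono) (auto simp: \<phi>_def)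
      finally show "\<kappa> * (a i)\<^sup>2 - \<eta> * R \<le> a i * \<phi> i" by (simp add: algebra_simps power2_eq_square)
    qed
    then have "(\<Sum>i<m. \<kappa> * (a i)\<^sup>2) - real m * (\<eta> * R) \<le> (\<Sum>i<m. a i * \<phi> i)" by (simp add: sum_subtractf)
    moreover have "(\<integral>x. G k (F a) x \<partial>\<mu>) - (\<integral>y. F a y \<partial>\<nu>) \<le> t + \<eta>" using elim(1) aR by blast
    ultimately have T: "(\<integral>x. G k (F a) x \<partial>\<mu>) - (\<integral>x. tilt k (F a) (F a) x \<partial>\<mu>) + (\<Sum>i<m. \<kappa> * (a i)\<^sup>2)
      \<le> t + (\<eta> + real m * (\<eta> * R))"
      unfolding tF by linarith
    have "(\<integral>x. tilt k (F a) (F a) x \<partial>\<mu>) \<le> (\<integral>x. G k (F a) x \<partial>\<mu>)"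
      by (intro integral_mono_bounded[OF mu] Cb_integrable mu tilt_Cb G_Cb F entropy_nonneg elim)
    with T \<eta>(5) have sq: "(\<Sum>i<m. \<kappa> * (a i)\<^sup>2) \<le> t + 1" by linarith
    have "\<bar>\<phi> i\<bar> \<le> \<epsilon>" if i: "i < m" for i
    proof -
      have "\<kappa> * (a i)\<^sup>2 \<le> (\<Sum>i<m. \<kappa> * (a i)\<^sup>2)"
        using \<kappa> i by (intro member_le_sum) auto
      then have "\<kappa> * (\<kappa> * (a i)\<^sup>2) \<le> \<kappa> * (t + 1)" using sq \<kappa>(1) by (intro mult_left_mono) auto
      then have "(\<kappa> * a i)\<^sup>2 \<le> (\<epsilon> / 2)\<^sup>2" unfolding \<kappa>(2) by (simp add: power2_eq_square algebra_simps)
      then have "\<bar>\<kappa> * a i\<bar> \<le> \<epsilon> / 2" using \<epsilon> by (simp add: abs_le_square_iff[symmetric])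
      with a[OF i] \<eta>(3) show ?thesis unfolding \<phi>_def by linarith
    qed
    moreover have "0 \<le> (\<Sum>i<m. \<kappa> * (a i)\<^sup>2)" using \<kappa> by (intro sum_nonneg) auto
    with T \<eta>(4) have "(\<integral>x. G k (F a) x \<partial>\<mu>) - (\<integral>x. tilt k (F a) (F a) x \<partial>\<mu>) \<le> t + \<epsilon>" by linarith
    ultimately show ?case using F by (auto simp: \<phi>_def)
  qed
qed

end

section \<open>Exponential tightness and finite covers\<close>

definition cutoff :: "real \<Rightarrow> 'a::real_normed_vector \<Rightarrow> real" where
  "cutoff R x = min 1 (max 0 (norm x - R))"

lemma cutoff_Cb: "cutoff R \<in> Cb"
  unfolding cutoff_def[abs_def] by (rule Cb_I[where B=1]) (auto intro!: continuous_intros)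

lemma cutoff_bounds: "0 \<le> cutoff R x" "cutoff R x \<le> 1"
  by (auto simp: cutoff_def)

lemma measure_cball_ge_cutoff:
  assumes "M \<in> prob_measures"
  shows "1 - (\<integral>x. cutoff R x \<partial>M) \<le> measure M (cball 0 (R + 1))"
proof -
  interpret prob_space M using assms by (rule prob_measuresD)
  have "(\<integral>x. 1 - cutoff R x \<partial>M) \<le> (\<integral>x. indicator (cball 0 (R + 1)) x \<partial>M)"
  proof (rule integral_mono_bounded[OF assms])
    show "integrable M (\<lambda>x. 1 - cutoff R x)" by (intro Cb_integrable[OF assms] Cb_diff Cb_const cutoff_Cb)
    show "integrable M (\<lambda>x. indicator (cball 0 (R + 1)) x :: real)"
      by (rule integrable_bounded[OF assms borel_measurable_indicator[OF borel_closed[OF closed_cball]], where B=1]) simp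
    show "1 - cutoff R x \<le> indicator (cball 0 (R + 1)) x" for x
      by (auto simp: cutoff_def indicator_def)
  qed
  moreover have "measure M UNIV = 1" using prob_space unfolding prob_measuresD(3)[OF assms] .
  ultimately show ?thesis
    using Cb_integrable[OF assms cutoff_Cb, of R] by (simp add: prob_measuresD[OF assms])
qed

context feller_LDP
begin

text \<open>Once the ball of radius \<open>R\<close> contains the compact set where
  \<open>c x\<close> is at most \<open>M\<close>, reaching the cutoff costs more than it gains and
  \<open>S\<close> vanishes at \<open>x\<close>. That radius depends on \<open>x\<close>, so
  dominated convergence finishes.\<close>

lemma integral_S_cutoff_tendsto:
  "(\<lambda>R :: nat. \<integral>x. S (\<lambda>y. - real M * cutoff (real R) y) x \<partial>\<mu>) \<longlonglongrightarrow> 0"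
proof -
  let ?f = "\<lambda>R y. - real M * cutoff (real R) y"
  have f: "?f R \<in> Cb" for R by (intro Cb_cmult cutoff_Cb)
  have fb: "\<bar>?f R y\<bar> \<le> real M" for R y
    using cutoff_bounds[of "real R" y] mult_left_mono[of "cutoff (real R) y" 1 "real M"] by (simp add: abs_mult)
  have lim: "(\<lambda>R. S (?f R) x) \<longlonglongrightarrow> 0" for x
  proof -
    have "compact {y. c x y \<le> ennreal (real M)}" using c_good[of x] by (simp add: good_rate_function_def)
    then have "bounded {y. c x y \<le> ennreal (real M)}" by (rule compact_imp_bounded)
    then obtain b where b: "\<And>y. c x y \<le> ennreal (real M) \<Longrightarrow> norm y \<le> b"
      unfolding bounded_iff by blast
    obtain R0 :: nat where R0: "b \<le> real R0" using real_arch_simple by blast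
    have "S (?f R) x = 0" if R: "R \<ge> R0" for R
    proof (rule antisym)
      have "?f R y \<le> 0" for y by (simp add: cutoff_bounds mult_nonneg_nonneg)
      from S_mono[OF f Cb_const this, of x] show "S (?f R) x \<le> 0" unfolding S_zero .
      show "0 \<le> S (?f R) x"
      proof (rule S_ge[OF f])
        fix y r assume r: "0 \<le> r" "c x y = ennreal r"
        show "0 \<le> r + ?f R y"
        proof (cases "r \<le> real M")
          case True
          then have "norm y \<le> b" using b[of y] r by (simp add: ennreal_leI)
          then have "cutoff (real R) y = 0" using R0 R by (simp add: cutoff_def)
          then show ?thesis using r by simp
        next
          case False
          then show ?thesis using fb[of R y] by linarith
        qed
      qed
    qed
    then show ?thesis by (intro tendsto_eventually eventually_sequentiallyI[of R0])
  qed
  have "(\<lambda>R. \<integral>x. S (?f R) x \<partial>\<mu>) \<longlonglongrightarrow> (\<integral>x. 0 \<partial>\<mu>)"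
    using lim S_bound[OF f fb] S_borel[OF f]
    by (intro integral_dominated_convergence[where w="\<lambda>_. real M"]) (auto simp: prob_measuresD[OF mu])
  then show ?thesis by simp
qed

lemma dual_le_of_dense:
  assumes \<nu>: "\<nu> \<in> prob_measures" and D: "D \<subseteq> Cb"
    and dense: "bounded_increasing_limit D f"
    and f: "f \<in> Cb" and le: "\<And>g. g \<in> D \<Longrightarrow> dual \<nu> g \<le> t"
  shows "dual \<nu> f \<le> t"
proof -
  from dense obtain g B where g: "range g \<subseteq> D" and B: "\<And>j x. \<bar>g j x\<bar> \<le> B"
    and inc: "\<And>x. incseq (\<lambda>j. g j x)" and lim: "\<And>x. (\<lambda>j::nat. g j x) \<longlonglongrightarrow> f x" by blast
  have gD: "g j \<in> D" for j using g by blast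
  then have gC: "g j \<in> Cb" for j using D by blast
  have "(\<lambda>j. \<integral>x. S (g j) x \<partial>\<mu>) \<longlonglongrightarrow> (\<integral>x. S f x \<partial>\<mu>)"
    using S_tendsto_increasing[OF gC f B inc lim] S_bound[OF gC B] S_borel[OF gC] S_borel[OF f]
    by (intro integral_dominated_convergence[where w="\<lambda>_. B"]) (auto simp: prob_measuresD[OF mu])
  moreover interpret nu: prob_space \<nu> using \<nu> by (rule prob_measuresD)
  have "(\<lambda>j. \<integral>y. g j y \<partial>\<nu>) \<longlonglongrightarrow> (\<integral>y. f y \<partial>\<nu>)"
    using lim B Cb_borel[OF gC] Cb_borel[OF f]
    by (intro integral_dominated_convergence[where w="\<lambda>_. B"]) (auto simp: prob_measuresD[OF \<nu>])
  ultimately have "(\<lambda>j. dual \<nu> (g j)) \<longlonglongrightarrow> dual \<nu> f"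
    by (rule tendsto_diff)
  then show ?thesis by (rule LIMSEQ_le_const2) (use le[OF gD] in blast)
qed

text \<open>The test functions \<open>- M * cutoff R\<close> turn a bound on the dual functional into tightness, so a
  sequence that violates every finite subcover has a narrow limit point violating the cover.\<close>

lemma finite_subcover:
  assumes C: "closedin narrow_topology C"
    and cover: "\<And>\<nu>. \<nu> \<in> C \<Longrightarrow> \<exists>f\<in>Cb. t < dual \<nu> f"
  obtains F where "finite F" "F \<subseteq> Cb" "\<forall>\<nu>\<in>C. \<exists>f\<in>F. t < dual \<nu> f"
proof (rule ccontr)
  assume neg: "\<not> thesis"
  obtain D0 :: "('a \<Rightarrow> real) set" where D0: "countable D0" "D0 \<subseteq> Cb"
    and dense: "\<forall>f\<in>Cb. bounded_increasing_limit D0 f"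
    by (rule Cb_countable_monotone_dense)
  let ?h = "\<lambda>(M :: nat, R :: nat) (y :: 'a). - real M * cutoff (real R) y"
  define D where "D = D0 \<union> range ?h"
  have "?h p \<in> Cb" for p by (cases p) (simp only: case_prod_conv Cb_cmult cutoff_Cb)
  then have D: "countable D" "D \<subseteq> Cb" "D \<noteq> {}"
    using D0 unfolding D_def by (simp, blast, blast)
  define d where "d = from_nat_into D"
  have rd: "range d = D" unfolding d_def by (rule range_from_nat_into[OF D(3,1)])
  then have dC: "d i \<in> Cb" for i using D by blast
  \<comment> \<open>Otherwise the first \<open>m + 1\<close> members of the enumeration would
    already form a finite subcover.\<close>
  have "\<exists>\<nu>\<in>C. \<forall>i\<le>m. dual \<nu> (d i) \<le> t" for m
  proof (rule ccontr)
    assume *: "\<not> (\<exists>\<nu>\<in>C. \<forall>i\<le>m. dual \<nu> (d i) \<le> t)"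
    have "\<exists>f\<in>d ` {..m}. t < dual \<nu> f" if "\<nu> \<in> C" for \<nu>
    proof -
      from * that obtain i where "i \<le> m" "\<not> dual \<nu> (d i) \<le> t" by blast
      then show ?thesis by (intro bexI[of _ "d i"]) auto
    qed
    moreover have "finite (d ` {..m})" "d ` {..m} \<subseteq> Cb" using dC by auto
    ultimately show False using neg that[of "d ` {..m}"] by blast
  qed
  then obtain \<nu> where \<nu>C: "\<And>m. \<nu> m \<in> C"
    and \<nu>t: "\<And>m i. i \<le> m \<Longrightarrow> dual (\<nu> m) (d i) \<le> t" by metis
  have \<nu>: "\<nu> m \<in> prob_measures" for m using \<nu>C C by (auto simp: closedin_def topspace_narrow)
  \<comment> \<open>The choice \<open>M = 0\<close>, \<open>R = 0\<close> puts the zero function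
    into the family, and its dual value is 0.\<close>
  have t: "0 \<le> t + 1"
  proof -
    have "?h (0, 0) \<in> range d" unfolding rd D_def by (intro UnI2 rangeI)
    then obtain i where "d i = (\<lambda>_. 0)" by auto
    then show ?thesis using \<nu>t[of i i] by (simp add: S_zero)
  qed
  have "\<exists>R. \<forall>\<^sub>F m in sequentially. 1 - \<epsilon> \<le> measure (\<nu> m) (cball 0 R)" if \<epsilon>: "\<epsilon> > 0" for \<epsilon>
  proof -
    \<comment> \<open>The dual bound together with an integral of \<open>S\<close> above -1 gives
      \<open>M\<close> times the cutoff mass at most \<open>t + 1\<close>, so a large
      \<open>M\<close> makes that mass smaller than \<epsilon>.\<close>
    obtain M :: nat where M: "t + 1 < real M * \<epsilon>" using ex_less_of_nat_mult[OF \<epsilon>] by blast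
    then have "M > 0" using t by (cases M) auto
    have "\<forall>\<^sub>F R :: nat in sequentially. -1 < (\<integral>x. S (\<lambda>y. - real M * cutoff (real R) y) x \<partial>\<mu>)"
      by (rule order_tendstoD(1)[OF integral_S_cutoff_tendsto]) simp
    then obtain R :: nat where R: "-1 < (\<integral>x. S (\<lambda>y. - real M * cutoff (real R) y) x \<partial>\<mu>)"
      by (auto dest: eventually_happens)
    have "?h (M, R) \<in> range d" unfolding rd D_def by (intro UnI2 rangeI)
    then obtain i where i: "d i = (\<lambda>y. - real M * cutoff (real R) y)" by auto
    have "1 - \<epsilon> \<le> measure (\<nu> m) (cball 0 (real R + 1))" if "m \<ge> i" for m
    proof -
      have "real M * (\<integral>y. cutoff (real R) y \<partial>\<nu> m) \<le> t + 1"
        using \<nu>t[OF that] R unfolding i by simp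
      then have "real M * (\<integral>y. cutoff (real R) y \<partial>\<nu> m) \<le> real M * \<epsilon>" using M by linarith
      then have "(\<integral>y. cutoff (real R) y \<partial>\<nu> m) \<le> \<epsilon>" using \<open>M > 0\<close> by simp
      then show ?thesis using measure_cball_ge_cutoff[OF \<nu>[of m], of "real R"] by linarith
    qed
    then show ?thesis by (intro exI[of _ "real R + 1"] eventually_sequentiallyI[of i])
  qed
  from prokhorov[OF \<nu> this] obtain r M where r: "strict_mono r" and M: "M \<in> prob_measures"
    and conv: "narrow_conv (\<lambda>j. \<nu> (r j)) M" .
  have "M \<in> C" by (rule narrow_closed_sequentially[OF C conv \<nu>C M])
  have Mt: "dual M g \<le> t" if g: "g \<in> D" for g
  proof -
    have "g \<in> range d" using g unfolding rd .
    then obtain i where i: "g = d i" by blast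
    have "(\<lambda>j. (\<integral>x. S g x \<partial>\<mu>) - (\<integral>y. g y \<partial>\<nu> (r j))) \<longlonglongrightarrow> dual M g"
      using conv dC[of i] by (intro tendsto_diff tendsto_const) (simp add: narrow_conv_def i)
    then show ?thesis
    proof (rule tendsto_upperbound)
      show "\<forall>\<^sub>F j in sequentially. (\<integral>x. S g x \<partial>\<mu>) - (\<integral>y. g y \<partial>\<nu> (r j)) \<le> t"
        using \<nu>t seq_suble[OF r] unfolding i by (intro eventually_sequentiallyI[of i]) (meson order_trans)
    qed simp
  qed
  obtain f where f: "f \<in> Cb" "t < dual M f" using cover[OF \<open>M \<in> C\<close>] by blast
  have "dual M f \<le> t"
    using Mt by (intro dual_le_of_dense[OF M D0(2) bspec[OF dense f(1)] f(1)]) (simp add: D_def)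
  with f(2) show False by simp
qed

end

section \<open>Large deviation bounds for the empirical measures\<close>

locale particle_LDP = feller_LDP \<mu> P c + Om: prob_space \<Omega>
  for \<mu> :: "'a::euclidean_space measure" and P :: "nat \<Rightarrow> 'a \<Rightarrow> 'a measure" and c :: "'a \<Rightarrow> 'a \<Rightarrow> ennreal"
    and \<Omega> :: "'w measure" +
  fixes z :: "nat \<Rightarrow> nat \<Rightarrow> 'a" and X :: "nat \<Rightarrow> nat \<Rightarrow> nat \<Rightarrow> 'w \<Rightarrow> 'a"
  assumes z_conv: "narrow_conv (\<lambda>n. empirical n (z n)) \<mu>"
    and X_indep: "\<And>k n. Om.indep_vars (\<lambda>_. borel) (X k n) {1..n}"
    and X_law: "\<And>k n i. i \<in> {1..n} \<Longrightarrow> distr \<Omega> borel (X k n i) = P k (z n i)"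
begin

abbreviation event :: "nat \<Rightarrow> nat \<Rightarrow> 'a measure set \<Rightarrow> 'w set" where
  "event k n B \<equiv> {\<omega> \<in> space \<Omega>. empirical n (\<lambda>i. X k n i \<omega>) \<in> B}"

lemma X_measurable: "i \<in> {1..n} \<Longrightarrow> X k n i \<in> borel_measurable \<Omega>"
  using X_indep[of k n] by (auto simp: Om.indep_vars_def)

lemma average_tendsto:
  assumes "h \<in> Cb" shows "(\<lambda>n. (\<Sum>i=1..n. h (z n i)) / real n) \<longlonglongrightarrow> (\<integral>x. h x \<partial>\<mu>)"
proof (rule Lim_transform_eventually)
  show "(\<lambda>n. \<integral>x. h x \<partial>empirical n (z n)) \<longlonglongrightarrow> (\<integral>x. h x \<partial>\<mu>)"
    using z_conv assms by (simp add: narrow_conv_def)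
  show "\<forall>\<^sub>F n in sequentially. (\<integral>x. h x \<partial>empirical n (z n)) = (\<Sum>i=1..n. h (z n i)) / real n"
    using integral_empirical[OF Cb_borel[OF assms]] by (intro eventually_sequentiallyI[of 1]) simp
qed

lemma expectation_prod:
  assumes \<phi>: "\<And>i. i \<in> {1..n} \<Longrightarrow> \<phi> i \<in> Cb"
  shows "integrable \<Omega> (\<lambda>\<omega>. \<Prod>i=1..n. \<phi> i (X k n i \<omega>) :: real)"
    "(\<integral>\<omega>. (\<Prod>i=1..n. \<phi> i (X k n i \<omega>)) \<partial>\<Omega>) = (\<Prod>i=1..n. \<integral>y. \<phi> i y \<partial>P k (z n i))"
proof -
  have ind: "Om.indep_vars (\<lambda>_. borel) (\<lambda>i \<omega>. \<phi> i (X k n i \<omega>)) {1..n}"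
    by (rule Om.indep_vars_compose2[OF X_indep]) (rule Cb_borel[OF \<phi>])
  have int: "integrable \<Omega> (\<lambda>\<omega>. \<phi> i (X k n i \<omega>))" "(\<integral>\<omega>. \<phi> i (X k n i \<omega>) \<partial>\<Omega>) = (\<integral>y. \<phi> i y \<partial>P k (z n i))"
    if i: "i \<in> {1..n}" for i
    using X_law[OF i, of k] X_measurable[OF i, of k] Cb_borel[OF \<phi>[OF i]] Cb_integrable[OF P_prob \<phi>[OF i], of k "z n i"]
    by (metis integrable_distr_eq, metis integral_distr)
  show "integrable \<Omega> (\<lambda>\<omega>. \<Prod>i=1..n. \<phi> i (X k n i \<omega>) :: real)"
    using int by (intro Om.indep_vars_integrable[OF _ ind]) auto
  show "(\<integral>\<omega>. (\<Prod>i=1..n. \<phi> i (X k n i \<omega>)) \<partial>\<Omega>) = (\<Prod>i=1..n. \<integral>y. \<phi> i y \<partial>P k (z n i))"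
    using int by (subst Om.indep_vars_lebesgue_integral[OF _ ind]) auto
qed

definition avg :: "nat \<Rightarrow> nat \<Rightarrow> ('a \<Rightarrow> real) \<Rightarrow> 'w \<Rightarrow> real" where
  "avg k n g \<omega> = (\<Sum>i=1..n. g (X k n i \<omega>)) / real n"

lemma avg_measurable: "g \<in> Cb \<Longrightarrow> avg k n g \<in> borel_measurable \<Omega>"
  unfolding avg_def[abs_def]
  by (intro borel_measurable_divide borel_measurable_sum borel_measurable_const
      measurable_compose[OF X_measurable Cb_borel])

lemma integral_empirical_X: "g \<in> Cb \<Longrightarrow> n \<ge> 1 \<Longrightarrow> (\<integral>x. g x \<partial>empirical n (\<lambda>i. X k n i \<omega>)) = avg k n g \<omega>"
  by (simp add: avg_def integral_empirical Cb_borel)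

lemma chernoff:
  assumes f: "f \<in> Cb" and k: "k > 0" and n: "n > 0"
  shows "measure \<Omega> {\<omega>\<in>space \<Omega>. avg k n f \<omega> < b} \<le> exp (real k * real n * (b - (\<Sum>i=1..n. G k f (z n i)) / real n))"
proof -
  let ?A = "{\<omega>\<in>space \<Omega>. avg k n f \<omega> < b}" and ?W = "\<lambda>\<omega>. \<Prod>i=1..n. exp (- (real k * f (X k n i \<omega>)))"
  note W = expectation_prod[where \<phi>="\<lambda>_ y. exp (- (real k * f y))", OF Cb_tilt[OF f]]
  have A: "?A \<in> sets \<Omega>" using avg_measurable[OF f] by measurable
  have Weq: "?W \<omega> = exp (- (real k * real n * avg k n f \<omega>))" for \<omega>
  proof -
    have "real k * real n * avg k n f \<omega> = (\<Sum>i=1..n. real k * f (X k n i \<omega>))"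
      using n by (simp add: avg_def sum_distrib_left[symmetric])
    then show ?thesis by (simp only: exp_sum[symmetric] finite_atLeastAtMost sum_negf)
  qed
  have "measure \<Omega> ?A = (\<integral>\<omega>. indicator ?A \<omega> \<partial>\<Omega>)" using A by simp
  also have "\<dots> \<le> (\<integral>\<omega>. exp (real k * real n * b) * ?W \<omega> \<partial>\<Omega>)"
  proof (rule integral_mono)
    show "integrable \<Omega> (\<lambda>\<omega>. indicator ?A \<omega> :: real)" using A by (simp add: less_top[symmetric])
    show "integrable \<Omega> (\<lambda>\<omega>. exp (real k * real n * b) * ?W \<omega>)" by (intro integrable_mult_right W(1))
    fix \<omega>
    have "real k * real n * avg k n f \<omega> \<le> real k * real n * b" if "avg k n f \<omega> < b"
      using that by (intro mult_left_mono) auto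
    then show "indicator ?A \<omega> \<le> exp (real k * real n * b) * ?W \<omega>"
      unfolding Weq by (auto simp: indicator_def exp_add[symmetric])
  qed
  also have "\<dots> = exp (real k * real n * b) * (\<Prod>i=1..n. Z k f (z n i))"
    using W(2) by (simp add: Z_def)
  also have "(\<Prod>i=1..n. Z k f (z n i)) = exp (- (real k * real n * ((\<Sum>i=1..n. G k f (z n i)) / real n)))"
  proof -
    have "real k * real n * ((\<Sum>i=1..n. G k f (z n i)) / real n) = (\<Sum>i=1..n. real k * G k f (z n i))"
      using n by (simp add: sum_distrib_left[symmetric])
    then show ?thesis by (simp only: exp_G[OF f k, symmetric] exp_sum[symmetric] finite_atLeastAtMost sum_negf)
  qed
  also have "exp (real k * real n * b) * \<dots> = exp (real k * real n * (b - (\<Sum>i=1..n. G k f (z n i)) / real n))"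
    by (simp add: exp_add[symmetric] right_diff_distrib)
  finally show ?thesis .
qed

lemma upper_one:
  assumes f: "f \<in> Cb" and s: "s < t"
  shows "\<forall>\<^sub>F k in sequentially. \<forall>\<^sub>F n in sequentially.
    measure \<Omega> {\<omega>\<in>space \<Omega>. avg k n f \<omega> < (\<integral>x. S f x \<partial>\<mu>) - t} \<le> exp (- (real k * real n * s))"
proof -
  \<comment> \<open>One half of the gap is spent on the limit in \<open>k\<close>, the other on the
    limit in \<open>n\<close>.\<close>
  define \<delta> where "\<delta> = (t - s) / 2"
  have "2 * \<delta> = t - s" by (simp add: \<delta>_def)
  with s have \<delta>: "\<delta> > 0" "2 * \<delta> = t - s" by linarith+
  have "\<forall>\<^sub>F k in sequentially. (\<integral>x. S f x \<partial>\<mu>) - \<delta> < (\<integral>x. G k f x \<partial>\<mu>)"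
    using \<delta> by (intro order_tendstoD(1)[OF integral_G_tendsto[OF f]]) simp
  then show ?thesis using eventually_gt_at_top[of 0]
  proof eventually_elim
    case (elim k)
    have "\<forall>\<^sub>F n in sequentially. (\<integral>x. G k f x \<partial>\<mu>) - \<delta> < (\<Sum>i=1..n. G k f (z n i)) / real n"
      using \<delta> by (intro order_tendstoD(1)[OF average_tendsto[OF G_Cb[OF f]]]) simp
    then show ?case using eventually_gt_at_top[of 0]
    proof eventually_elim
      fix n assume n: "(\<integral>x. G k f x \<partial>\<mu>) - \<delta> < (\<Sum>i=1..n. G k f (z n i)) / real n" "n > 0"
      have "measure \<Omega> {\<omega>\<in>space \<Omega>. avg k n f \<omega> < (\<integral>x. S f x \<partial>\<mu>) - t}
        \<le> exp (real k * real n * ((\<integral>x. S f x \<partial>\<mu>) - t - (\<Sum>i=1..n. G k f (z n i)) / real n))"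
        by (rule chernoff[OF f elim(2) n(2)])
      also have "\<dots> \<le> exp (real k * real n * - s)"
        using elim(1) n(1) \<delta> unfolding exp_le_cancel_iff by (intro mult_left_mono) auto
      finally show "measure \<Omega> {\<omega>\<in>space \<Omega>. avg k n f \<omega> < (\<integral>x. S f x \<partial>\<mu>) - t} \<le> exp (- (real k * real n * s))"
        by simp
    qed
  qed
qed

lemma upper_closed:
  assumes C: "closedin narrow_topology C"
    and cover: "\<And>\<nu>. \<nu> \<in> C \<Longrightarrow> \<exists>f\<in>Cb. t < dual \<nu> f" and s: "s < t"
  shows "\<forall>\<^sub>F k in sequentially. \<forall>\<^sub>F n in sequentially.
    measure \<Omega> (event k n C) \<le> exp (- (real k * real n * s))"
proof -
  from finite_subcover[OF C cover] obtain F where F: "finite F" "F \<subseteq> Cb"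
    and FC: "\<forall>\<nu>\<in>C. \<exists>f\<in>F. t < dual \<nu> f" .
  obtain s' where s': "s < s'" "s' < t" using dense[OF s] by blast
  let ?E = "\<lambda>k n f. {\<omega>\<in>space \<Omega>. avg k n f \<omega> < (\<integral>x. S f x \<partial>\<mu>) - t}"
  have "\<forall>\<^sub>F k in sequentially. \<forall>f\<in>F. \<forall>\<^sub>F n in sequentially. measure \<Omega> (?E k n f) \<le> exp (- (real k * real n * s'))"
    using F s' by (intro eventually_ball_finite ballI upper_one) auto
  then show ?thesis using eventually_gt_at_top[of 0]
  proof eventually_elim
    case (elim k)
    \<comment> \<open>The union bound costs a factor \<open>card F\<close>; from
      \<open>n \<ge> m\<close> on it is absorbed by the gap between \<open>s\<close> and
      \<open>s'\<close>, since \<open>k\<close> is at least 1.\<close>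
    obtain m :: nat where m: "real (card F) < real m * (s' - s)"
      using ex_less_of_nat_mult[of "s' - s"] s' by auto
    have "\<forall>\<^sub>F n in sequentially. \<forall>f\<in>F. measure \<Omega> (?E k n f) \<le> exp (- (real k * real n * s'))"
      using elim(1) F(1) by (intro eventually_ball_finite) auto
    then show ?case using eventually_ge_at_top[of "max 1 m"]
    proof eventually_elim
      fix n assume n: "\<forall>f\<in>F. measure \<Omega> (?E k n f) \<le> exp (- (real k * real n * s'))" "max 1 m \<le> n"
      have E: "?E k n f \<in> sets \<Omega>" if "f \<in> F" for f
      proof -
        have [measurable]: "avg k n f \<in> borel_measurable \<Omega>" using that F by (intro avg_measurable) auto
        show ?thesis by measurable
      qed
      have "event k n C \<subseteq> (\<Union>f\<in>F. ?E k n f)"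
      proof
        fix \<omega> assume \<omega>: "\<omega> \<in> event k n C"
        then obtain f where f: "f \<in> F" "t < (\<integral>x. S f x \<partial>\<mu>) - (\<integral>y. f y \<partial>empirical n (\<lambda>i. X k n i \<omega>))"
          using FC by blast
        then have "t < (\<integral>x. S f x \<partial>\<mu>) - avg k n f \<omega>" using integral_empirical_X[of f n k \<omega>] F n(2) by auto
        then have "avg k n f \<omega> < (\<integral>x. S f x \<partial>\<mu>) - t" by linarith
        then show "\<omega> \<in> (\<Union>f\<in>F. ?E k n f)" using f(1) \<omega> by auto
      qed
      then have "measure \<Omega> (event k n C) \<le> measure \<Omega> (\<Union>f\<in>F. ?E k n f)"
        using E F(1) by (intro Om.finite_measure_mono) auto
      also have "\<dots> \<le> (\<Sum>f\<in>F. measure \<Omega> (?E k n f))"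
        using E F(1) by (intro Om.finite_measure_subadditive_finite) auto
      also have "\<dots> \<le> real (card F) * exp (- (real k * real n * s'))"
        using n(1) sum_bounded_above[of F "\<lambda>f. measure \<Omega> (?E k n f)"] by simp
      also have "\<dots> \<le> exp (real k * real n * (s' - s)) * exp (- (real k * real n * s'))"
      proof (rule mult_right_mono)
        have "real m * (s' - s) \<le> (real k * real n) * (s' - s)"
        proof (rule mult_right_mono)
          have "real m \<le> 1 * real n" using n(2) by simp
          also have "\<dots> \<le> real k * real n" using elim(2) by (intro mult_right_mono) auto
          finally show "real m \<le> real k * real n" .
        qed (use s' in simp)
        then show "real (card F) \<le> exp (real k * real n * (s' - s))"
          using m exp_ge_add_one_self[of "real k * real n * (s' - s)"] by linarith
      qed simp
      also have "\<dots> = exp (- (real k * real n * s))" by (simp add: exp_add[symmetric] algebra_simps)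
      finally show "measure \<Omega> (event k n C) \<le> exp (- (real k * real n * s))" .
    qed
  qed
qed

end

section \<open>Change of measure and the lower bound on open sets\<close>

context particle_LDP
begin

text \<open>The density of the law under which the particles are independent with tilted laws.\<close>

definition W :: "nat \<Rightarrow> nat \<Rightarrow> ('a \<Rightarrow> real) \<Rightarrow> 'w \<Rightarrow> real" where
  "W k n f \<omega> = (\<Prod>i=1..n. exp (- (real k * f (X k n i \<omega>))) / Z k f (z n i))"

lemma W_eq:
  assumes f: "f \<in> Cb" and k: "k > 0" and n: "n > 0"
  shows "W k n f \<omega> = exp (real k * real n * ((\<Sum>i=1..n. G k f (z n i)) / real n - avg k n f \<omega>))"
proof -
  have "real k * real n * ((\<Sum>i=1..n. G k f (z n i)) / real n - avg k n f \<omega>)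
    = (\<Sum>i=1..n. real k * G k f (z n i) - real k * f (X k n i \<omega>))"
    using n by (simp add: avg_def sum_distrib_left[symmetric] sum_subtractf right_diff_distrib)
  moreover have "exp (- (real k * f y)) / Z k f x = exp (real k * G k f x - real k * f y)" for x y
    by (simp add: exp_G[OF f k, symmetric] exp_diff exp_minus divide_inverse mult.commute)
  ultimately show ?thesis by (simp only: W_def exp_sum[symmetric] finite_atLeastAtMost)
qed

lemma tilted_expectation:
  assumes f: "f \<in> Cb" and \<psi>: "\<And>i. i \<in> {1..n} \<Longrightarrow> \<psi> i \<in> Cb"
  shows "integrable \<Omega> (\<lambda>\<omega>. W k n f \<omega> * (\<Prod>i=1..n. \<psi> i (X k n i \<omega>)))"
    "(\<integral>\<omega>. W k n f \<omega> * (\<Prod>i=1..n. \<psi> i (X k n i \<omega>)) \<partial>\<Omega>) = (\<Prod>i=1..n. tilt k f (\<psi> i) (z n i))"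
proof -
  let ?\<phi> = "\<lambda>i y. 1 / Z k f (z n i) * (\<psi> i y * exp (- (real k * f y)))"
  have \<phi>: "?\<phi> i \<in> Cb" if "i \<in> {1..n}" for i by (intro Cb_cmult Cb_mult Cb_tilt f \<psi> that)
  have eq: "W k n f \<omega> * (\<Prod>i=1..n. \<psi> i (X k n i \<omega>)) = (\<Prod>i=1..n. ?\<phi> i (X k n i \<omega>))" for \<omega>
    unfolding W_def prod.distrib[symmetric] by (intro prod.cong refl) simp
  show "integrable \<Omega> (\<lambda>\<omega>. W k n f \<omega> * (\<Prod>i=1..n. \<psi> i (X k n i \<omega>)))"
    unfolding eq by (rule expectation_prod(1)) (rule \<phi>)
  have "(\<integral>\<omega>. W k n f \<omega> * (\<Prod>i=1..n. \<psi> i (X k n i \<omega>)) \<partial>\<Omega>) = (\<Prod>i=1..n. \<integral>y. ?\<phi> i y \<partial>P k (z n i))"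
    unfolding eq by (rule expectation_prod(2)) (rule \<phi>)
  also have "\<dots> = (\<Prod>i=1..n. tilt k f (\<psi> i) (z n i))"
    by (intro prod.cong refl) (simp add: tilt_def)
  finally show "(\<integral>\<omega>. W k n f \<omega> * (\<Prod>i=1..n. \<psi> i (X k n i \<omega>)) \<partial>\<Omega>) = (\<Prod>i=1..n. tilt k f (\<psi> i) (z n i))" .
qed

lemma W_integrable: "f \<in> Cb \<Longrightarrow> integrable \<Omega> (W k n f)"
  and W_expectation: "f \<in> Cb \<Longrightarrow> (\<integral>\<omega>. W k n f \<omega> \<partial>\<Omega>) = 1"
  using tilted_expectation[where \<psi>="\<lambda>_ _. 1", OF _ Cb_const] by (simp_all add: tilt_const)

lemma W_nonneg: "f \<in> Cb \<Longrightarrow> 0 \<le> W k n f \<omega>"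
  unfolding W_def by (intro prod_nonneg ballI divide_nonneg_nonneg) (auto intro: less_imp_le[OF Z_pos])

text \<open>Under the density \<open>W\<close> the particles are independent, so centred cross terms
  vanish and only the \<open>n\<close> diagonal terms, each at most \<open>4 * B\<^sup>2\<close>,
  survive the division by \<open>n\<close> squared.\<close>

lemma tilted_variance:
  fixes k n :: nat
  assumes f: "f \<in> Cb" and g: "g \<in> Cb" and B: "\<And>y. \<bar>g y\<bar> \<le> B" and n: "n > 0"
  defines "e \<equiv> (\<Sum>i=1..n. tilt k f g (z n i)) / real n"
  shows "integrable \<Omega> (\<lambda>\<omega>. W k n f \<omega> * (avg k n g \<omega> - e)\<^sup>2)"
    "(\<integral>\<omega>. W k n f \<omega> * (avg k n g \<omega> - e)\<^sup>2 \<partial>\<Omega>) \<le> 4 * B\<^sup>2 / real n"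
proof -
  define m where "m i = tilt k f g (z n i)" for i
  define Y where "Y j \<omega> = g (X k n j \<omega>) - m j" for j \<omega>
  \<comment> \<open>Rewrites a product of two centred variables as a product over all particles with
    trivial factors elsewhere, the form that \<open>tilted_expectation\<close> accepts; for
    \<open>j = l\<close> the single factor is a square.\<close>
  define \<psi> where "\<psi> j l i y = (if i = j then g y - m j else 1) * (if i = l then g y - m l else 1)" for j l i :: nat and y
  have \<psi>: "\<psi> j l i \<in> Cb" for j l i
  proof -
    have "(\<lambda>y. if i = j then g y - m j else 1) \<in> Cb" for j
      by (cases "i = j") (auto intro: Cb_diff g Cb_const)
    then show ?thesis unfolding \<psi>_def[abs_def] by (intro Cb_mult)
  qed
  have prod: "(\<Prod>i=1..n. \<psi> j l i (X k n i \<omega>)) = Y j \<omega> * Y l \<omega>" if "j \<in> {1..n}" "l \<in> {1..n}" for j l \<omega>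
    using that by (simp add: \<psi>_def prod.distrib prod.delta Y_def)

  have int: "integrable \<Omega> (\<lambda>\<omega>. W k n f \<omega> * (Y j \<omega> * Y l \<omega>))" if "j \<in> {1..n}" "l \<in> {1..n}" for j l
    unfolding prod[OF that, symmetric] by (rule tilted_expectation(1)[OF f \<psi>])
  have val: "(\<integral>\<omega>. W k n f \<omega> * (Y j \<omega> * Y l \<omega>) \<partial>\<Omega>) \<le> (if j = l then 4 * B\<^sup>2 else 0)"
    if jl: "j \<in> {1..n}" "l \<in> {1..n}" for j l
  proof -
    have "(\<integral>\<omega>. W k n f \<omega> * (Y j \<omega> * Y l \<omega>) \<partial>\<Omega>) = (\<Prod>i=1..n. tilt k f (\<psi> j l i) (z n i))"
      unfolding prod[OF jl, symmetric] by (rule tilted_expectation(2)[OF f \<psi>])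
    also have "\<dots> \<le> (if j = l then 4 * B\<^sup>2 else 0)"
    proof (cases "j = l")
      case True
      have "tilt k f (\<psi> j l i) (z n i) = (if i = j then tilt k f (\<psi> j j j) (z n j) else 1)" for i
      proof (cases "i = j")
        case False
        then have "\<psi> j l i = (\<lambda>_. 1)" using True by (auto simp: \<psi>_def)
        then show ?thesis using False by (simp add: tilt_const[OF f])
      qed (simp add: True)
      then have "(\<Prod>i=1..n. tilt k f (\<psi> j l i) (z n i)) = tilt k f (\<psi> j j j) (z n j)"
        using jl by (simp add: prod.delta)
      also have "\<dots> \<le> 4 * B\<^sup>2"
      proof -
        have "\<bar>\<psi> j j j y\<bar> \<le> (2 * B) * (2 * B)" for y
        proof -
          have "\<bar>g y - m j\<bar> \<le> 2 * B" using B[of y] tilt_bound[OF f g B, of k "z n j"] unfolding m_def by linarith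
          then show ?thesis by (simp only: \<psi>_def abs_mult refl if_True) (intro mult_mono; simp)
        qed
        from tilt_bound[OF f \<psi> this, of k "z n j"] show ?thesis by (simp add: power2_eq_square abs_le_iff)
      qed
      finally show ?thesis using True by simp
    next
      case False
      \<comment> \<open>Off the diagonal, the factor of particle \<open>j\<close> is centred under
        its tilted law, so the product of means contains a zero.\<close>
      have "\<psi> j l j = (\<lambda>y. - m j + 1 * g y)" using False by (auto simp: \<psi>_def)
      then have "tilt k f (\<psi> j l j) (z n j) = 0" by (simp only: tilt_affine[OF f g]) (simp add: m_def)
      then have p0: "(\<Prod>i=1..n. tilt k f (\<psi> j l i) (z n i)) = 0" using jl by (intro prod_zero) auto
      show ?thesis unfolding p0 using False by simp
    qed
    finally show ?thesis .
  qed
  have avg: "avg k n g \<omega> - e = (\<Sum>j=1..n. Y j \<omega>) / real n" for \<omega>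
    by (simp add: avg_def e_def Y_def m_def sum_subtractf diff_divide_distrib)
  have eq: "W k n f \<omega> * (avg k n g \<omega> - e)\<^sup>2 = (\<Sum>j=1..n. \<Sum>l=1..n. W k n f \<omega> * (Y j \<omega> * Y l \<omega>)) / (real n)\<^sup>2" for \<omega>
  proof -
    have "(\<Sum>j=1..n. Y j \<omega>)\<^sup>2 = (\<Sum>j=1..n. \<Sum>l=1..n. Y j \<omega> * Y l \<omega>)"
      by (simp only: power2_eq_square sum_product)
    then show ?thesis unfolding avg power_divide by (simp only: times_divide_eq_right sum_distrib_left)
  qed
  show "integrable \<Omega> (\<lambda>\<omega>. W k n f \<omega> * (avg k n g \<omega> - e)\<^sup>2)"
    unfolding eq using int by (intro integrable_divide Bochner_Integration.integrable_sum) auto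
  have "(\<integral>\<omega>. W k n f \<omega> * (avg k n g \<omega> - e)\<^sup>2 \<partial>\<Omega>)
    = (\<Sum>j=1..n. \<Sum>l=1..n. \<integral>\<omega>. W k n f \<omega> * (Y j \<omega> * Y l \<omega>) \<partial>\<Omega>) / (real n)\<^sup>2"
  proof -
    have "(\<integral>\<omega>. (\<Sum>j=1..n. \<Sum>l=1..n. W k n f \<omega> * (Y j \<omega> * Y l \<omega>)) \<partial>\<Omega>)
      = (\<Sum>j=1..n. \<integral>\<omega>. (\<Sum>l=1..n. W k n f \<omega> * (Y j \<omega> * Y l \<omega>)) \<partial>\<Omega>)"
      by (intro Bochner_Integration.integral_sum Bochner_Integration.integrable_sum int)
    also have "\<dots> = (\<Sum>j=1..n. \<Sum>l=1..n. \<integral>\<omega>. W k n f \<omega> * (Y j \<omega> * Y l \<omega>) \<partial>\<Omega>)"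
      by (intro sum.cong refl Bochner_Integration.integral_sum int)
    finally show ?thesis unfolding eq by simp
  qed
  also have "\<dots> \<le> (\<Sum>j=1..n. \<Sum>l=1..n. if j = l then 4 * B\<^sup>2 else 0) / (real n)\<^sup>2"
    using val by (intro divide_right_mono sum_mono) auto
  also have "\<dots> = 4 * B\<^sup>2 / real n"
    using n by (simp add: power2_eq_square)
  finally show "(\<integral>\<omega>. W k n f \<omega> * (avg k n g \<omega> - e)\<^sup>2 \<partial>\<Omega>) \<le> 4 * B\<^sup>2 / real n" .
qed

lemma tilted_deviation_tendsto:
  assumes f: "f \<in> Cb" and g: "g \<in> Cb" and \<eta>: "\<eta> > 0" and \<epsilon>: "\<epsilon> > 0"
  shows "\<forall>\<^sub>F n in sequentially.
    (\<integral>\<omega>. W k n f \<omega> * indicator {\<omega>\<in>space \<Omega>. \<eta> \<le> \<bar>avg k n g \<omega> - (\<integral>x. tilt k f g x \<partial>\<mu>)\<bar>} \<omega> \<partial>\<Omega>) \<le> \<epsilon>"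
proof -
  obtain B where B: "\<And>y. \<bar>g y\<bar> \<le> B" using Cb_D[OF g] by blast
  let ?e = "\<lambda>n. (\<Sum>i=1..n. tilt k f g (z n i)) / real n" and ?m = "\<integral>x. tilt k f g x \<partial>\<mu>"
  \<comment> \<open>Chebyshev's inequality at distance \<open>\<eta> / 2\<close> gives
    \<open>4 / \<eta>\<^sup>2\<close> times the variance \<open>4 * B\<^sup>2 / n\<close>; the other
    \<open>\<eta> / 2\<close> covers the convergence of the mean.\<close>
  obtain N :: nat where N: "16 * B\<^sup>2 < real N * (\<epsilon> * \<eta>\<^sup>2)"
    using ex_less_of_nat_mult[of "\<epsilon> * \<eta>\<^sup>2"] \<epsilon> \<eta> by auto
  have "\<forall>\<^sub>F n in sequentially. dist (?e n) ?m < \<eta> / 2"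
    using \<eta> by (intro tendstoD[OF average_tendsto[OF tilt_Cb[OF f g]]]) simp
  then show ?thesis using eventually_ge_at_top[of "max 1 N"]
  proof eventually_elim
    case (elim n)
    let ?A = "{\<omega>\<in>space \<Omega>. \<eta> \<le> \<bar>avg k n g \<omega> - ?m\<bar>}"
    have n: "n > 0" "N \<le> n" using elim(2) by auto
    note V = tilted_variance[OF f g B n(1), of k]
    have [measurable]: "avg k n g \<in> borel_measurable \<Omega>" by (rule avg_measurable[OF g])
    have A: "?A \<in> sets \<Omega>" by measurable
    have "(\<integral>\<omega>. W k n f \<omega> * indicator ?A \<omega> \<partial>\<Omega>) \<le> (\<integral>\<omega>. 4 / \<eta>\<^sup>2 * (W k n f \<omega> * (avg k n g \<omega> - ?e n)\<^sup>2) \<partial>\<Omega>)"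
    proof (rule integral_mono)
      show "integrable \<Omega> (\<lambda>\<omega>. W k n f \<omega> * indicator ?A \<omega>)"
        using integrable_mult_indicator[OF A W_integrable[OF f, of k n]] by (simp add: mult.commute)
      show "integrable \<Omega> (\<lambda>\<omega>. 4 / \<eta>\<^sup>2 * (W k n f \<omega> * (avg k n g \<omega> - ?e n)\<^sup>2))"
        by (rule integrable_mult_right[OF V(1)])
      fix \<omega>
      show "W k n f \<omega> * indicator ?A \<omega> \<le> 4 / \<eta>\<^sup>2 * (W k n f \<omega> * (avg k n g \<omega> - ?e n)\<^sup>2)"
      proof (cases "\<omega> \<in> ?A")
        case True
        then have "\<eta> \<le> \<bar>avg k n g \<omega> - ?m\<bar>" by simp
        moreover have "\<bar>?e n - ?m\<bar> < \<eta> / 2" using elim(1) unfolding dist_real_def .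
        ultimately have "\<eta> / 2 \<le> \<bar>avg k n g \<omega> - ?e n\<bar>" by linarith
        then have "(\<eta> / 2)\<^sup>2 \<le> (avg k n g \<omega> - ?e n)\<^sup>2" using \<eta> by (intro abs_le_square_iff[THEN iffD1]) simp
        then have "1 \<le> 4 / \<eta>\<^sup>2 * (avg k n g \<omega> - ?e n)\<^sup>2" using \<eta> by (simp add: field_simps)
        from mult_left_mono[OF this W_nonneg[OF f, of k n \<omega>]] show ?thesis using True by (simp add: algebra_simps)
      next
        case False
        then show ?thesis using W_nonneg[OF f, of k n \<omega>] by simp
      qed
    qed
    also have "\<dots> = 4 / \<eta>\<^sup>2 * (\<integral>\<omega>. W k n f \<omega> * (avg k n g \<omega> - ?e n)\<^sup>2 \<partial>\<Omega>)"
      by simp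
    also have "\<dots> \<le> 4 / \<eta>\<^sup>2 * (4 * B\<^sup>2 / real n)"
      by (rule mult_left_mono[OF V(2)]) simp
    also have "\<dots> \<le> \<epsilon>"
    proof -
      have "real N * (\<epsilon> * \<eta>\<^sup>2) \<le> real n * (\<epsilon> * \<eta>\<^sup>2)" using n \<epsilon> by (intro mult_right_mono) auto
      then show ?thesis using N n \<eta> by (simp add: field_simps)
    qed
    finally show ?case .
  qed
qed

text \<open>The event has tilted probability at least one half, and on it the density
  \<open>W\<close> is at most about \<open>exp (k * n * T)\<close>, where \<open>T\<close> is the
  entropic cost per unit. Dividing gives the bound for the original law.\<close>

lemma lower_tilt:
  assumes f: "f \<in> Cb" and F: "finite F" "F \<subseteq> Cb" and k: "k > 0" and \<epsilon>: "\<epsilon> > 0"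
    and s: "(\<integral>x. G k f x \<partial>\<mu>) - (\<integral>x. tilt k f f x \<partial>\<mu>) < s"
  shows "\<forall>\<^sub>F n in sequentially. exp (- (real k * real n * s))
    \<le> measure \<Omega> {\<omega>\<in>space \<Omega>. \<forall>g\<in>F. \<bar>avg k n g \<omega> - (\<integral>x. tilt k f g x \<partial>\<mu>)\<bar> < \<epsilon>}"
proof -
  let ?T = "(\<integral>x. G k f x \<partial>\<mu>) - (\<integral>x. tilt k f f x \<partial>\<mu>)" and ?m = "\<lambda>g. \<integral>x. tilt k f g x \<partial>\<mu>"
  \<comment> \<open>The gap between \<open>s\<close> and the entropic cost is cut into four: two
    parts bound the density on the event, two absorb the factor one half.\<close>
  define \<eta> where "\<eta> = min \<epsilon> ((s - ?T) / 4)"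
  have \<eta>: "\<eta> > 0" "\<eta> \<le> \<epsilon>" "4 * \<eta> \<le> s - ?T" using \<epsilon> s by (auto simp: \<eta>_def min_def)
  obtain N :: nat where N: "1 < real N * (2 * \<eta>)" using ex_less_of_nat_mult[of "2 * \<eta>" 1] \<eta> by auto
  \<comment> \<open>The tilting function joins the test functions because control of its empirical
    average is what bounds the density.\<close>
  define F' where "F' = insert f F"
  have F': "finite F'" "F' \<subseteq> Cb" "f \<in> F'" "F \<subseteq> F'" using F f by (auto simp: F'_def)
  have cF: "real (card F') > 0" using F' by (simp add: card_gt_0_iff, blast)
  let ?D = "\<lambda>n g. {\<omega>\<in>space \<Omega>. \<eta> \<le> \<bar>avg k n g \<omega> - ?m g\<bar>}"
  have "\<forall>\<^sub>F n in sequentially. \<forall>g\<in>F'. (\<integral>\<omega>. W k n f \<omega> * indicator (?D n g) \<omega> \<partial>\<Omega>) \<le> 1 / (2 * real (card F'))"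
    using F' \<eta> cF by (intro eventually_ball_finite ballI tilted_deviation_tendsto f) auto
  moreover have "\<forall>\<^sub>F n in sequentially. (\<Sum>i=1..n. G k f (z n i)) / real n < (\<integral>x. G k f x \<partial>\<mu>) + \<eta>"
    using \<eta> by (intro order_tendstoD(2)[OF average_tendsto[OF G_Cb[OF f]]]) simp
  ultimately show ?thesis
    using eventually_ge_at_top[of "max 1 N"]
  proof eventually_elim
    case (elim n)
    have n: "n > 0" "N \<le> n" using elim(3) by auto
    let ?A = "{\<omega>\<in>space \<Omega>. \<forall>g\<in>F'. \<bar>avg k n g \<omega> - ?m g\<bar> < \<eta>}"
    have meas: "avg k n g \<in> borel_measurable \<Omega>" if "g \<in> F'" for g using that F' by (intro avg_measurable) auto
    have D: "?D n g \<in> sets \<Omega>" if "g \<in> F'" for g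
    proof -
      note [measurable] = meas[OF that]
      show ?thesis by measurable
    qed
    have "?A = space \<Omega> - (\<Union>g\<in>F'. ?D n g)" by (auto simp: not_le)
    moreover have "(\<Union>g\<in>F'. ?D n g) \<in> sets \<Omega>" using F'(1) D by (intro sets.finite_UN) auto
    ultimately have A: "?A \<in> sets \<Omega>" by (simp only: sets.compl_sets)
    have intW: "integrable \<Omega> (\<lambda>\<omega>. W k n f \<omega> * indicator E \<omega>)" if "E \<in> sets \<Omega>" for E
      using integrable_mult_indicator[OF that W_integrable[OF f, of k n]] by (simp add: mult.commute)
    let ?R = "\<lambda>\<omega>. W k n f \<omega> * indicator ?A \<omega> + (\<Sum>g\<in>F'. W k n f \<omega> * indicator (?D n g) \<omega>)"
    have "(\<integral>\<omega>. W k n f \<omega> \<partial>\<Omega>) \<le> (\<integral>\<omega>. ?R \<omega> \<partial>\<Omega>)"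
    proof (rule integral_mono)
      show "integrable \<Omega> (W k n f)" by (rule W_integrable[OF f])
      show "integrable \<Omega> ?R"
        using intW A D by (intro Bochner_Integration.integrable_add Bochner_Integration.integrable_sum) auto
      fix \<omega> assume \<omega>: "\<omega> \<in> space \<Omega>"
      have nn: "0 \<le> (\<Sum>g\<in>F'. W k n f \<omega> * indicator (?D n g) \<omega>)"
        by (intro sum_nonneg mult_nonneg_nonneg W_nonneg f) auto
      show "W k n f \<omega> \<le> ?R \<omega>"
      proof (cases "\<omega> \<in> ?A")
        case True
        then show ?thesis using nn by simp
      next
        case False
        then obtain g where g: "g \<in> F'" "\<omega> \<in> ?D n g" using \<omega> by (auto simp: not_less)
        then have "W k n f \<omega> = W k n f \<omega> * indicator (?D n g) \<omega>" by simp
        also have "\<dots> \<le> (\<Sum>g\<in>F'. W k n f \<omega> * indicator (?D n g) \<omega>)"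
          using g(1) F'(1) by (intro member_le_sum mult_nonneg_nonneg W_nonneg[OF f]) auto
        finally show ?thesis using False by simp
      qed
    qed
    also have "\<dots> = (\<integral>\<omega>. W k n f \<omega> * indicator ?A \<omega> \<partial>\<Omega>) + (\<Sum>g\<in>F'. \<integral>\<omega>. W k n f \<omega> * indicator (?D n g) \<omega> \<partial>\<Omega>)"
      using intW[OF A] intW[OF D] by (simp add: Bochner_Integration.integral_sum Bochner_Integration.integrable_sum)
    also have "(\<Sum>g\<in>F'. \<integral>\<omega>. W k n f \<omega> * indicator (?D n g) \<omega> \<partial>\<Omega>) \<le> real (card F') * (1 / (2 * real (card F')))"
      using elim(1) by (intro sum_bounded_above) auto
    also have "\<dots> = 1 / 2" using cF by simp
    finally have half: "1 / 2 \<le> (\<integral>\<omega>. W k n f \<omega> * indicator ?A \<omega> \<partial>\<Omega>)" using W_expectation[OF f, of k n] by simp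
    \<comment> \<open>One \<eta> comes from the average of \<open>G k f\<close> over the array, the
      other from the empirical average of \<open>f\<close>.\<close>
    let ?E = "exp (real k * real n * (?T + 2 * \<eta>))"
    have "(\<integral>\<omega>. W k n f \<omega> * indicator ?A \<omega> \<partial>\<Omega>) \<le> (\<integral>\<omega>. ?E * indicator ?A \<omega> \<partial>\<Omega>)"
    proof (rule integral_mono[OF intW[OF A]])
      show "integrable \<Omega> (\<lambda>\<omega>. ?E * indicator ?A \<omega>)" using A by (simp add: less_top[symmetric])
      fix \<omega>
      show "W k n f \<omega> * indicator ?A \<omega> \<le> ?E * indicator ?A \<omega>"
      proof (cases "\<omega> \<in> ?A")
        case True
        then have "\<bar>avg k n f \<omega> - ?m f\<bar> < \<eta>" using F'(3) by blast
        then have "(\<Sum>i=1..n. G k f (z n i)) / real n - avg k n f \<omega> \<le> ?T + 2 * \<eta>" using elim(2) by linarith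
        then have "W k n f \<omega> \<le> ?E"
          unfolding W_eq[OF f k n(1)] exp_le_cancel_iff by (intro mult_left_mono) auto
        then show ?thesis using True by simp
      qed simp
    qed
    also have "\<dots> = ?E * measure \<Omega> ?A" using A by simp
    finally have "1 / 2 \<le> ?E * measure \<Omega> ?A" using half by linarith
    then have "1 / 2 * exp (- (real k * real n * (?T + 2 * \<eta>))) \<le> ?E * measure \<Omega> ?A * exp (- (real k * real n * (?T + 2 * \<eta>)))"
      by (rule mult_right_mono) simp
    also have "\<dots> = measure \<Omega> ?A * (?E * exp (- (real k * real n * (?T + 2 * \<eta>))))" by (simp only: mult_ac)
    also have "?E * exp (- (real k * real n * (?T + 2 * \<eta>))) = 1" by (rule exp_minus_inverse)
    finally have PA: "1 / 2 * exp (- (real k * real n * (?T + 2 * \<eta>))) \<le> measure \<Omega> ?A" by simp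
    have "2 \<le> exp (real k * real n * (2 * \<eta>))"
    proof -
      have "real N * (2 * \<eta>) \<le> (real k * real n) * (2 * \<eta>)"
      proof (rule mult_right_mono)
        have "real N \<le> 1 * real n" using n by simp
        also have "\<dots> \<le> real k * real n" using k by (intro mult_right_mono) auto
        finally show "real N \<le> real k * real n" .
      qed (use \<eta> in simp)
      then show ?thesis using N exp_ge_add_one_self[of "real k * real n * (2 * \<eta>)"] by linarith
    qed
    then have "2 * exp (- (real k * real n * (?T + 4 * \<eta>)))
      \<le> exp (real k * real n * (2 * \<eta>)) * exp (- (real k * real n * (?T + 4 * \<eta>)))"
      by (intro mult_right_mono) auto
    also have "\<dots> = exp (- (real k * real n * (?T + 2 * \<eta>)))"
      by (simp add: exp_add[symmetric] algebra_simps)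
    finally have "exp (- (real k * real n * (?T + 4 * \<eta>))) \<le> measure \<Omega> ?A" using PA by linarith
    moreover have "exp (- (real k * real n * s)) \<le> exp (- (real k * real n * (?T + 4 * \<eta>)))"
    proof -
      have "real k * real n * (?T + 4 * \<eta>) \<le> real k * real n * s" using \<eta>(3) by (intro mult_left_mono) auto
      then show ?thesis by simp
    qed
    moreover have "measure \<Omega> ?A \<le> measure \<Omega> {\<omega>\<in>space \<Omega>. \<forall>g\<in>F. \<bar>avg k n g \<omega> - ?m g\<bar> < \<epsilon>}"
    proof (rule Om.finite_measure_mono)
      show "?A \<subseteq> {\<omega>\<in>space \<Omega>. \<forall>g\<in>F. \<bar>avg k n g \<omega> - ?m g\<bar> < \<epsilon>}"
        using \<eta>(2) F'(4) by (auto intro: less_le_trans)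
      have "{\<omega>\<in>space \<Omega>. \<forall>g\<in>F. \<bar>avg k n g \<omega> - ?m g\<bar> < \<epsilon>} = space \<Omega> - (\<Union>g\<in>F. {\<omega>\<in>space \<Omega>. \<epsilon> \<le> \<bar>avg k n g \<omega> - ?m g\<bar>})"
        by (auto simp: not_le)
      moreover have "{\<omega>\<in>space \<Omega>. \<epsilon> \<le> \<bar>avg k n g \<omega> - ?m g\<bar>} \<in> sets \<Omega>" if "g \<in> F" for g
      proof -
        have [measurable]: "avg k n g \<in> borel_measurable \<Omega>" using meas that F'(4) by blast
        show ?thesis by measurable
      qed
      then have "(\<Union>g\<in>F. {\<omega>\<in>space \<Omega>. \<epsilon> \<le> \<bar>avg k n g \<omega> - ?m g\<bar>}) \<in> sets \<Omega>"
        using F(1) by (intro sets.finite_UN) auto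
      ultimately show "{\<omega>\<in>space \<Omega>. \<forall>g\<in>F. \<bar>avg k n g \<omega> - ?m g\<bar> < \<epsilon>} \<in> sets \<Omega>" by (simp only: sets.compl_sets)
    qed
    ultimately show ?case by linarith
  qed
qed

lemma lower_open:
  assumes U: "openin narrow_topology U" "\<nu> \<in> U"
    and dual: "\<And>f. f \<in> Cb \<Longrightarrow> dual \<nu> f \<le> t" and s: "t < s"
  shows "\<forall>\<^sub>F k in sequentially. \<forall>\<^sub>F n in sequentially. exp (- (real k * real n * s))
    \<le> measure \<Omega> (event k n U)"
proof -
  have \<nu>: "\<nu> \<in> prob_measures" using U openin_subset[OF U(1)] by (auto simp: topspace_narrow)
  obtain F \<epsilon> where F: "finite F" "F \<subseteq> Cb" "\<epsilon> > 0"
    and FU: "\<And>M. M \<in> prob_measures \<Longrightarrow> (\<And>f. f \<in> F \<Longrightarrow> \<bar>(\<integral>x. f x \<partial>M) - (\<integral>x. f x \<partial>\<nu>)\<bar> < \<epsilon>) \<Longrightarrow> M \<in> U"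
    using narrow_open_nbhd[OF U] by blast
  obtain fs :: "nat \<Rightarrow> 'a \<Rightarrow> real" and m where fs: "F = fs ` {i. i < m}"
    using finite_imp_nat_seg_image_inj_on[OF F(1)] by blast
  \<comment> \<open>Half of the neighbourhood is left for the bias of the tilted means, half for the
    fluctuation of the empirical averages.\<close>
  define \<delta> where "\<delta> = min (\<epsilon> / 2) ((s - t) / 2)"
  have \<delta>: "\<delta> > 0" "\<delta> \<le> \<epsilon> / 2" "t + \<delta> < s" using F(3) s by (auto simp: \<delta>_def min_def field_simps)
  have fC: "fs i \<in> Cb" if "i < m" for i using that F(2) fs by auto
  have "\<forall>\<^sub>F k in sequentially. \<exists>f\<in>Cb. (\<forall>i<m. \<bar>(\<integral>x. tilt k f (fs i) x \<partial>\<mu>) - (\<integral>y. fs i y \<partial>\<nu>)\<bar> \<le> \<delta>) \<and>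
    (\<integral>x. G k f x \<partial>\<mu>) - (\<integral>x. tilt k f f x \<partial>\<mu>) \<le> t + \<delta>"
    by (rule tilt_recovery[OF \<nu> fC dual \<delta>(1)])
  then show ?thesis using eventually_gt_at_top[of 0]
  proof eventually_elim
    case (elim k)
    then obtain f where f: "f \<in> Cb" "\<forall>i<m. \<bar>(\<integral>x. tilt k f (fs i) x \<partial>\<mu>) - (\<integral>y. fs i y \<partial>\<nu>)\<bar> \<le> \<delta>"
      "(\<integral>x. G k f x \<partial>\<mu>) - (\<integral>x. tilt k f f x \<partial>\<mu>) \<le> t + \<delta>" by blast
    then have fF: "\<bar>(\<integral>x. tilt k f g x \<partial>\<mu>) - (\<integral>y. g y \<partial>\<nu>)\<bar> \<le> \<epsilon> / 2" if "g \<in> F" for g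
      using that \<delta>(2) fs by force
    have "\<forall>\<^sub>F n in sequentially. exp (- (real k * real n * s))
      \<le> measure \<Omega> {\<omega>\<in>space \<Omega>. \<forall>g\<in>F. \<bar>avg k n g \<omega> - (\<integral>x. tilt k f g x \<partial>\<mu>)\<bar> < \<epsilon> / 2}"
      using f(3) \<delta>(3) F elim(2) by (intro lower_tilt f(1)) auto
    then show ?case using eventually_ge_at_top[of 1]
    proof eventually_elim
      fix n :: nat assume n: "1 \<le> n" and ge: "exp (- (real k * real n * s))
        \<le> measure \<Omega> {\<omega>\<in>space \<Omega>. \<forall>g\<in>F. \<bar>avg k n g \<omega> - (\<integral>x. tilt k f g x \<partial>\<mu>)\<bar> < \<epsilon> / 2}"
      have "measure \<Omega> {\<omega>\<in>space \<Omega>. \<forall>g\<in>F. \<bar>avg k n g \<omega> - (\<integral>x. tilt k f g x \<partial>\<mu>)\<bar> < \<epsilon> / 2}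
        \<le> measure \<Omega> (event k n U)"
      proof (rule Om.finite_measure_mono)
        have "U \<in> narrow_borel" unfolding narrow_borel_def using U(1) by (intro sigma_sets.Basic) simp
        then show "event k n U \<in> sets \<Omega>"
          using n X_measurable by (intro empirical_event_sets) auto
        show "{\<omega>\<in>space \<Omega>. \<forall>g\<in>F. \<bar>avg k n g \<omega> - (\<integral>x. tilt k f g x \<partial>\<mu>)\<bar> < \<epsilon> / 2}
          \<subseteq> event k n U"
        proof clarify
          fix \<omega> assume \<omega>: "\<forall>g\<in>F. \<bar>avg k n g \<omega> - (\<integral>x. tilt k f g x \<partial>\<mu>)\<bar> < \<epsilon> / 2"
          have "\<bar>(\<integral>x. g x \<partial>empirical n (\<lambda>i. X k n i \<omega>)) - (\<integral>x. g x \<partial>\<nu>)\<bar> < \<epsilon>" if g: "g \<in> F" for g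
          proof -
            have "(\<integral>x. g x \<partial>empirical n (\<lambda>i. X k n i \<omega>)) = avg k n g \<omega>"
              using g F(2) n by (intro integral_empirical_X) auto
            then show ?thesis using bspec[OF \<omega> g] fF[OF g] by linarith
          qed
          then show "empirical n (\<lambda>i. X k n i \<omega>) \<in> U"
            by (intro FU empirical_prob_measures[OF n])
        qed
      qed
      with ge show "exp (- (real k * real n * s)) \<le> measure \<Omega> (event k n U)"
        by linarith
    qed
  qed
qed

end

section \<open>Measurability of kernels\<close>

text \<open>Masses of open sets are limits of test integrals, and open sets generate the
  sigma-algebra of \<open>prob_algebra\<close>.\<close>

lemma kernel_measurable:
  fixes \<kappa> :: "'a::metric_space \<Rightarrow> 'b::metric_space measure"
  assumes \<kappa>: "\<And>x. \<kappa> x \<in> prob_measures"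
    and meas: "\<And>g. g \<in> Cb \<Longrightarrow> (\<lambda>x. \<integral>y. g y \<partial>\<kappa> x) \<in> borel_measurable borel"
  shows "\<kappa> \<in> measurable borel (prob_algebra borel)"
proof (rule measurable_prob_algebra_generated[where G="{U. open U}" and \<Omega>=UNIV])
  show "sets (borel :: 'b measure) = sigma_sets UNIV {U. open U}" by (simp add: borel_def)
  show "Int_stable {U :: 'b set. open U}" by (auto simp: Int_stable_def)
  show "prob_space (\<kappa> x)" "sets (\<kappa> x) = sets borel" for x using prob_measuresD[OF \<kappa>] by auto
  fix U :: "'b set" assume "U \<in> {U. open U}"
  then have U: "open U" by simp
  have "(\<lambda>x. measure (\<kappa> x) U) \<in> borel_measurable borel"
  proof (cases "U = UNIV")
    case True
    have "measure (\<kappa> x) U = 1" for x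
      using prob_space.prob_space[OF prob_measuresD(1)[OF \<kappa>[of x]]] True by (simp add: prob_measuresD(3)[OF \<kappa>[of x]])
    then show ?thesis by simp
  next
    case False
    note approx = Cb_open_approx[OF U False]
    show ?thesis
    proof (rule borel_measurable_LIMSEQ_real)
      show "(\<lambda>x. \<integral>y. min 1 (real n * infdist y (- U)) \<partial>\<kappa> x) \<in> borel_measurable borel" for n
        by (rule meas[OF approx(1)])
      fix x
      interpret prob_space "\<kappa> x" using \<kappa> by (rule prob_measuresD)
      have "(\<lambda>n. \<integral>y. min 1 (real n * infdist y (- U)) \<partial>\<kappa> x) \<longlonglongrightarrow> (\<integral>y. indicator U y \<partial>\<kappa> x)"
        using U approx
        by (intro integral_dominated_convergence[where w="\<lambda>_. 1"])
           (auto simp: prob_measuresD[OF \<kappa>] abs_le_iff infdist_nonneg intro!: Cb_borel)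
      then show "(\<lambda>n. \<integral>y. min 1 (real n * infdist y (- U)) \<partial>\<kappa> x) \<longlonglongrightarrow> measure (\<kappa> x) U"
        using U by (simp add: prob_measuresD[OF \<kappa>])
    qed
  qed
  then show "(\<lambda>x. emeasure (\<kappa> x) U) \<in> borel_measurable borel"
    using finite_measure.emeasure_eq_measure[OF prob_space.finite_measure[OF prob_measuresD(1)[OF \<kappa>]]] by simp
qed auto

section \<open>Couplings with given first marginal and tilted second marginals\<close>

context feller_LDP
begin

definition tilted_law :: "nat \<Rightarrow> ('a \<Rightarrow> real) \<Rightarrow> 'a \<Rightarrow> 'a measure" where
  "tilted_law k f x = density (P k x) (\<lambda>y. ennreal (exp (- (real k * f y)) / Z k f x))"

definition tilted_joint :: "nat \<Rightarrow> ('a \<Rightarrow> real) \<Rightarrow> ('a \<times> 'a) measure" where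
  "tilted_joint k f = \<mu> \<bind> (\<lambda>x. distr (tilted_law k f x) borel (Pair x))"

lemma tilted_law_integral:
  assumes f: "f \<in> Cb" and g: "g \<in> borel_measurable borel"
  shows "(\<integral>y. g y \<partial>tilted_law k f x) = tilt k f g x"
proof -
  have "(\<integral>y. g y \<partial>tilted_law k f x) = (\<integral>y. exp (- (real k * f y)) / Z k f x * g y \<partial>P k x)"
    unfolding tilted_law_def using Cb_borel[OF Cb_tilt[OF f]] g Z_pos[OF f, of k x]
    by (subst integral_density) (auto simp: prob_measuresD[OF P_prob])
  also have "\<dots> = tilt k f g x"
    by (simp add: tilt_def integral_divide_zero[symmetric] mult.commute del: integral_divide_zero)
  finally show ?thesis .
qed

lemma tilted_law_prob: assumes f: "f \<in> Cb" shows "tilted_law k f x \<in> prob_measures"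
proof -
  have m: "(\<lambda>y. exp (- (real k * f y)) / Z k f x) \<in> borel_measurable borel"
    using Cb_borel[OF Cb_tilt[OF f]] by simp
  have int: "integrable (P k x) (\<lambda>y. exp (- (real k * f y)) / Z k f x)"
    by (intro integrable_divide Cb_integrable[OF P_prob] Cb_tilt f)
  have "emeasure (tilted_law k f x) UNIV = (\<integral>\<^sup>+ y. ennreal (exp (- (real k * f y)) / Z k f x) \<partial>P k x)"
    unfolding tilted_law_def using m by (subst emeasure_density) (auto simp: prob_measuresD[OF P_prob])
  also have "\<dots> = ennreal (\<integral>y. exp (- (real k * f y)) / Z k f x \<partial>P k x)"
    using Z_pos[OF f, of k x] by (intro nn_integral_eq_integral int) auto
  also have "\<dots> = 1" using Z_pos[OF f, of k x] by (simp add: Z_def)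
  finally have "emeasure (tilted_law k f x) UNIV = 1" .
  then show ?thesis
    unfolding prob_measures_def
    by (auto intro!: prob_spaceI simp: tilted_law_def prob_measuresD[OF P_prob])
qed

lemma tilted_law_measurable: assumes f: "f \<in> Cb" shows "tilted_law k f \<in> measurable borel (prob_algebra borel)"
proof (rule kernel_measurable[OF tilted_law_prob[OF f]])
  fix g :: "'a \<Rightarrow> real" assume g: "g \<in> Cb"
  then show "(\<lambda>x. \<integral>y. g y \<partial>tilted_law k f x) \<in> borel_measurable borel"
    using Cb_borel[OF tilt_Cb[OF f g]] by (simp add: tilted_law_integral[OF f Cb_borel])
qed

lemma tilted_joint_kernel:
  assumes f: "f \<in> Cb"
  shows "(\<lambda>x. distr (tilted_law k f x) borel (Pair x)) \<in> measurable borel (subprob_algebra borel)"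
proof -
  have "case_prod Pair \<in> measurable (borel \<Otimes>\<^sub>M borel) (borel :: ('a \<times> 'a) measure)"
    by (simp add: borel_prod)
  moreover have "tilted_law k f \<in> measurable borel (subprob_algebra borel)"
    using tilted_law_measurable[OF f] by (rule measurable_prob_algebraD)
  ultimately show ?thesis by (rule measurable_distr2)
qed

lemma Pair_borel: "Pair x \<in> borel_measurable borel"
  by (intro borel_measurable_continuous_onI continuous_intros)

lemma tilted_joint_prob: assumes f: "f \<in> Cb" shows "tilted_joint k f \<in> prob_measures"
proof -
  have "(\<lambda>x. distr (tilted_law k f x) borel (Pair x)) \<in> measurable borel (prob_algebra borel)"
  proof (rule measurable_prob_algebraI)
    show "prob_space (distr (tilted_law k f x) borel (Pair x))" for x
      using prob_measures_distr[OF tilted_law_prob[OF f] Pair_borel] by (rule prob_measuresD)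
  qed (rule tilted_joint_kernel[OF f])
  moreover have "\<mu> \<in> space (prob_algebra borel)"
    using prob_measuresD[OF mu] by (simp add: space_prob_algebra)
  ultimately show ?thesis
    unfolding prob_measures_def tilted_joint_def by (simp add: prob_space_bind' sets_bind')
qed

lemma tilted_joint_integral:
  assumes f: "f \<in> Cb" and F: "F \<in> Cb"
  shows "(\<integral>p. F p \<partial>tilted_joint k f) = (\<integral>x. tilt k f (\<lambda>y. F (x, y)) x \<partial>\<mu>)"
    "integrable \<mu> (\<lambda>x. tilt k f (\<lambda>y. F (x, y)) x)"
proof -
  let ?K = "\<lambda>x. distr (tilted_law k f x) borel (Pair x)"
  obtain B where B: "\<And>p. \<bar>F p\<bar> \<le> B" using Cb_D[OF F] by blast
  have K: "?K \<in> measurable \<mu> (subprob_algebra borel)"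
    using tilted_joint_kernel[OF f] by (simp add: prob_measuresD[OF mu])
  have Fx: "(\<lambda>y. F (x, y)) \<in> borel_measurable borel" for x
    using measurable_compose[OF Pair_borel Cb_borel[OF F]] .
  have eq: "(\<integral>p. F p \<partial>?K x) = tilt k f (\<lambda>y. F (x, y)) x" for x
  proof -
    have "(\<integral>p. F p \<partial>?K x) = (\<integral>y. F (x, y) \<partial>tilted_law k f x)"
      using Cb_borel[OF F] Pair_borel by (subst integral_distr) (auto simp: prob_measuresD[OF tilted_law_prob[OF f]])
    then show ?thesis by (simp add: tilted_law_integral[OF f Fx])
  qed
  have "(\<integral>p. F p \<partial>tilted_joint k f) = (\<integral>x. \<integral>p. F p \<partial>?K x \<partial>\<mu>)"
    unfolding tilted_joint_def
  proof (rule integral_bind[OF Cb_borel[OF F] _ K, where B=B and B'=1])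
    show "finite_measure \<mu>" by unfold_locales
    show "AE x in \<mu>. emeasure (?K x) (space (?K x)) \<le> ennreal 1"
    proof (rule AE_I2)
      fix x
      show "emeasure (?K x) (space (?K x)) \<le> ennreal 1"
        using prob_space.emeasure_space_1[OF prob_measuresD(1)[OF prob_measures_distr[OF tilted_law_prob[OF f] Pair_borel]], of k x x]
        by simp
    qed
  qed (use B in auto)
  then show "(\<integral>p. F p \<partial>tilted_joint k f) = (\<integral>x. tilt k f (\<lambda>y. F (x, y)) x \<partial>\<mu>)" by (simp only: eq)
  have "(\<lambda>x. \<integral>p. F p \<partial>?K x) \<in> borel_measurable borel"
    by (rule measurable_compose[OF tilted_joint_kernel[OF f] integral_measurable_subprob_algebra[OF Cb_borel[OF F]]])
  then have "(\<lambda>x. tilt k f (\<lambda>y. F (x, y)) x) \<in> borel_measurable borel" by (simp only: eq)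
  moreover have "(\<lambda>y. F (x, y)) \<in> Cb" for x
    by (rule Cb_compose[OF F]) (intro continuous_intros)
  ultimately show "integrable \<mu> (\<lambda>x. tilt k f (\<lambda>y. F (x, y)) x)"
    using tilt_bound[OF f _ B] by (intro integrable_bounded[OF mu, where B=B]) auto
qed

end

section \<open>Kantorovich duality\<close>

text \<open>With \<open>a i = S (d i)\<close> these maxima increase to the cost; with
  \<open>a i = G k (d i)\<close> they are continuous on the product and can be tested against narrow
  limits. Starting at 0 keeps them nonnegative, as the passage to \<open>ennreal\<close>
  requires.\<close>

primrec running_max :: "(nat \<Rightarrow> 'b \<Rightarrow> real) \<Rightarrow> (nat \<Rightarrow> 'b \<Rightarrow> real) \<Rightarrow> nat \<Rightarrow> 'b \<times> 'b \<Rightarrow> real" where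
  "running_max a d 0 p = 0"
| "running_max a d (Suc m) p = max (running_max a d m p) (a m (fst p) - d m (snd p))"

lemma running_max_nonneg: "0 \<le> running_max a d m p"
  by (induction m) auto

lemma running_max_le_iff: "running_max a d m p \<le> v \<longleftrightarrow> 0 \<le> v \<and> (\<forall>i<m. a i (fst p) - d i (snd p) \<le> v)"
  by (induction m) (auto simp: less_Suc_eq)

lemma running_max_cases:
  obtains "running_max a d m p = 0" | i where "i < m" "running_max a d m p = a i (fst p) - d i (snd p)"
proof (induction m arbitrary: thesis)
  case (Suc m)
  show ?case
  proof (cases "running_max a d m p \<le> a m (fst p) - d m (snd p)")
    case True
    then show ?thesis using Suc.prems(2)[of m] by (simp add: max_def)
  next
    case False
    then have eq: "running_max a d (Suc m) p = running_max a d m p" by simp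
    show ?thesis
    proof (rule Suc.IH)
      assume "running_max a d m p = 0" then show thesis using Suc.prems(1) eq by simp
    next
      fix i assume "i < m" "running_max a d m p = a i (fst p) - d i (snd p)"
      then show thesis using Suc.prems(2)[of i] eq by simp
    qed
  qed
qed simp

lemma running_max_Cb:
  assumes "\<And>i. a i \<in> Cb" "\<And>i. d i \<in> Cb"
  shows "running_max a d m \<in> Cb"
proof (induction m)
  case 0
  have "running_max a d 0 = (\<lambda>_. 0)" by (rule ext) simp
  then show ?case by (simp add: Cb_const)
next
  case (Suc m)
  have "running_max a d (Suc m) = (\<lambda>p. max (running_max a d m p) (a m (fst p) - d m (snd p)))" by (rule ext) simp
  also have "\<dots> \<in> Cb"
    by (intro Cb_max Suc Cb_diff Cb_compose[OF assms(1)] Cb_compose[OF assms(2)] continuous_intros)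
  finally show ?case .
qed

lemma running_max_borel:
  fixes a :: "nat \<Rightarrow> 'b::second_countable_topology \<Rightarrow> real"
  assumes "\<And>i. a i \<in> borel_measurable borel" "\<And>i. d i \<in> borel_measurable borel"
  shows "running_max a d m \<in> borel_measurable borel"
proof (induction m)
  case 0
  have "running_max a d 0 = (\<lambda>_. 0)" by (rule ext) simp
  then show ?case by simp
next
  case (Suc m)
  have fs: "(fst :: 'b \<times> 'b \<Rightarrow> 'b) \<in> borel_measurable borel" "(snd :: 'b \<times> 'b \<Rightarrow> 'b) \<in> borel_measurable borel"
    by (intro borel_measurable_continuous_onI continuous_intros)+
  have "running_max a d (Suc m) = (\<lambda>p. max (running_max a d m p) (a m (fst p) - d m (snd p)))" by (rule ext) simp
  also have "\<dots> \<in> borel_measurable borel"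
    by (intro borel_measurable_max Suc borel_measurable_diff measurable_compose[OF fs(1) assms(1)]
        measurable_compose[OF fs(2) assms(2)])
  finally show ?case .
qed

lemma running_max_tendsto:
  assumes "\<And>i. (\<lambda>k. a k i (fst p)) \<longlonglongrightarrow> a' i (fst p)"
  shows "(\<lambda>k. running_max (a k) d m p) \<longlonglongrightarrow> running_max a' d m p"
  by (induction m) (auto intro!: tendsto_intros assms)

lemma running_max_bound:
  assumes "\<And>i x. \<bar>a i x\<bar> \<le> b i" "\<And>i x. \<bar>d i x\<bar> \<le> b i"
  shows "\<bar>running_max a d m p\<bar> \<le> (\<Sum>i<m. 2 * b i)"
proof -
  have b: "0 \<le> b i" for i using order_trans[OF abs_ge_zero assms(1)] .
  have "running_max a d m p \<le> (\<Sum>i<m. 2 * b i)"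
    unfolding running_max_le_iff
  proof (intro conjI allI impI)
    show "0 \<le> (\<Sum>i<m. 2 * b i)" using b by (intro sum_nonneg) auto
    fix i assume "i < m"
    have "a i (fst p) - d i (snd p) \<le> 2 * b i" using assms(1)[of i "fst p"] assms(2)[of i "snd p"] by linarith
    also have "\<dots> \<le> (\<Sum>i<m. 2 * b i)" using \<open>i < m\<close> b by (intro member_le_sum) auto
    finally show "a i (fst p) - d i (snd p) \<le> (\<Sum>i<m. 2 * b i)" .
  qed
  then show ?thesis using running_max_nonneg[of a d m p] by simp
qed

lemma cutoff_tendsto_zero:
  assumes "\<nu> \<in> prob_measures"
  shows "(\<lambda>R :: nat. \<integral>x. cutoff (real R) x \<partial>\<nu>) \<longlonglongrightarrow> 0"
proof -
  interpret prob_space \<nu> using assms by (rule prob_measuresD)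
  have "(\<lambda>R :: nat. cutoff (real R) x) \<longlonglongrightarrow> 0" for x :: 'a
  proof -
    obtain R0 :: nat where "norm x \<le> real R0" using real_arch_simple by blast
    then have "cutoff (real R) x = 0" if "R \<ge> R0" for R using that by (simp add: cutoff_def)
    then show ?thesis by (intro tendsto_eventually eventually_sequentiallyI[of R0])
  qed
  then have "(\<lambda>R :: nat. \<integral>x. cutoff (real R) x \<partial>\<nu>) \<longlonglongrightarrow> (\<integral>x. 0 \<partial>\<nu>)"
    using Cb_borel[OF cutoff_Cb]
    by (intro integral_dominated_convergence[where w="\<lambda>_. 1"])
       (auto simp: prob_measuresD[OF assms] cutoff_bounds)
  then show ?thesis by simp
qed

lemma measure_pair_cball_ge_cutoff:
  fixes M :: "('a::euclidean_space \<times> 'a) measure"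
  assumes M: "M \<in> prob_measures"
  shows "1 - (\<integral>p. cutoff R (fst p) \<partial>M) - (\<integral>p. cutoff R (snd p) \<partial>M) \<le> measure M (cball 0 (2 * (R + 1)))"
proof -
  interpret prob_space M using M by (rule prob_measuresD)
  have c: "(\<lambda>p. cutoff R (fst p)) \<in> Cb" "(\<lambda>p. cutoff R (snd p)) \<in> Cb"
    by (intro Cb_compose[OF cutoff_Cb] continuous_intros)+
  have "(\<integral>p. 1 - cutoff R (fst p) - cutoff R (snd p) \<partial>M) \<le> (\<integral>p. indicator (cball 0 (2 * (R + 1))) p \<partial>M)"
  proof (rule integral_mono_bounded[OF M])
    show "integrable M (\<lambda>p. 1 - cutoff R (fst p) - cutoff R (snd p))"
      by (intro Cb_integrable[OF M] Cb_diff Cb_const c)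
    show "integrable M (\<lambda>p. indicator (cball 0 (2 * (R + 1))) p :: real)"
      by (rule integrable_bounded[OF M borel_measurable_indicator[OF borel_closed[OF closed_cball]], where B=1]) simp
    fix p :: "'a \<times> 'a"
    show "1 - cutoff R (fst p) - cutoff R (snd p) \<le> indicator (cball 0 (2 * (R + 1))) p"
    proof (cases "norm (fst p) \<le> R + 1 \<and> norm (snd p) \<le> R + 1")
      case True
      then have "norm p \<le> 2 * (R + 1)" using norm_Pair_le[of "fst p" "snd p"] by simp
      then show ?thesis using cutoff_bounds[of R "fst p"] cutoff_bounds[of R "snd p"] by (simp add: indicator_def)
    next
      case False
      then have "cutoff R (fst p) = 1 \<or> cutoff R (snd p) = 1" by (auto simp: cutoff_def)
      then have "1 - cutoff R (fst p) - cutoff R (snd p) \<le> 0"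
        using cutoff_bounds[of R "fst p"] cutoff_bounds[of R "snd p"] by auto
      then show ?thesis by (rule order_trans) simp
    qed
  qed
  moreover have "measure M UNIV = 1" using prob_space unfolding prob_measuresD(3)[OF M] .
  ultimately show ?thesis
    using Cb_integrable[OF M c(1)] Cb_integrable[OF M c(2)] by (simp add: prob_measuresD[OF M])
qed

context feller_LDP
begin

text \<open>Combines \<open>cost_dual_less\<close> with increasing approximation, so that a
  countable family represents the cost. Joint measurability and monotone convergence for
  \<open>c\<close> both come from this formula.\<close>

lemma cost_eq_SUP_running_max:
  assumes d: "\<And>i. d i \<in> Cb"
    and dense: "\<forall>f\<in>Cb. bounded_increasing_limit (range d) f"
  shows "c (fst p) (snd p) = (SUP m. ennreal (running_max (\<lambda>i. S (d i)) d m p))"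
proof (rule antisym)
  show "(SUP m. ennreal (running_max (\<lambda>i. S (d i)) d m p)) \<le> c (fst p) (snd p)"
  proof (rule SUP_least)
    fix m
    show "ennreal (running_max (\<lambda>i. S (d i)) d m p) \<le> c (fst p) (snd p)"
      by (rule running_max_cases[of "\<lambda>i. S (d i)" d m p]) (simp_all add: cost_dual_le[OF d])
  qed
  show "c (fst p) (snd p) \<le> (SUP m. ennreal (running_max (\<lambda>i. S (d i)) d m p))"
  proof (rule dense_le)
    fix t assume "t < c (fst p) (snd p)"
    then obtain f where f: "f \<in> Cb" "t < ennreal (S f (fst p) - f (snd p))" by (rule cost_dual_less)
    from bspec[OF dense f(1)] obtain g B where g: "range g \<subseteq> range d" and B: "\<And>j x. \<bar>g j x\<bar> \<le> B"
      and inc: "\<And>x. incseq (\<lambda>j. g j x)" and lim: "\<And>x. (\<lambda>j::nat. g j x) \<longlonglongrightarrow> f x" by blast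
    have gr: "g j \<in> range d" for j using g by blast
    have gC: "g j \<in> Cb" for j using gr[of j] d by (elim rangeE) simp
    have "(\<lambda>j. ennreal (S (g j) (fst p) - g j (snd p))) \<longlonglongrightarrow> ennreal (S f (fst p) - f (snd p))"
      by (intro tendsto_ennrealI tendsto_diff S_tendsto_increasing[OF gC f(1) B inc lim] lim)
    from order_tendstoD(1)[OF this f(2)] obtain j where j: "t < ennreal (S (g j) (fst p) - g j (snd p))"
      by (auto dest: eventually_happens)
    obtain i where i: "g j = d i" using gr[of j] by blast
    have "t \<le> ennreal (running_max (\<lambda>i. S (d i)) d (Suc i) p)"
      using j unfolding i by (intro order_trans[OF less_imp_le[OF j[unfolded i]]] ennreal_leI) simp
    also have "\<dots> \<le> (SUP m. ennreal (running_max (\<lambda>i. S (d i)) d m p))" by (rule SUP_upper) simp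
    finally show "t \<le> (SUP m. ennreal (running_max (\<lambda>i. S (d i)) d m p))" .
  qed
qed

text \<open>Gibbs' variational inequality, with \<open>exp\<close> of a finite maximum bounded by the sum of the
  exponentials.\<close>

lemma tilt_running_max_le:
  assumes d: "\<And>i. d i \<in> Cb" and a: "\<And>i. a i \<in> Cb" and f: "f \<in> Cb" and k: "k > 0"
  shows "tilt k f (\<lambda>y. running_max a d m (x, y)) x
    \<le> G k f x - tilt k f f x + (ln (real m + 1) / real k + (\<Sum>i<m. \<bar>a i x - G k (d i) x\<bar>))"
proof -
  let ?F = "\<lambda>y. running_max a d m (x, y)" and ?h = "\<Sum>i<m. \<bar>a i x - G k (d i) x\<bar>"
  have F: "?F \<in> Cb" by (rule Cb_compose[OF running_max_Cb[OF a d]]) (intro continuous_intros)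
  have "Z k (\<lambda>y. - ?F y) x \<le> (\<integral>y. 1 + (\<Sum>i<m. exp (real k * a i x) * exp (- (real k * d i y))) \<partial>P k x)"
    unfolding Z_def
  proof (rule integral_mono_bounded[OF P_prob])
    show "integrable (P k x) (\<lambda>y. exp (- (real k * - ?F y)))"
      by (intro Cb_integrable[OF P_prob] Cb_tilt Cb_uminus F)
    show "integrable (P k x) (\<lambda>y. 1 + (\<Sum>i<m. exp (real k * a i x) * exp (- (real k * d i y))))"
      by (intro Cb_integrable[OF P_prob] Cb_add Cb_const Cb_sum Cb_cmult Cb_tilt d)
    fix y
    show "exp (- (real k * - ?F y)) \<le> 1 + (\<Sum>i<m. exp (real k * a i x) * exp (- (real k * d i y)))"
    proof (rule running_max_cases[of a d m "(x, y)"])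
      assume "?F y = 0"
      then show ?thesis by (simp add: sum_nonneg)
    next
      fix i assume i: "i < m" "?F y = a i (fst (x, y)) - d i (snd (x, y))"
      have "exp (- (real k * - ?F y)) = exp (real k * a i x) * exp (- (real k * d i y))"
        unfolding i(2) by (simp add: exp_add[symmetric] algebra_simps)
      also have "\<dots> \<le> (\<Sum>i<m. exp (real k * a i x) * exp (- (real k * d i y)))"
        using i(1) by (intro member_le_sum[of i "{..<m}" "\<lambda>i. exp (real k * a i x) * exp (- (real k * d i y))"]) auto
      finally show ?thesis by simp
    qed
  qed
  also have "\<dots> = 1 + (\<Sum>i<m. exp (real k * a i x) * Z k (d i) x)"
  proof -
    interpret p: prob_space "P k x" using P_prob by (rule prob_measuresD)
    have 1: "integrable (P k x) (\<lambda>y. exp (real k * a i x) * exp (- (real k * d i y)))" for i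
      by (intro integrable_mult_right Cb_integrable[OF P_prob] Cb_tilt d)
    then show ?thesis
      by (subst Bochner_Integration.integral_add)
         (simp_all add: Bochner_Integration.integral_sum p.prob_space Z_def)
  qed
  \<comment> \<open>For \<open>a i = G k (d i)\<close> every term of the sum would be exactly 1;
    \<open>?h\<close> pays for the difference between \<open>a i\<close> and
    \<open>G k (d i)\<close>.\<close>
  also have "\<dots> \<le> exp (real k * ?h) + (\<Sum>i<m. exp (real k * ?h))"
  proof (intro add_mono sum_mono)
    have h: "0 \<le> ?h" by (intro sum_nonneg) auto
    then show "1 \<le> exp (real k * ?h)" by (simp add: mult_nonneg_nonneg)
    fix i assume "i \<in> {..<m}"
    then have "a i x - G k (d i) x \<le> ?h"
      using member_le_sum[of i "{..<m}" "\<lambda>i. \<bar>a i x - G k (d i) x\<bar>"] by auto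
    then have "real k * (a i x - G k (d i) x) \<le> real k * ?h" by (intro mult_left_mono) auto
    then show "exp (real k * a i x) * Z k (d i) x \<le> exp (real k * ?h)"
      by (simp add: exp_G[OF d k, symmetric] exp_add[symmetric] right_diff_distrib)
  qed
  also have "\<dots> = (real m + 1) * exp (real k * ?h)" by (simp add: algebra_simps)
  also have "\<dots> = exp (- (real k * - (ln (real m + 1) / real k + ?h)))"
  proof -
    have "- (real k * - (ln (real m + 1) / real k + ?h)) = ln (real m + 1) + real k * ?h"
      unfolding mult_minus_right minus_minus using k by (simp add: distrib_left)
    then show ?thesis by (simp only: exp_add) simp
  qed
  finally have "- (ln (real m + 1) / real k + ?h) \<le> G k (\<lambda>y. - ?F y) x"
    using G_ge_iff[OF Cb_uminus[OF F] k] by blast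
  with tilt_le_entropy[OF f F k, of x] show ?thesis by linarith
qed

text \<open>The attainment half of duality. Tilted joint laws have first marginal \<mu> exactly,
  second marginal \<nu> asymptotically, and entropic cost asymptotically at most \<open>t\<close>; a
  narrow limit point is the coupling.\<close>

lemma coupling_of_dual_bound:
  assumes \<nu>: "\<nu> \<in> prob_measures"
    and dual: "\<And>f. f \<in> Cb \<Longrightarrow> dual \<nu> f \<le> t"
  obtains \<rho> where "\<rho> \<in> couplings \<mu> \<nu>" "(\<integral>\<^sup>+ p. c (fst p) (snd p) \<partial>\<rho>) \<le> ennreal t"
proof -
  interpret nu: prob_space \<nu> using \<nu> by (rule prob_measuresD)
  obtain D0 :: "('a \<Rightarrow> real) set" where D0: "countable D0" "D0 \<subseteq> Cb"
    and dense0: "\<forall>f\<in>Cb. bounded_increasing_limit D0 f"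
    by (rule Cb_countable_monotone_dense)
  \<comment> \<open>Second marginals are only controlled on the enumerated functions, so the cutoffs
    are added to read tightness off that control.\<close>
  define D where "D = D0 \<union> range (\<lambda>R :: nat. cutoff (real R))"
  have D: "countable D" "D \<subseteq> Cb" "D \<noteq> {}"
    using D0 cutoff_Cb unfolding D_def by (simp, blast, blast)
  define d where "d = from_nat_into D"
  have rd: "range d = D" unfolding d_def by (rule range_from_nat_into[OF D(3,1)])
  then have dC: "d i \<in> Cb" for i using D by blast
  have dense: "\<forall>f\<in>Cb. bounded_increasing_limit (range d) f"
  proof
    fix f :: "'a \<Rightarrow> real" assume "f \<in> Cb"
    have "D0 \<subseteq> range d" unfolding rd D_def by blast
    with bspec[OF dense0 \<open>f \<in> Cb\<close>] show "bounded_increasing_limit (range d) f" by (elim ex_forward conj_forward) auto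
  qed
  \<comment> \<open>The condition \<open>j < k\<close> sends the levels \<open>kk j\<close> to
    infinity, so that \<open>ln (m + 1) / k\<close> disappears and \<open>G\<close> approaches
    \<open>S\<close>.\<close>
  let ?Q = "\<lambda>j k f. j < k \<and> f \<in> Cb \<and>
    (\<forall>i<j. \<bar>(\<integral>x. tilt k f (d i) x \<partial>\<mu>) - (\<integral>y. d i y \<partial>\<nu>)\<bar> \<le> 1 / real (Suc j)) \<and>
    (\<integral>x. G k f x \<partial>\<mu>) - (\<integral>x. tilt k f f x \<partial>\<mu>) \<le> t + 1 / real (Suc j)"
  have "\<exists>k f. ?Q j k f" for j
  proof -
    have "\<forall>\<^sub>F k in sequentially. \<exists>f\<in>Cb. (\<forall>i<j. \<bar>(\<integral>x. tilt k f (d i) x \<partial>\<mu>) - (\<integral>y. d i y \<partial>\<nu>)\<bar> \<le> 1 / real (Suc j)) \<and>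
      (\<integral>x. G k f x \<partial>\<mu>) - (\<integral>x. tilt k f f x \<partial>\<mu>) \<le> t + 1 / real (Suc j)"
      by (rule tilt_recovery[OF \<nu> dC dual]) auto
    then have "\<forall>\<^sub>F k in sequentially. \<exists>f. ?Q j k f"
      using eventually_gt_at_top[of j] by eventually_elim blast
    then show ?thesis by (auto dest: eventually_happens)
  qed
  then obtain kk ff where Q: "\<And>j. ?Q j (kk j) (ff j)" by metis
  have kk: "j < kk j" and ff: "ff j \<in> Cb"
    and near: "i < j \<Longrightarrow> \<bar>(\<integral>x. tilt (kk j) (ff j) (d i) x \<partial>\<mu>) - (\<integral>y. d i y \<partial>\<nu>)\<bar> \<le> 1 / real (Suc j)"
    and ent: "(\<integral>x. G (kk j) (ff j) x \<partial>\<mu>) - (\<integral>x. tilt (kk j) (ff j) (ff j) x \<partial>\<mu>) \<le> t + 1 / real (Suc j)" for i j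
    using Q[of j] by auto
  define \<rho> where "\<rho> j = tilted_joint (kk j) (ff j)" for j
  have \<rho>: "\<rho> j \<in> prob_measures" for j unfolding \<rho>_def by (rule tilted_joint_prob[OF ff])
  have cont: "continuous_on UNIV (fst :: 'a \<times> 'a \<Rightarrow> 'a)" "continuous_on UNIV (snd :: 'a \<times> 'a \<Rightarrow> 'a)"
    by (intro continuous_intros)+
  have fst_int: "(\<integral>p. g (fst p) \<partial>\<rho> j) = (\<integral>x. g x \<partial>\<mu>)" if g: "g \<in> Cb" for g j
    unfolding \<rho>_def using tilted_joint_integral(1)[OF ff Cb_compose[OF g cont(1)]] by (simp add: tilt_const[OF ff])
  have snd_int: "(\<integral>p. g (snd p) \<partial>\<rho> j) = (\<integral>x. tilt (kk j) (ff j) g x \<partial>\<mu>)" if g: "g \<in> Cb" for g j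
    unfolding \<rho>_def using tilted_joint_integral(1)[OF ff Cb_compose[OF g cont(2)]] by simp
  have inv_lim: "(\<lambda>j. 1 / real (Suc j)) \<longlonglongrightarrow> 0" using LIMSEQ_inverse_real_of_nat by (simp add: inverse_eq_divide)
  have snd_lim: "(\<lambda>j. \<integral>p. d i (snd p) \<partial>\<rho> j) \<longlonglongrightarrow> (\<integral>y. d i y \<partial>\<nu>)" for i
  proof (rule LIM_zero_cancel, rule Lim_null_comparison[OF _ inv_lim])
    show "\<forall>\<^sub>F j in sequentially. norm ((\<integral>p. d i (snd p) \<partial>\<rho> j) - (\<integral>y. d i y \<partial>\<nu>)) \<le> 1 / real (Suc j)"
      using eventually_gt_at_top[of i] by eventually_elim (simp only: snd_int[OF dC] real_norm_def near)
  qed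
  have tight: "\<exists>R. \<forall>\<^sub>F j in sequentially. 1 - \<epsilon> \<le> measure (\<rho> j) (cball 0 R)" if \<epsilon>: "\<epsilon> > 0" for \<epsilon>
  proof -
    have "\<forall>\<^sub>F R :: nat in sequentially. (\<integral>x. cutoff (real R) x \<partial>\<mu>) < \<epsilon> / 2 \<and> (\<integral>x. cutoff (real R) x \<partial>\<nu>) < \<epsilon> / 2"
      using \<epsilon> by (intro eventually_conj order_tendstoD(2)[OF cutoff_tendsto_zero] mu \<nu>) auto
    then obtain R :: nat where R: "(\<integral>x. cutoff (real R) x \<partial>\<mu>) < \<epsilon> / 2" "(\<integral>x. cutoff (real R) x \<partial>\<nu>) < \<epsilon> / 2"
      by (auto dest: eventually_happens)
    have "cutoff (real R) \<in> range d" unfolding rd D_def by blast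
    then obtain i where i: "d i = cutoff (real R)" by auto
    have "\<forall>\<^sub>F j in sequentially. (\<integral>p. cutoff (real R) (snd p) \<partial>\<rho> j) < \<epsilon> / 2"
      using snd_lim[of i] R(2) unfolding i by (intro order_tendstoD(2))
    then have "\<forall>\<^sub>F j in sequentially. 1 - \<epsilon> \<le> measure (\<rho> j) (cball 0 (2 * (real R + 1)))"
    proof eventually_elim
      case (elim j)
      then show ?case
        using measure_pair_cball_ge_cutoff[OF \<rho>[of j], of "real R"] R(1) fst_int[OF cutoff_Cb[of "real R"], of j] by linarith
    qed
    then show ?thesis by blast
  qed
  from prokhorov[OF \<rho> tight] obtain r M where r: "strict_mono r" and M: "M \<in> prob_measures"
    and conv: "narrow_conv (\<lambda>j. \<rho> (r j)) M" .
  interpret M: prob_space M using M by (rule prob_measuresD)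
  have Mlim: "(\<lambda>j. \<integral>p. F p \<partial>\<rho> (r j)) \<longlonglongrightarrow> (\<integral>p. F p \<partial>M)" if "F \<in> Cb" for F
    using conv that by (simp add: narrow_conv_def)
  have fm: "fst \<in> borel_measurable (borel :: ('a \<times> 'a) measure)" and sm: "snd \<in> borel_measurable (borel :: ('a \<times> 'a) measure)"
    using cont by (auto intro: borel_measurable_continuous_onI)
  have fstM: "distr M borel fst = \<mu>"
  proof (rule prob_measures_eqI[OF prob_measures_distr[OF M fm] mu])
    fix g :: "'a \<Rightarrow> real" assume g: "g \<in> Cb"
    have "(\<integral>p. g (fst p) \<partial>M) = (\<integral>x. g x \<partial>\<mu>)"
      using Mlim[OF Cb_compose[OF g cont(1)]] by (simp add: fst_int[OF g] LIMSEQ_const_iff)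
    then show "(\<integral>x. g x \<partial>distr M borel fst) = (\<integral>x. g x \<partial>\<mu>)"
      using fm Cb_borel[OF g] by (subst integral_distr) (auto simp: prob_measuresD[OF M])
  qed
  have sndD: "(\<integral>p. d i (snd p) \<partial>M) = (\<integral>y. d i y \<partial>\<nu>)" for i
    by (rule LIMSEQ_unique[OF Mlim[OF Cb_compose[OF dC cont(2)]]])
       (use LIMSEQ_subseq_LIMSEQ[OF snd_lim r] in \<open>simp add: comp_def\<close>)
  \<comment> \<open>The second marginal agrees with \<nu> on the enumeration only; bounded
    increasing limits extend this to all test functions.\<close>
  have sndM: "distr M borel snd = \<nu>"
  proof (rule prob_measures_eqI[OF prob_measures_distr[OF M sm] \<nu>])
    fix f :: "'a \<Rightarrow> real" assume f: "f \<in> Cb"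
    from bspec[OF dense f] obtain g B where g: "range g \<subseteq> range d" and B: "\<And>j x. \<bar>g j x\<bar> \<le> B"
      and lim: "\<And>x. (\<lambda>j::nat. g j x) \<longlonglongrightarrow> f x" by blast
    have gr: "g j \<in> range d" for j using g by blast
    have gC: "g j \<in> Cb" for j using gr[of j] dC by (elim rangeE) simp
    have eq: "(\<integral>p. g j (snd p) \<partial>M) = (\<integral>y. g j y \<partial>\<nu>)" for j using gr[of j] sndD by auto
    have "(\<lambda>j. \<integral>p. g j (snd p) \<partial>M) \<longlonglongrightarrow> (\<integral>p. f (snd p) \<partial>M)"
      using lim B Cb_borel[OF Cb_compose[OF gC cont(2)]] Cb_borel[OF Cb_compose[OF f cont(2)]]
      by (intro integral_dominated_convergence[where w="\<lambda>_. B"]) (auto simp: prob_measuresD[OF M])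
    moreover have "(\<lambda>j. \<integral>y. g j y \<partial>\<nu>) \<longlonglongrightarrow> (\<integral>y. f y \<partial>\<nu>)"
      using lim B Cb_borel[OF gC] Cb_borel[OF f]
      by (intro integral_dominated_convergence[where w="\<lambda>_. B"]) (auto simp: prob_measuresD[OF \<nu>])
    ultimately have "(\<integral>p. f (snd p) \<partial>M) = (\<integral>y. f y \<partial>\<nu>)" unfolding eq by (rule LIMSEQ_unique)
    then show "(\<integral>x. f x \<partial>distr M borel snd) = (\<integral>x. f x \<partial>\<nu>)"
      using sm Cb_borel[OF f] by (subst integral_distr) (auto simp: prob_measuresD[OF M])
  qed
  have "\<exists>b. \<forall>x. \<bar>d i x\<bar> \<le> b" for i using Cb_D(2)[OF dC[of i]] by blast
  then obtain b where b: "\<And>i x. \<bar>d i x\<bar> \<le> b i" by metis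
  \<comment> \<open>\<open>S (d i)\<close> need not be continuous, so narrow convergence cannot be
    applied to it. A frozen level \<open>k0\<close> supplies a continuous substitute, at the price
    of its distance from \<open>S (d i)\<close> in mean.\<close>
  have step: "(\<integral>p. running_max (\<lambda>i. G k0 (d i)) d m p \<partial>M) \<le> t + (\<Sum>i<m. \<integral>x. \<bar>G k0 (d i) x - S (d i) x\<bar> \<partial>\<mu>)" for k0 m
  proof -
    let ?F = "running_max (\<lambda>i. G k0 (d i)) d m"
    let ?e = "\<lambda>j. t + 1 / real (Suc j) + (ln (real m + 1) / real (kk j) + (\<Sum>i<m. \<integral>x. \<bar>G k0 (d i) x - G (kk j) (d i) x\<bar> \<partial>\<mu>))"
    have F: "?F \<in> Cb" by (intro running_max_Cb G_Cb dC)
    have le: "(\<integral>p. ?F p \<partial>\<rho> j) \<le> ?e j" for j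
    proof -
      have iG: "integrable \<mu> (\<lambda>x. \<bar>G k0 (d i) x - G (kk j) (d i) x\<bar>)" for i
        by (intro integrable_abs Cb_integrable[OF mu] Cb_diff G_Cb dC)
      have i2: "integrable \<mu> (G (kk j) (ff j))" "integrable \<mu> (tilt (kk j) (ff j) (ff j))"
        by (intro Cb_integrable[OF mu] G_Cb tilt_Cb ff)+
      have "(\<integral>p. ?F p \<partial>\<rho> j) = (\<integral>x. tilt (kk j) (ff j) (\<lambda>y. ?F (x, y)) x \<partial>\<mu>)"
        unfolding \<rho>_def by (rule tilted_joint_integral(1)[OF ff F])
      also have "\<dots> \<le> (\<integral>x. G (kk j) (ff j) x - tilt (kk j) (ff j) (ff j) x
          + (ln (real m + 1) / real (kk j) + (\<Sum>i<m. \<bar>G k0 (d i) x - G (kk j) (d i) x\<bar>)) \<partial>\<mu>)"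
      proof (rule integral_mono_bounded[OF mu tilted_joint_integral(2)[OF ff F]])
        show "integrable \<mu> (\<lambda>x. G (kk j) (ff j) x - tilt (kk j) (ff j) (ff j) x
          + (ln (real m + 1) / real (kk j) + (\<Sum>i<m. \<bar>G k0 (d i) x - G (kk j) (d i) x\<bar>)))"
          using i2 iG by (intro Bochner_Integration.integrable_add Bochner_Integration.integrable_diff
              Bochner_Integration.integrable_sum) auto
        have "0 < kk j" using kk[of j] by simp
        then show "tilt (kk j) (ff j) (\<lambda>y. ?F (x, y)) x \<le> G (kk j) (ff j) x - tilt (kk j) (ff j) (ff j) x
          + (ln (real m + 1) / real (kk j) + (\<Sum>i<m. \<bar>G k0 (d i) x - G (kk j) (d i) x\<bar>))" for x
          by (intro tilt_running_max_le dC G_Cb ff)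
      qed
      also have "\<dots> = (\<integral>x. G (kk j) (ff j) x \<partial>\<mu>) - (\<integral>x. tilt (kk j) (ff j) (ff j) x \<partial>\<mu>)
          + (ln (real m + 1) / real (kk j) + (\<Sum>i<m. \<integral>x. \<bar>G k0 (d i) x - G (kk j) (d i) x\<bar> \<partial>\<mu>))"
        using i2 iG by (simp add: Bochner_Integration.integral_sum mu.prob_space)
      also have "\<dots> \<le> ?e j" using ent[of j] by simp
      finally show ?thesis .
    qed
    have kinf: "filterlim kk at_top sequentially"
      by (rule filterlim_at_top_mono[OF filterlim_ident]) (use kk in \<open>auto intro: always_eventually less_imp_le\<close>)
    have "(\<lambda>k. \<integral>x. \<bar>G k0 (d i) x - G k (d i) x\<bar> \<partial>\<mu>) \<longlonglongrightarrow> (\<integral>x. \<bar>G k0 (d i) x - S (d i) x\<bar> \<partial>\<mu>)" for i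
    proof (rule integral_dominated_convergence[where w="\<lambda>_. b i + b i"])
      show "(\<lambda>x. \<bar>G k0 (d i) x - S (d i) x\<bar>) \<in> borel_measurable \<mu>"
        "(\<lambda>x. \<bar>G k0 (d i) x - G k (d i) x\<bar>) \<in> borel_measurable \<mu>" for k
        using S_borel[OF dC[of i]] Cb_borel[OF G_Cb[OF dC[of i]]] by (auto simp: prob_measuresD[OF mu])
      have "\<bar>G k0 (d i) x - G k (d i) x\<bar> \<le> b i + b i" for k x
        using G_bound[OF dC b, of k0 i x] G_bound[OF dC b, of k i x] by linarith
      then show "AE x in \<mu>. norm \<bar>G k0 (d i) x - G k (d i) x\<bar> \<le> b i + b i" for k by simp
      show "AE x in \<mu>. (\<lambda>k. \<bar>G k0 (d i) x - G k (d i) x\<bar>) \<longlonglongrightarrow> \<bar>G k0 (d i) x - S (d i) x\<bar>"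
        by (intro AE_I2 tendsto_intros varadhan dC)
    qed simp
    then have "(\<lambda>j. \<integral>x. \<bar>G k0 (d i) x - G (kk j) (d i) x\<bar> \<partial>\<mu>) \<longlonglongrightarrow> (\<integral>x. \<bar>G k0 (d i) x - S (d i) x\<bar> \<partial>\<mu>)" for i
      by (rule filterlim_compose[OF _ kinf])
    moreover have "(\<lambda>j. ln (real m + 1) / real (kk j)) \<longlonglongrightarrow> 0"
      by (rule filterlim_compose[OF lim_const_over_n kinf])
    ultimately have "?e \<longlonglongrightarrow> t + 0 + (0 + (\<Sum>i<m. \<integral>x. \<bar>G k0 (d i) x - S (d i) x\<bar> \<partial>\<mu>))"
      by (intro tendsto_add tendsto_const inv_lim tendsto_sum)
    from LIMSEQ_subseq_LIMSEQ[OF this r]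
    have "(\<lambda>j. ?e (r j)) \<longlonglongrightarrow> t + (\<Sum>i<m. \<integral>x. \<bar>G k0 (d i) x - S (d i) x\<bar> \<partial>\<mu>)" by (simp add: comp_def)
    with Mlim[OF F] show ?thesis by (rule LIMSEQ_le) (use le in blast)
  qed
  have S_step: "(\<integral>p. running_max (\<lambda>i. S (d i)) d m p \<partial>M) \<le> t" for m
  proof -
    have "(\<lambda>k0. \<integral>p. running_max (\<lambda>i. G k0 (d i)) d m p \<partial>M) \<longlonglongrightarrow> (\<integral>p. running_max (\<lambda>i. S (d i)) d m p \<partial>M)"
    proof (rule integral_dominated_convergence[where w="\<lambda>_. \<Sum>i<m. 2 * b i"])
      show "running_max (\<lambda>i. S (d i)) d m \<in> borel_measurable M"
        "running_max (\<lambda>i. G k0 (d i)) d m \<in> borel_measurable M" for k0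
        unfolding prob_measuresD[OF M] by (intro running_max_borel S_borel dC Cb_borel G_Cb)+
      show "AE p in M. norm (running_max (\<lambda>i. G k0 (d i)) d m p) \<le> (\<Sum>i<m. 2 * b i)" for k0
        using running_max_bound[of "\<lambda>i. G k0 (d i)" b d m] G_bound[OF dC b] b by simp
      show "AE p in M. (\<lambda>k0. running_max (\<lambda>i. G k0 (d i)) d m p) \<longlonglongrightarrow> running_max (\<lambda>i. S (d i)) d m p"
        by (intro AE_I2 running_max_tendsto varadhan dC)
    qed simp
    \<comment> \<open>The limit is written with \<open>S (d i) x - S (d i) x\<close> to match the
      integrands of dominated convergence; it is zero.\<close>
    moreover have "(\<lambda>k0. t + (\<Sum>i<m. \<integral>x. \<bar>G k0 (d i) x - S (d i) x\<bar> \<partial>\<mu>)) \<longlonglongrightarrow> t + (\<Sum>i<m. \<integral>x. \<bar>S (d i) x - S (d i) x\<bar> \<partial>\<mu>)"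
    proof (intro tendsto_add tendsto_const tendsto_sum integral_dominated_convergence[where w="\<lambda>_. b _ + b _"])
      fix i
      show "(\<lambda>x. \<bar>S (d i) x - S (d i) x\<bar>) \<in> borel_measurable \<mu>"
        "(\<lambda>x. \<bar>G k0 (d i) x - S (d i) x\<bar>) \<in> borel_measurable \<mu>" for k0
        using S_borel[OF dC[of i]] Cb_borel[OF G_Cb[OF dC[of i]]] by (auto simp: prob_measuresD[OF mu])
      have "\<bar>G k0 (d i) x - S (d i) x\<bar> \<le> b i + b i" for k0 x
        using G_bound[OF dC b, of k0 i x] S_bound[OF dC b, of i x] by linarith
      then show "AE x in \<mu>. norm \<bar>G k0 (d i) x - S (d i) x\<bar> \<le> b i + b i" for k0 by simp
      show "AE x in \<mu>. (\<lambda>k0. \<bar>G k0 (d i) x - S (d i) x\<bar>) \<longlonglongrightarrow> \<bar>S (d i) x - S (d i) x\<bar>"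
        by (intro AE_I2 tendsto_intros varadhan dC)
    qed simp_all
    ultimately have "(\<integral>p. running_max (\<lambda>i. S (d i)) d m p \<partial>M) \<le> t + (\<Sum>i<m. \<integral>x. \<bar>S (d i) x - S (d i) x\<bar> \<partial>\<mu>)"
      by (rule LIMSEQ_le) (use step in blast)
    then show ?thesis by simp
  qed
  have "(\<integral>\<^sup>+ p. c (fst p) (snd p) \<partial>M) = (\<integral>\<^sup>+ p. (SUP m. ennreal (running_max (\<lambda>i. S (d i)) d m p)) \<partial>M)"
    by (simp only: cost_eq_SUP_running_max[OF dC dense])
  also have "\<dots> = (SUP m. \<integral>\<^sup>+ p. ennreal (running_max (\<lambda>i. S (d i)) d m p) \<partial>M)"
  proof (rule nn_integral_monotone_convergence_SUP)
    show "incseq (\<lambda>m p. ennreal (running_max (\<lambda>i. S (d i)) d m p))"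
      by (intro incseq_SucI le_funI ennreal_leI) simp
    have "running_max (\<lambda>i. S (d i)) d m \<in> borel_measurable M" for m
      unfolding prob_measuresD[OF M] by (intro running_max_borel S_borel dC Cb_borel)
    then show "(\<lambda>p. ennreal (running_max (\<lambda>i. S (d i)) d m p)) \<in> borel_measurable M" for m by simp
  qed
  also have "\<dots> \<le> ennreal t"
  proof (rule SUP_least)
    fix m
    have "integrable M (running_max (\<lambda>i. S (d i)) d m)"
      using running_max_bound[of "\<lambda>i. S (d i)" b d m] S_bound[OF dC b] b
      by (intro integrable_bounded[OF M running_max_borel, where B="\<Sum>i<m. 2 * b i"] S_borel dC Cb_borel) auto
    then have "(\<integral>\<^sup>+ p. ennreal (running_max (\<lambda>i. S (d i)) d m p) \<partial>M) = ennreal (\<integral>p. running_max (\<lambda>i. S (d i)) d m p \<partial>M)"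
      by (rule nn_integral_eq_integral) (simp add: running_max_nonneg)
    also have "\<dots> \<le> ennreal t" by (rule ennreal_leI[OF S_step])
    finally show "(\<integral>\<^sup>+ p. ennreal (running_max (\<lambda>i. S (d i)) d m p) \<partial>M) \<le> ennreal t" .
  qed
  finally have "(\<integral>\<^sup>+ p. c (fst p) (snd p) \<partial>M) \<le> ennreal t" .
  moreover have "M \<in> couplings \<mu> \<nu>"
    using fstM sndM M.prob_space_axioms prob_measuresD(2)[OF M] by (simp add: couplings_def)
  ultimately show ?thesis by (rule that[rotated])
qed

text \<open>Weak duality, integrated from \<open>cost_dual_le\<close>. The positive part appears
  because \<open>ennreal\<close> truncates negative values.\<close>

lemma dual_le_cost:
  assumes \<rho>: "\<rho> \<in> couplings \<mu> \<nu>" and f: "f \<in> Cb"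
  shows "ennreal (dual \<nu> f) \<le> (\<integral>\<^sup>+ p. c (fst p) (snd p) \<partial>\<rho>)"
proof -
  have M: "\<rho> \<in> prob_measures" and m: "distr \<rho> borel fst = \<mu>" "distr \<rho> borel snd = \<nu>"
    using \<rho> by (auto simp: couplings_def prob_measures_def)
  have fm: "fst \<in> borel_measurable (borel :: ('a \<times> 'a) measure)" and sm: "snd \<in> borel_measurable (borel :: ('a \<times> 'a) measure)"
    by (intro borel_measurable_continuous_onI continuous_intros)+
  obtain B where B: "\<And>y. \<bar>f y\<bar> \<le> B" using Cb_D[OF f] by blast
  have i1: "integrable \<rho> (\<lambda>p. S f (fst p))"
    using S_bound[OF f B] measurable_compose[OF fm S_borel[OF f]] by (intro integrable_bounded[OF M, where B=B]) auto
  have i2: "integrable \<rho> (\<lambda>p. f (snd p))"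
    using B measurable_compose[OF sm Cb_borel[OF f]] by (intro integrable_bounded[OF M, where B=B]) auto
  have i3: "integrable \<rho> (\<lambda>p. max 0 (S f (fst p) - f (snd p)))"
    using i1 i2 by (intro integrable_max) auto
  have "dual \<nu> f = (\<integral>p. S f (fst p) - f (snd p) \<partial>\<rho>)"
    unfolding m(1)[symmetric] m(2)[symmetric] using i1 i2 fm sm S_borel[OF f] Cb_borel[OF f]
    by (simp add: integral_distr prob_measuresD[OF M])
  also have "\<dots> \<le> (\<integral>p. max 0 (S f (fst p) - f (snd p)) \<partial>\<rho>)"
    using i1 i2 i3 by (intro integral_mono_bounded[OF M]) auto
  finally have "ennreal (dual \<nu> f) \<le> ennreal (\<integral>p. max 0 (S f (fst p) - f (snd p)) \<partial>\<rho>)"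
    by (rule ennreal_leI)
  also have "\<dots> = (\<integral>\<^sup>+ p. ennreal (max 0 (S f (fst p) - f (snd p))) \<partial>\<rho>)"
    by (rule nn_integral_eq_integral[symmetric, OF i3]) simp
  also have "\<dots> \<le> (\<integral>\<^sup>+ p. c (fst p) (snd p) \<partial>\<rho>)"
  proof (rule nn_integral_mono)
    fix p
    have "ennreal (max 0 (S f (fst p) - f (snd p))) = ennreal (S f (fst p) - f (snd p))"
      by (simp add: max_def ennreal_neg)
    then show "ennreal (max 0 (S f (fst p) - f (snd p))) \<le> c (fst p) (snd p)"
      using cost_dual_le[OF f, of "fst p" "snd p"] by simp
  qed
  finally show ?thesis .
qed

end

section \<open>Duality formula and level sets of the transport cost\<close>

context feller_LDP
begin

text \<open>Joins weak duality and attainment. The large deviation bounds, which are phrased with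
  \<open>dual\<close>, meet the transport cost only through this equivalence.\<close>

lemma transport_cost_le_iff:
  assumes "\<nu> \<in> prob_measures" "0 \<le> t"
  shows "transport_cost c \<mu> \<nu> \<le> ennreal t \<longleftrightarrow> (\<forall>f\<in>Cb. dual \<nu> f \<le> t)"
proof (intro iffI ballI)
  fix f :: "'a \<Rightarrow> real" assume le: "transport_cost c \<mu> \<nu> \<le> ennreal t" and f: "f \<in> Cb"
  have "ennreal (dual \<nu> f) \<le> transport_cost c \<mu> \<nu>"
    unfolding transport_cost_def by (intro INF_greatest dual_le_cost f)
  from order_trans[OF this le] show "dual \<nu> f \<le> t"
    using assms(2) by (simp add: ennreal_le_iff)
next
  assume "\<forall>f\<in>Cb. dual \<nu> f \<le> t"
  then obtain \<rho> where \<rho>: "\<rho> \<in> couplings \<mu> \<nu>" "(\<integral>\<^sup>+ p. c (fst p) (snd p) \<partial>\<rho>) \<le> ennreal t"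
    using coupling_of_dual_bound[OF assms(1)] by blast
  then show "transport_cost c \<mu> \<nu> \<le> ennreal t"
    unfolding transport_cost_def by (intro INF_lower2[OF \<rho>(1)])
qed

lemma S_zero_fun: "S (\<lambda>_. 0) = (\<lambda>_. 0)"
  by (rule ext) (rule S_zero)

theorem kantorovich_duality:
  assumes \<nu>: "\<nu> \<in> prob_measures"
  shows "enn2ereal (transport_cost c \<mu> \<nu>) = (SUP f\<in>Cb. ereal (dual \<nu> f))"
    (is "_ = ?R")
proof (rule antisym)
  have R0: "0 \<le> ?R"
    by (rule SUP_upper2[OF Cb_const[of 0]]) (simp add: S_zero_fun)
  show "enn2ereal (transport_cost c \<mu> \<nu>) \<le> ?R"
  proof (cases ?R)
    case (real t)
    have t: "0 \<le> t" using R0 unfolding real by simp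
    have "dual \<nu> f \<le> t" if "f \<in> Cb" for f
    proof -
      have "ereal (dual \<nu> f) \<le> ?R" by (rule SUP_upper[OF that])
      then show ?thesis unfolding real by simp
    qed
    then have "transport_cost c \<mu> \<nu> \<le> ennreal t" using transport_cost_le_iff[OF \<nu> t] by blast
    then have "enn2ereal (transport_cost c \<mu> \<nu>) \<le> ereal t"
      using t by (simp add: less_eq_ennreal.rep_eq enn2ereal_ennreal)
    then show ?thesis unfolding real .
  next
    case PInf
    then show ?thesis by simp
  next
    case MInf
    then show ?thesis using R0 by simp
  qed
  show "?R \<le> enn2ereal (transport_cost c \<mu> \<nu>)"
  proof (rule SUP_least)
    fix f :: "'a \<Rightarrow> real" assume f: "f \<in> Cb"
    let ?d = "dual \<nu> f"
    show "ereal ?d \<le> enn2ereal (transport_cost c \<mu> \<nu>)"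
    proof (cases "transport_cost c \<mu> \<nu>")
      case (real r)
      then have "?d \<le> r" using transport_cost_le_iff[OF \<nu>, of r] f by auto
      then show ?thesis using real by (simp add: enn2ereal_ennreal)
    qed simp
  qed
qed

lemma transport_cost_gt_iff:
  assumes "\<nu> \<in> prob_measures" "0 \<le> t"
  shows "ennreal t < transport_cost c \<mu> \<nu> \<longleftrightarrow> (\<exists>f\<in>Cb. t < dual \<nu> f)"
  using transport_cost_le_iff[OF assms] by (auto simp: not_le[symmetric])

text \<open>The complement of a finite level set is a union of subbasic open sets, one for each test
  function whose dual value exceeds the level.\<close>

lemma transport_cost_closed_levels: "closedin narrow_topology {\<nu> \<in> prob_measures. transport_cost c \<mu> \<nu> \<le> t}"
proof (cases t)
  case (real r)
  have "openin narrow_topology {\<nu> \<in> prob_measures. ennreal r < transport_cost c \<mu> \<nu>}"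
  proof -
    have "{\<nu> \<in> prob_measures. ennreal r < transport_cost c \<mu> \<nu>}
      = (\<Union>f\<in>Cb. {\<nu> \<in> prob_measures. (\<integral>y. f y \<partial>\<nu>) \<in> {..<(\<integral>x. S f x \<partial>\<mu>) - r}})"
      using transport_cost_gt_iff[OF _ \<open>0 \<le> r\<close>] by (auto simp: less_diff_eq add.commute)
    moreover have "openin narrow_topology (\<Union>f\<in>Cb. {\<nu> \<in> prob_measures. (\<integral>y. f y \<partial>\<nu>) \<in> {..<(\<integral>x. S f x \<partial>\<mu>) - r}})"
      by (rule openin_Union) (elim imageE, simp only:, rule openin_narrow_basic, assumption, rule open_lessThan)
    ultimately show ?thesis by (simp only:)
  qed
  moreover have "prob_measures - {\<nu> \<in> prob_measures. transport_cost c \<mu> \<nu> \<le> t}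
    = {\<nu> \<in> prob_measures. ennreal r < transport_cost c \<mu> \<nu>}"
    unfolding real by (auto simp: not_le)
  ultimately show ?thesis by (simp add: closedin_def topspace_narrow)
next
  case top
  then show ?thesis using closedin_topspace[of narrow_topology] by (simp add: topspace_narrow)
qed

end

lemma closed_in_narrow_borel:
  assumes "closedin narrow_topology C" shows "C \<in> narrow_borel"
proof -
  have "openin narrow_topology (prob_measures - C)" "C \<subseteq> prob_measures"
    using assms by (auto simp: closedin_def topspace_narrow)
  then have "prob_measures - (prob_measures - C) \<in> narrow_borel"
    unfolding narrow_borel_def by (intro sigma_sets.Compl sigma_sets.Basic) simp
  also have "prob_measures - (prob_measures - C) = C" using \<open>C \<subseteq> prob_measures\<close> by blast
  finally show ?thesis .
qed

section \<open>The large deviation principle for the empirical measures\<close>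

context particle_LDP
begin

theorem kn_LDP_empirical:
  "kn_LDP \<Omega> (\<lambda>k n \<omega>. empirical n (\<lambda>i. X k n i \<omega>)) (\<lambda>\<nu>. transport_cost c \<mu> \<nu>)"
  unfolding kn_LDP_def Let_def
proof (intro conjI allI ballI)
  show "closedin narrow_topology {\<nu> \<in> prob_measures. transport_cost c \<mu> \<nu> \<le> t}" for t
    by (rule transport_cost_closed_levels)
next
  fix B :: "'a measure set" assume B: "B \<in> narrow_borel"
  let ?p = "\<lambda>k n. ereal (1 / (real k * real n)) * eln (measure \<Omega> (event k n B))"
  have ev: "event k n A \<in> sets \<Omega>" if "A \<in> narrow_borel" "n \<ge> 1" for A k n
    using that X_measurable by (intro empirical_event_sets) auto
  show "liminf (\<lambda>k. liminf (\<lambda>n. ?p k n)) \<le> limsup (\<lambda>k. limsup (\<lambda>n. ?p k n))"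
  proof -
    have "liminf (\<lambda>k. liminf (\<lambda>n. ?p k n)) \<le> limsup (\<lambda>k. liminf (\<lambda>n. ?p k n))"
      by (rule Liminf_le_Limsup) simp
    also have "\<dots> \<le> limsup (\<lambda>k. limsup (\<lambda>n. ?p k n))"
      by (intro Limsup_mono always_eventually allI Liminf_le_Limsup) simp
    finally show ?thesis .
  qed
  show "- enn2ereal (INF \<nu>\<in>narrow_topology interior_of B. transport_cost c \<mu> \<nu>) \<le> liminf (\<lambda>k. liminf (\<lambda>n. ?p k n))"
    (is "- enn2ereal ?I \<le> ?L")
  proof (rule ccontr)
    assume "\<not> - enn2ereal ?I \<le> ?L"
    then obtain u where u: "?L < ereal u" "ereal u < - enn2ereal ?I" using ereal_dense2[of ?L "- enn2ereal ?I"] by (auto simp: not_le)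
    define s where "s = - u"
    have "enn2ereal ?I < ereal s"
      using u(2) ereal_less_uminus_reorder[of "ereal u" "enn2ereal ?I"] by (simp add: s_def)
    moreover have "0 \<le> enn2ereal ?I" by (rule enn2ereal_nonneg)
    ultimately have "0 < ereal s" by (rule le_less_trans[rotated])
    then have "?I < ennreal s"
      using \<open>enn2ereal ?I < ereal s\<close> by (simp add: less_ennreal.rep_eq enn2ereal_ennreal)
    then obtain \<nu> where \<nu>: "\<nu> \<in> narrow_topology interior_of B" "transport_cost c \<mu> \<nu> < ennreal s"
      by (auto simp: INF_less_iff)
    let ?U = "narrow_topology interior_of B"
    have U: "openin narrow_topology ?U" by (rule openin_interior_of)
    have \<nu>p: "\<nu> \<in> prob_measures" using \<nu>(1) openin_subset[OF U] by (auto simp: topspace_narrow)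
    obtain t where t: "transport_cost c \<mu> \<nu> = ennreal t" "0 \<le> t"
      using \<nu>(2) by (cases "transport_cost c \<mu> \<nu>") auto
    have "t < s" using \<nu>(2) t by (simp add: ennreal_less_iff)
    have dual: "dual \<nu> f \<le> t" if "f \<in> Cb" for f
      using transport_cost_le_iff[OF \<nu>p t(2)] t(1) that by simp
    have "\<forall>\<^sub>F k in sequentially. \<forall>\<^sub>F n in sequentially. exp (- (real k * real n * s))
      \<le> measure \<Omega> (event k n ?U)"
      by (rule lower_open[OF U \<nu>(1) dual \<open>t < s\<close>])
    then have "\<forall>\<^sub>F k in sequentially. ereal u \<le> liminf (\<lambda>n. ?p k n)"
      using eventually_gt_at_top[of 0]
    proof eventually_elim
      case (elim k)
      show ?case
      proof (rule Liminf_bounded)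
        show "\<forall>\<^sub>F n in sequentially. ereal u \<le> ?p k n"
          using elim(1) eventually_ge_at_top[of 1]
        proof eventually_elim
          fix n :: nat assume n: "1 \<le> n" and le: "exp (- (real k * real n * s))
            \<le> measure \<Omega> (event k n ?U)"
          note le
          also have "measure \<Omega> (event k n ?U)
            \<le> measure \<Omega> (event k n B)"
            using interior_of_subset[of narrow_topology B] by (intro Om.finite_measure_mono ev[OF B n]) auto
          finally show "ereal u \<le> ?p k n"
            using elim(2) n by (intro eln_ge) (simp_all add: s_def)
        qed
      qed
    qed
    then have "ereal u \<le> ?L" by (rule Liminf_bounded)
    with u(1) show False by simp
  qed
  show "limsup (\<lambda>k. limsup (\<lambda>n. ?p k n)) \<le> - enn2ereal (INF \<nu>\<in>narrow_topology closure_of B. transport_cost c \<mu> \<nu>)"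
    (is "?L \<le> - enn2ereal ?I")
  proof (rule ccontr)
    assume "\<not> ?L \<le> - enn2ereal ?I"
    then obtain u where u: "- enn2ereal ?I < ereal u" "ereal u < ?L" using ereal_dense2[of "- enn2ereal ?I" ?L] by (auto simp: not_le)
    \<comment> \<open>The upper bound for closed sets asks for a strict gap between the covering
      level \<open>- v\<close> and the decay rate \<open>- u\<close>.\<close>
    then obtain v where v: "- enn2ereal ?I < ereal v" "ereal v < ereal u" using ereal_dense2 by blast
    let ?C = "narrow_topology closure_of B"
    have C: "closedin narrow_topology ?C" by (rule closedin_closure_of)
    have vI: "ereal (- v) < enn2ereal ?I"
      using v(1) ereal_uminus_less_reorder[of "enn2ereal ?I" "ereal v"] by simp
    have cover: "\<exists>f\<in>Cb. - v < dual \<nu> f" if \<nu>: "\<nu> \<in> ?C" for \<nu>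
    \<comment> \<open>For a negative level \<open>ennreal (- v)\<close> would truncate to 0 and
      carry no information; the zero function, of dual value 0, covers this case.\<close>
    proof (cases "- v < 0")
      case True
      then show ?thesis by (intro bexI[of _ "\<lambda>_. 0"]) (simp_all add: S_zero_fun Cb_const)
    next
      case False
      have \<nu>p: "\<nu> \<in> prob_measures" using \<nu> closedin_subset[OF C] by (auto simp: topspace_narrow)
      have "ennreal (- v) < ?I" using vI False by (simp add: less_ennreal.rep_eq enn2ereal_ennreal)
      also have "?I \<le> transport_cost c \<mu> \<nu>" by (rule INF_lower[OF \<nu>])
      finally show ?thesis using transport_cost_gt_iff[OF \<nu>p, of "- v"] False by simp
    qed
    have "- u < - v" using v(2) by simp
    from upper_closed[OF C cover this]
    have "\<forall>\<^sub>F k in sequentially. \<forall>\<^sub>F n in sequentially.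
      measure \<Omega> (event k n ?C) \<le> exp (- (real k * real n * - u))" .
    then have "\<forall>\<^sub>F k in sequentially. limsup (\<lambda>n. ?p k n) \<le> ereal u"
      using eventually_gt_at_top[of 0]
    proof eventually_elim
      case (elim k)
      show ?case
      proof (rule Limsup_bounded)
        show "\<forall>\<^sub>F n in sequentially. ?p k n \<le> ereal u"
          using elim(1) eventually_ge_at_top[of 1]
        proof eventually_elim
          fix n :: nat assume n: "1 \<le> n" and le: "measure \<Omega> (event k n ?C)
            \<le> exp (- (real k * real n * - u))"
          have "B \<subseteq> prob_measures"
            using B unfolding narrow_borel_def
            by (rule sigma_sets_into_sp[rotated]) (auto simp: topspace_narrow[symmetric] dest: openin_subset)
          then have "B \<subseteq> ?C" by (intro closure_of_subset) (simp add: topspace_narrow)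
          then have "measure \<Omega> (event k n B)
            \<le> measure \<Omega> (event k n ?C)"
            by (intro Om.finite_measure_mono ev[OF closed_in_narrow_borel[OF C] n]) auto
          also note le
          finally show "?p k n \<le> ereal u"
            using elim(2) n by (intro eln_le) simp_all
        qed
      qed
    qed
    then have "?L \<le> ereal u" by (rule Limsup_bounded)
    with u(2) show False by simp
  qed
qed

end

text \<open>\<open>P k x\<close> stands for the law of U^k_x, since the hypotheses on these
  variables concern their laws only. Independence is required within each row \<open>k\<close>,
  \<open>n\<close>, while all rows share one probability space.\<close>

theorem mainTheorem1:
  fixes \<mu> :: "'a::euclidean_space measure"
    and z :: "nat \<Rightarrow> nat \<Rightarrow> 'a"
    and P :: "nat \<Rightarrow> 'a \<Rightarrow> 'a measure"
    and c :: "'a \<Rightarrow> 'a \<Rightarrow> ennreal"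
    and \<Omega> :: "'w measure"
    and X :: "nat \<Rightarrow> nat \<Rightarrow> nat \<Rightarrow> 'w \<Rightarrow> 'a"
  assumes mu: "\<mu> \<in> prob_measures"
    and z_conv: "narrow_conv (\<lambda>n. empirical n (z n)) \<mu>"
    and P_prob: "\<And>k x. P k x \<in> prob_measures"
    and P_feller: "\<And>k. feller (P k)"
    and P_LDP: "\<And>x. k_LDP (\<lambda>k. P k x) (c x)"
    and c_good: "\<And>x. good_rate_function (c x)"
    and Omega: "prob_space \<Omega>"
    and X_indep: "\<And>k n. prob_space.indep_vars \<Omega> (\<lambda>_. borel) (X k n) {1..n}"
    and X_law: "\<And>k n i. i \<in> {1..n} \<Longrightarrow> distr \<Omega> borel (X k n i) = P k (z n i)"
  shows
    "kn_LDP \<Omega> (\<lambda>k n \<omega>. empirical n (\<lambda>i. X k n i \<omega>)) (\<lambda>\<nu>. transport_cost c \<mu> \<nu>)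
     \<and> (\<forall>(Q :: nat \<Rightarrow> 'a measure) (c0 :: 'a \<Rightarrow> ennreal).
          (\<forall>k. Q k \<in> prob_measures) \<and> k_LDP Q c0 \<and> good_rate_function c0 \<and>
          (\<forall>k x. P k x = distr (Q k) borel (\<lambda>u. x + u))
          \<longrightarrow> (\<forall>x0 x1. c x0 x1 = c0 (x1 - x0)))
     \<and> (\<forall>\<nu>\<in>prob_measures.
          enn2ereal (transport_cost c \<mu> \<nu>) =
          (SUP f\<in>Cb. ereal ((\<integral>x0. real_of_ereal (S1 c f x0) \<partial>\<mu>) - (\<integral>x1. f x1 \<partial>\<nu>))))"
proof -
  interpret feller_LDP \<mu> P c
    by (rule feller_LDP.intro[OF mu P_prob P_feller P_LDP c_good])
  interpret particle_LDP \<mu> P c \<Omega> z X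
    by (rule particle_LDP.intro[OF feller_LDP_axioms Omega particle_LDP_axioms.intro[OF z_conv X_indep X_law]])
  show ?thesis
  proof (intro conjI allI impI ballI)
    show "kn_LDP \<Omega> (\<lambda>k n \<omega>. empirical n (\<lambda>i. X k n i \<omega>)) (\<lambda>\<nu>. transport_cost c \<mu> \<nu>)"
      by (rule kn_LDP_empirical)
  next
    fix Q :: "nat \<Rightarrow> 'a measure" and c0 :: "'a \<Rightarrow> ennreal" and x0 x1 :: 'a
    assume Q: "(\<forall>k. Q k \<in> prob_measures) \<and> k_LDP Q c0 \<and> good_rate_function c0 \<and>
      (\<forall>k x. P k x = distr (Q k) borel (\<lambda>u. x + u))"
    then have "k_LDP (\<lambda>k. distr (Q k) borel (\<lambda>u. x0 + u)) (c x0)" using P_LDP[of x0] by simp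
    with Q show "c x0 x1 = c0 (x1 - x0)" by (intro k_LDP_translate) auto
  next
    fix \<nu> :: "'a measure" assume "\<nu> \<in> prob_measures"
    from kantorovich_duality[OF this] show "enn2ereal (transport_cost c \<mu> \<nu>) =
      (SUP f\<in>Cb. ereal ((\<integral>x0. real_of_ereal (S1 c f x0) \<partial>\<mu>) - (\<integral>x1. f x1 \<partial>\<nu>)))"
      by (simp only: S_def[abs_def])
  qed
qed

end
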